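(* Let $\{x_{i,n}\}_{1\le i\le n}$ be a locally stationary time series with covariance function $\gamma(t,k)$, satisfying the UPDC condition, the short-range dependence condition with exponent $\tau>1$, and the smoothness condition of order $d$ (all defined in the context). Let $b=b(n)$ be the approximation order, and let $\phi_{0,n}(t),\phi_{1,n}(t),\dots,\phi_{b,n}(t)$ be the coefficient functions defined in the context. Then $\phi_{j,n}(t)\in C^d([0,1])$ for $0\le j\le b$. For $i>b$ put $\boldsymbol{\phi}_{i}=(\phi_{i1,n},\dots,\phi_{i,i-1,n})^*$ and $\boldsymbol{\phi}(\tfrac in)=(\phi_{1,n}(\tfrac in),\dots,\phi_{b,n}(\tfrac in),\mathbf 0)^*\in\mathbb{R}^{i-1}$. Then there exists a constant $C>0$ such that $$\max_{i>b}\Big|\boldsymbol{\phi}_i-\boldsymbol{\phi}(\tfrac in)\Big|\le C\Big((\log b)^{\tau-1}b^{-(\tau-1)}+\frac{b^2}{n}\Big).$$ Moreover, $$\max_{i>b}\Big|\phi_{i0,n}-\phi_{0,n}(\tfrac in)\Big|\le C\Big((\log b)^{\tau}b^{-(\tau-2)}+\frac{b^{2.5}}{n}\Big).$$ Finally, for $b+1\le i\le n$, $$x_{i,n}-\Big(\phi_{0,n}(\tfrac in)+\sum_{j=1}^b\phi_{j,n}(\tfrac in)x_{i-j,n}+\epsilon_{i,n}\Big)=O_{\ell^2}\Big((\log b)^{\tau}b^{-(\tau-2)}+\frac{b^{2.5}}{n}\Big),$$ and for all $1\le i\le n$, $$x_{i,n}-x_{i,n}^{**}=O_{\ell^2}\Big((\log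 b)^{\tau}b^{-(\tau-2)}+\frac{b^{2.5}}{n}\Big),$$ where $x^{**}_{i,n}=x_{i,n}$ for $i\le b$ and $x^{**}_{i,n}=\phi_{0,n}(\tfrac in)+\sum_{j=1}^b\phi_{j,n}(\tfrac in)x^{**}_{i-j,n}+\epsilon_{i,n}$ for $i>b$.
   Context: For each $n$, $x_{1,n},\dots,x_{n,n}$ are real random variables. $|\cdot|$ is the Euclidean norm, $^*$ on vectors is transpose. Constants do not depend on $n$. $y=O_{\ell^2}(a_n)$ means $(\mathbb{E}|y|^2)^{1/2}\le Ca_n$ for a finite constant $C$ (not depending on $i$ and $n$). Locally stationary (in covariance): there is a function $\gamma(t,k):[0,1]\times\mathbb{N}\to\mathbb{R}$ such that $\operatorname{Cov}(x_{i,n},x_{j,n})=\gamma(t_i,|i-j|)+O\big(\frac{|i-j|+1}{n}\big)$, $t_i=i/n$, uniformly in $i,j,n$; $\gamma$ is Lipschitz continuous in $t$ (with a Lipschitz constant not depending on $k$); and for any fixed $t$, $\gamma(t,\cdot)$ is the autocovariance function of a stationary process. UPDC condition: there is a universal constant $\kappa>0$ such that for all sufficiently large $n$ the smallest eigenvalue of $\operatorname{Cov}(x_{1,n},\dots,x_{n,n})$ is at least $\kappa$. Short-range dependence condition with exponent $\tau>1$: there is a constant $C>0$ independent of $n$ with $|\operatorname{Cov}(x_{k,n},x_{k+r,n})|\le C|r|^{-\tau}$ for all $n$, $1\le k\le n$, $-k+1\le r\le n-k$, $r\neq0$; also $\sup_{i,n}\mathbb{E}|x_{i,n}|<\infty$.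 Smoothness condition of order $d$ ($d>0$ a given integer): there is $\mu\in C^d([0,1])$ with $\mathbb{E}x_{i,n}=\mu(i/n)$, and $\gamma(\cdot,j)\in C^d([0,1])$ for every $j\ge0$. The best linear prediction (with intercept) of $x_{i,n}$ from all its predecessors is $\widehat x_{i,n}=\phi_{i0,n}+\sum_{j=1}^{i-1}\phi_{ij,n}x_{i-j,n}$, and $\epsilon_{i,n}=x_{i,n}-\widehat x_{i,n}$. Coefficient functions: $(\phi_{1,n}(t),\dots,\phi_{b,n}(t))^*=\Gamma(t)^{-1}\boldsymbol{\gamma}(t)$, where $\Gamma(t)\in\mathbb{R}^{b\times b}$ has entries $\Gamma_{ij}(t)=\gamma(t,|i-j|)$ and $\boldsymbol{\gamma}(t)\in\mathbb{R}^b$ has entries $\gamma(t,i)$, $i,j=1,\dots,b$ ($\Gamma(t)$ is invertible under UPDC); and $\phi_{0,n}(t)=\mu(t)-\sum_{j=1}^b\phi_{j,n}(t)\mu(t)$. The order $b=b(n)$ is a sequence of positive integers, $b<n$, diverging to infinity with $n$. *)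

theory Defs
  imports "HOL-Probability.Probability" "Jordan_Normal_Form.Spectral_Radius"
    "Jordan_Normal_Form.Gauss_Jordan_Elimination"
begin

text \<open>The triangular array is \<open>x n i\<close> with \<open>1 \<le> i \<le> n\<close>, where row \<open>n\<close> lives on the
  probability space \<open>M n\<close>; the values of \<open>x n i\<close> for other indices are irrelevant.\<close>

definition square_integrable :: "'w measure \<Rightarrow> ('w \<Rightarrow> real) \<Rightarrow> bool" where
  "square_integrable M X \<longleftrightarrow> X \<in> borel_measurable M \<and> integrable M (\<lambda>\<omega>. (X \<omega>)\<^sup>2)"

definition covariance :: "'w measure \<Rightarrow> ('w \<Rightarrow> real) \<Rightarrow> ('w \<Rightarrow> real) \<Rightarrow> real" where
  "covariance M X Y = (LINT \<omega>|M. (X \<omega> - (LINT \<omega>|M. X \<omega>)) * (Y \<omega> - (LINT \<omega>|M. Y \<omega>)))"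

definition second_order_array :: "(nat \<Rightarrow> 'w measure) \<Rightarrow> (nat \<Rightarrow> nat \<Rightarrow> 'w \<Rightarrow> real) \<Rightarrow> bool" where
  "second_order_array M x \<longleftrightarrow>
     (\<forall>n\<ge>1. prob_space (M n) \<and> (\<forall>i\<in>{1..n}. square_integrable (M n) (x n i)))"

definition weakly_stationary :: "'v measure \<Rightarrow> (int \<Rightarrow> 'v \<Rightarrow> real) \<Rightarrow> bool" where
  "weakly_stationary P X \<longleftrightarrow> prob_space P \<and> (\<forall>s. square_integrable P (X s)) \<and>
     (\<forall>s s'. (LINT \<omega>|P. X s \<omega>) = (LINT \<omega>|P. X s' \<omega>)) \<and>
     (\<forall>s s' k. covariance P (X s) (X (s + k)) = covariance P (X s') (X (s' + k)))"

text \<open>Fixing the sample space type to the path space \<open>int \<Rightarrow> real\<close> loses no generality,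
  since any process indexed by \<open>int\<close> can be replaced by its law on paths.\<close>

definition autocovariance_function :: "(nat \<Rightarrow> real) \<Rightarrow> bool" where
  "autocovariance_function g \<longleftrightarrow>
     (\<exists>(P :: (int \<Rightarrow> real) measure) X. weakly_stationary P X \<and>
        (\<forall>s k. covariance P (X s) (X (s + int k)) = g k))"

abbreviation lag :: "nat \<Rightarrow> nat \<Rightarrow> nat" where
  "lag i j \<equiv> nat \<bar>int i - int j\<bar>"

definition locally_stationary ::
  "(nat \<Rightarrow> 'w measure) \<Rightarrow> (nat \<Rightarrow> nat \<Rightarrow> 'w \<Rightarrow> real) \<Rightarrow> (real \<Rightarrow> nat \<Rightarrow> real) \<Rightarrow> bool" where
  "locally_stationary M x \<gamma> \<longleftrightarrow>
     (\<exists>C. \<forall>n. \<forall>i\<in>{1..n}. \<forall>j\<in>{1..n}.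
        \<bar>covariance (M n) (x n i) (x n j) - \<gamma> (real i / real n) (lag i j)\<bar>
          \<le> C * ((real (lag i j) + 1) / real n)) \<and>
     (\<exists>L. \<forall>k. L-lipschitz_on {0..1} (\<lambda>t. \<gamma> t k)) \<and>
     (\<forall>t\<in>{0..1}. autocovariance_function (\<gamma> t))"

definition covariance_matrix :: "'w measure \<Rightarrow> (nat \<Rightarrow> 'w \<Rightarrow> real) \<Rightarrow> nat \<Rightarrow> real Matrix.mat" where
  "covariance_matrix M X n =
     Matrix.mat n n (\<lambda>(i, j). covariance M (X (i + 1)) (X (j + 1)))"

definition UPDC :: "(nat \<Rightarrow> 'w measure) \<Rightarrow> (nat \<Rightarrow> nat \<Rightarrow> 'w \<Rightarrow> real) \<Rightarrow> bool" where
  "UPDC M x \<longleftrightarrow>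
     (\<exists>\<kappa>>0. \<forall>\<^sub>F n in sequentially. \<kappa> \<le> Min (spectrum (covariance_matrix (M n) (x n) n)))"

definition short_range_dependent ::
  "(nat \<Rightarrow> 'w measure) \<Rightarrow> (nat \<Rightarrow> nat \<Rightarrow> 'w \<Rightarrow> real) \<Rightarrow> real \<Rightarrow> bool" where
  "short_range_dependent M x \<tau> \<longleftrightarrow>
     (\<exists>C>0. \<forall>n. \<forall>k\<in>{1..n}. \<forall>r\<in>{- int k + 1..int n - int k} - {0}.
        \<bar>covariance (M n) (x n k) (x n (nat (int k + r)))\<bar> \<le> C * \<bar>of_int r\<bar> powr (- \<tau>)) \<and>
     bdd_above {LINT \<omega>|M n. \<bar>x n i \<omega>\<bar> | i n. 1 \<le> i \<and> i \<le> n}"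

text \<open>\<open>D m\<close> is the \<open>m\<close>-th derivative of \<open>f\<close> relative to \<open>S\<close>: one-sided at the endpoints
  of an interval.\<close>

definition continuously_differentiable_on :: "nat \<Rightarrow> real set \<Rightarrow> (real \<Rightarrow> real) \<Rightarrow> bool" where
  "continuously_differentiable_on d S f \<longleftrightarrow>
     (\<exists>D :: nat \<Rightarrow> real \<Rightarrow> real. (\<forall>t\<in>S. D 0 t = f t) \<and>
        (\<forall>m<d. \<forall>t\<in>S. (D m has_real_derivative D (Suc m) t) (at t within S)) \<and>
        continuous_on S (D d))"

definition smooth_of_order ::
  "nat \<Rightarrow> (nat \<Rightarrow> 'w measure) \<Rightarrow> (nat \<Rightarrow> nat \<Rightarrow> 'w \<Rightarrow> real) \<Rightarrow>
     (real \<Rightarrow> nat \<Rightarrow> real) \<Rightarrow> (real \<Rightarrow> real) \<Rightarrow> bool" where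
  "smooth_of_order d M x \<gamma> \<mu> \<longleftrightarrow>
     continuously_differentiable_on d {0..1} \<mu> \<and>
     (\<forall>n. \<forall>i\<in>{1..n}. (LINT \<omega>|M n. x n i \<omega>) = \<mu> (real i / real n)) \<and>
     (\<forall>j. continuously_differentiable_on d {0..1} (\<lambda>t. \<gamma> t j))"

definition linear_prediction ::
  "(nat \<Rightarrow> 'w \<Rightarrow> real) \<Rightarrow> nat \<Rightarrow> (nat \<Rightarrow> real) \<Rightarrow> 'w \<Rightarrow> real" where
  "linear_prediction X i c \<omega> = c 0 + (\<Sum>j=1..i - 1. c j * X (i - j) \<omega>)"

definition best_linear_prediction ::
  "'w measure \<Rightarrow> (nat \<Rightarrow> 'w \<Rightarrow> real) \<Rightarrow> nat \<Rightarrow> (nat \<Rightarrow> real) \<Rightarrow> bool" where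
  "best_linear_prediction M X i c \<longleftrightarrow>
     (\<forall>c'. (LINT \<omega>|M. (X i \<omega> - linear_prediction X i c \<omega>)\<^sup>2)
         \<le> (LINT \<omega>|M. (X i \<omega> - linear_prediction X i c' \<omega>)\<^sup>2))"

definition prediction_error ::
  "(nat \<Rightarrow> 'w \<Rightarrow> real) \<Rightarrow> nat \<Rightarrow> (nat \<Rightarrow> real) \<Rightarrow> 'w \<Rightarrow> real" where
  "prediction_error X i c \<omega> = X i \<omega> - linear_prediction X i c \<omega>"

text \<open>Matrix and vector indices start at \<open>0\<close>, hence the shifts by one.\<close>

definition Gamma_mat :: "(real \<Rightarrow> nat \<Rightarrow> real) \<Rightarrow> nat \<Rightarrow> real \<Rightarrow> real Matrix.mat" where
  "Gamma_mat \<gamma> b t = Matrix.mat b b (\<lambda>(i, j). \<gamma> t (lag i j))"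

definition gamma_vec :: "(real \<Rightarrow> nat \<Rightarrow> real) \<Rightarrow> nat \<Rightarrow> real \<Rightarrow> real Matrix.vec" where
  "gamma_vec \<gamma> b t = Matrix.vec b (\<lambda>i. \<gamma> t (i + 1))"

definition coef_vec :: "(real \<Rightarrow> nat \<Rightarrow> real) \<Rightarrow> nat \<Rightarrow> real \<Rightarrow> real Matrix.vec" where
  "coef_vec \<gamma> b t = mult_mat_vec (the (mat_inverse (Gamma_mat \<gamma> b t))) (gamma_vec \<gamma> b t)"

text \<open>Meaningful for \<open>j \<le> b\<close> only.\<close>

definition coef_fun ::
  "(real \<Rightarrow> nat \<Rightarrow> real) \<Rightarrow> (real \<Rightarrow> real) \<Rightarrow> nat \<Rightarrow> nat \<Rightarrow> real \<Rightarrow> real" where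
  "coef_fun \<gamma> \<mu> b j t =
     (if j = 0 then \<mu> t - (\<Sum>k=1..b. vec_index (coef_vec \<gamma> b t) (k - 1) * \<mu> t)
      else vec_index (coef_vec \<gamma> b t) (j - 1))"

text \<open>The autoregressive recursion of order \<open>b\<close> with coefficients \<open>c i j\<close> at time \<open>i\<close>,
  innovations \<open>e\<close> and initial values \<open>y\<close>.\<close>

fun ar_process ::
  "nat \<Rightarrow> (nat \<Rightarrow> nat \<Rightarrow> real) \<Rightarrow> (nat \<Rightarrow> real) \<Rightarrow> (nat \<Rightarrow> real) \<Rightarrow> nat \<Rightarrow> real" where
  "ar_process b c e y i =
     (if i \<le> b then y i
      else c i 0 + (\<Sum>j=1..b. c i j * ar_process b c e y (i - j)) + e i)"

declare ar_process.simps [simp del]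

text \<open>\<open>y n i = O(a n)\<close> in mean square, uniformly over \<open>i \<in> I n\<close> and \<open>n \<ge> n0\<close>.\<close>

definition bigO_l2 ::
  "(nat \<Rightarrow> 'w measure) \<Rightarrow> nat \<Rightarrow> (nat \<Rightarrow> nat set) \<Rightarrow> (nat \<Rightarrow> nat \<Rightarrow> 'w \<Rightarrow> real) \<Rightarrow>
     (nat \<Rightarrow> real) \<Rightarrow> bool" where
  "bigO_l2 M n0 I y a \<longleftrightarrow>
     (\<exists>C. \<forall>n\<ge>n0. \<forall>i\<in>I n. square_integrable (M n) (y n i) \<and>
        sqrt (LINT \<omega>|M n. \<bar>y n i \<omega>\<bar>\<^sup>2) \<le> C * a n)"

end

theory Submission
  imports Defs
begin

text \<open>Let \<open>A\<close> be symmetric with \<open>\<kappa> \<bar>u\<bar>\<^sup>2 \<le> u\<^sup>T A u\<close> and entries \<open>O((1 + \<bar>j - k\<bar>) powr (- \<tau>))\<close>. Conjugating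
  \<open>A u = f\<close> with the weights \<open>W = (1 + \<bar>c - k\<bar>) powr s\<close> leaves the commutator \<open>[A, W] u\<close>, which is a small multiple
  of \<open>W u\<close> plus lower order terms and can be absorbed by coercivity. With \<open>s = \<tau> / 2\<close> in mean square
  this bounds the columns of the inverse of \<open>A\<close> in the sum norm, and then with \<open>s = \<tau>\<close> in the sup norm it shows that
  solutions inherit the decay of the right-hand side. All constants are independent of the size of \<open>A\<close>.

  Both the predictor coefficients and the stationary coefficient functions therefore decay like \<open>j powr (- \<tau>)\<close>,
  and inserting the latter into the exact normal equations leaves a residual of sum norm
  \<open>O(b\<^sup>2 / n + b powr (1 - \<tau>))\<close>, which is even smaller than the claimed rates. For the autoregressive recursion, the exact
  predictors give a unit lower triangular \<open>L\<close> with \<open>L \<Sigma> L\<^sup>T = D\<close> diagonal, so \<open>\<Sigma> L\<^sup>T\<close>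
  inverts \<open>L\<close> up to the factor \<open>D\<close>, and its row sums are bounded uniformly in \<open>n\<close>. The order-\<open>b\<close> recursion is
  a perturbation of \<open>L\<close> that tends to \<open>0\<close> in the row-sum norm, whatever the growth of \<open>b\<close>.
  The finitely many remaining \<open>n\<close> only affect the constants, because both rates are positive.\<close>

section \<open>Polynomially decaying kernels\<close>

text \<open>Far commutator entries produce a kernel of exponent \<tau> - s that no longer carries
  the weight. For s = \<tau> this kernel is merely bounded, so it has to be paired with the sum norm
  of the solution, which is not known beforehand; this forces the two stages. For s = \<tau> / 2 the
  squares of the reciprocal weight and of the far kernel are both \<open>decay \<tau>\<close>, hence
  summable: the weighted mean-square norm then controls the sum norm, and the far term becomes a
  small multiple of the very norm being estimated.

  UPDC speaks only about the array. The stationary matrices inherit the same constant \<kappa> as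
  limits of covariance blocks, so one set of estimates serves both systems.

  The residual estimate has two free cutoffs N and J and is used twice. N = J = b gives the rate.
  Fixed N and J make the coefficient difference as small as desired for large n, which the stability
  of the recursion needs because b^2 / n may fail to tend to 0.\<close>

definition decay :: "real \<Rightarrow> nat \<Rightarrow> real" where
  "decay \<tau> m = (1 + real m) powr (- \<tau>)"

text \<open>The tail kernel. The cutoff is strict, so its total mass starts at
  \<open>Suc N\<close>.\<close>

definition decay_from :: "real \<Rightarrow> nat \<Rightarrow> nat \<Rightarrow> real" where
  "decay_from \<tau> N m = (if N < m then decay \<tau> m else 0)"

lemma decay_pos [simp]: "0 < decay \<tau> m"
  by (simp add: decay_def add_pos_nonneg)

lemma decay_nonneg [simp]: "0 \<le> decay \<tau> m"
  by (simp add: decay_def)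

lemma decay_from_nonneg [simp]: "0 \<le> decay_from \<tau> N m"
  by (simp add: decay_from_def)

lemma decay_0 [simp]: "decay \<tau> 0 = 1"
  by (simp add: decay_def)

lemma decay_le_1: "0 \<le> \<tau> \<Longrightarrow> decay \<tau> m \<le> 1"
  unfolding decay_def by (simp add: powr_minus field_simps ge_one_powr_ge_zero)

lemma decay_mult: "decay s m * decay t m = decay (s + t) m"
  by (simp add: decay_def powr_add[symmetric])

lemma decay_power2: "(decay s m)\<^sup>2 = decay (2 * s) m"
  by (simp only: power2_eq_square decay_mult mult_2)

lemma summable_decay:
  assumes "1 < \<tau>"
  shows "summable (decay \<tau>)"
proof -
  have "summable (\<lambda>n. real n powr (- \<tau>))"
    using assms by (simp add: summable_real_powr_iff)
  then have "summable (\<lambda>n. real (Suc n) powr (- \<tau>))"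
    by (subst summable_Suc_iff)
  then show ?thesis
    by (simp add: decay_def[abs_def] add.commute)
qed

lemma summable_decay_from:
  assumes "1 < \<tau>"
  shows "summable (decay_from \<tau> N)"
  by (rule summable_comparison_test'[OF summable_decay[OF assms], of 0])
    (simp add: decay_from_def)

lemma suminf_decay_ge_1: "1 < \<tau> \<Longrightarrow> 1 \<le> suminf (decay \<tau>)"
  using sum_le_suminf[OF summable_decay, of \<tau> "{0}"] by simp

lemma sum_decay_le: "1 < \<tau> \<Longrightarrow> finite I \<Longrightarrow> (\<Sum>m\<in>I. decay \<tau> m) \<le> suminf (decay \<tau>)"
  by (rule sum_le_suminf[OF summable_decay]) auto

lemma suminf_decay_from_nonneg: "1 < \<tau> \<Longrightarrow> 0 \<le> suminf (decay_from \<tau> N)"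
  by (rule suminf_nonneg[OF summable_decay_from]) auto

lemma suminf_decay_from:
  assumes "1 < \<tau>"
  shows "suminf (decay_from \<tau> N) = (\<Sum>m. decay \<tau> (m + Suc N))"
proof -
  have "suminf (decay_from \<tau> N) = (\<Sum>m. decay_from \<tau> N (m + Suc N)) + (\<Sum>m<Suc N. decay_from \<tau> N m)"
    by (rule suminf_split_initial_segment[OF summable_decay_from[OF assms]])
  moreover have "(\<Sum>m<Suc N. decay_from \<tau> N m) = 0"
    by (rule sum.neutral) (auto simp: decay_from_def)
  ultimately show ?thesis
    by (simp add: decay_from_def)
qed

lemma suminf_decay_from_tendsto_0:
  assumes "1 < \<tau>"
  shows "(\<lambda>N. suminf (decay_from \<tau> N)) \<longlonglongrightarrow> 0"
proof (rule LIMSEQ_I)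
  fix r :: real assume "0 < r"
  from suminf_exist_split[OF this summable_decay[OF assms]]
  obtain N where N: "\<And>n. N \<le> n \<Longrightarrow> norm (\<Sum>i. decay \<tau> (i + n)) < r"
    by auto
  show "\<exists>no. \<forall>n\<ge>no. norm (suminf (decay_from \<tau> n) - 0) < r"
    using N by (intro exI[of _ N] allI impI) (metis suminf_decay_from[OF assms] diff_zero le_SucI)
qed

text \<open>Integral comparison in discrete form. On [m, m + 1] the derivative of y powr (1 -
  \<tau>) has absolute value (\<tau> - 1) * y powr (- \<tau>), which is smallest at the right end,
  and that value is \<open>decay \<tau> m\<close> up to the factor \<tau> - 1.\<close>

lemma decay_le_telescope:
  assumes "1 < \<tau>" "0 < m"
  shows "decay \<tau> m \<le> (real m powr (1 - \<tau>) - (1 + real m) powr (1 - \<tau>)) / (\<tau> - 1)"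
proof -
  have "\<exists>z. real m < z \<and> z < real m + 1 \<and>
      (real m + 1) powr (1 - \<tau>) - real m powr (1 - \<tau>)
        = (real m + 1 - real m) * ((1 - \<tau>) * z powr (1 - \<tau> - 1))"
    using assms by (intro MVT2) (auto intro!: derivative_eq_intros)
  then obtain z where z: "real m < z" "z < real m + 1"
    and eq: "(real m + 1) powr (1 - \<tau>) - real m powr (1 - \<tau>) = (1 - \<tau>) * z powr (- \<tau>)"
    by auto
  have "(real m + 1) powr (- \<tau>) \<le> z powr (- \<tau>)"
    using z assms by (intro powr_mono2') auto
  then have "(\<tau> - 1) * decay \<tau> m \<le> (\<tau> - 1) * z powr (- \<tau>)"
    using assms by (intro mult_left_mono) (simp_all add: decay_def add.commute)
  also have "\<dots> = real m powr (1 - \<tau>) - (1 + real m) powr (1 - \<tau>)"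
    using eq by (simp add: algebra_simps)
  finally show ?thesis
    using assms by (simp add: field_simps)
qed

lemma suminf_decay_from_le:
  assumes "1 < \<tau>"
  shows "suminf (decay_from \<tau> N) \<le> (1 + real N) powr (1 - \<tau>) / (\<tau> - 1)"
proof -
  \<comment> \<open>The sign makes the increments of \<open>h\<close> the positive bounds of the
    preceding lemma. Since \<open>h\<close> tends to 0, they add up to \<open>- h 0\<close>, the
    claimed value.\<close>
  define h where "h = (\<lambda>m. - (real (m + Suc N) powr (1 - \<tau>)) / (\<tau> - 1))"
  have "(\<lambda>m. real (m + Suc N) powr (1 - \<tau>)) \<longlonglongrightarrow> 0"
    using assms
    by (intro LIMSEQ_ignore_initial_segment[where f = "\<lambda>m. real m powr (1 - \<tau>)"]
        tendsto_neg_powr filterlim_real_sequentially) auto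
  then have "h \<longlonglongrightarrow> - 0 / (\<tau> - 1)"
    unfolding h_def using assms by (intro tendsto_intros) auto
  then have s: "(\<lambda>m. h (Suc m) - h m) sums (0 - h 0)"
    using telescope_sums[of h 0] by simp
  have "(\<Sum>m. decay \<tau> (m + Suc N)) \<le> (\<Sum>m. h (Suc m) - h m)"
  proof (rule suminf_le)
    fix m
    show "decay \<tau> (m + Suc N) \<le> h (Suc m) - h m"
      using decay_le_telescope[OF assms, of "m + Suc N"] 
      by (simp add: h_def diff_divide_distrib add_ac)
    next
    show "summable (\<lambda>m. decay \<tau> (m + Suc N))"
      by (rule summable_ignore_initial_segment[OF summable_decay[OF assms]])
    show "summable (\<lambda>m. h (Suc m) - h m)"
      by (rule sums_summable[OF s])
  qed
  also have "\<dots> = (1 + real N) powr (1 - \<tau>) / (\<tau> - 1)"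
    using s by (simp add: sums_iff h_def)
  finally show ?thesis
    by (simp add: suminf_decay_from[OF assms])
qed

section \<open>Lags, convolutions and commutators with weights\<close>

lemma lag_commute: "lag i j = lag j i"
  by simp

lemma lag_triangle: "lag i k \<le> lag i j + lag j k"
  by linarith

text \<open>Around a fixed k each lag occurs at most once to the left and once to the right, hence
  the factor 2.\<close>

lemma sum_lag_le:
  fixes a :: "nat \<Rightarrow> real"
  assumes "finite I" "summable a" "\<And>m. 0 \<le> a m"
  shows "(\<Sum>l\<in>I. a (lag k l)) \<le> 2 * suminf a"
proof -
  have *: "(\<Sum>l\<in>J. a (lag k l)) \<le> suminf a" if "finite J" "inj_on (\<lambda>l. lag k l) J" for J
  proof -
    have "(\<Sum>l\<in>J. a (lag k l)) = sum a ((\<lambda>l. lag k l) ` J)"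
      by (simp add: sum.reindex[OF that(2)])
    also have "\<dots> \<le> suminf a"
      using assms that by (intro sum_le_suminf) auto
    finally show ?thesis .
  qed
  have "(\<Sum>l\<in>I. a (lag k l)) = (\<Sum>l\<in>{l\<in>I. l \<le> k}. a (lag k l)) + (\<Sum>l\<in>{l\<in>I. k < l}. a (lag k l))"
    using assms(1) by (subst sum.union_disjoint[symmetric]) (auto intro!: sum.cong)
  also have "\<dots> \<le> suminf a + suminf a"
    using assms(1) by (intro add_mono *) (auto simp: inj_on_def)
  finally show ?thesis by simp
qed

text \<open>By the triangle inequality one of the two lags is at least half of
  \<open>lag k c\<close>. Its factor is replaced by
  \<open>2 powr \<tau> * decay \<tau> (lag k c)\<close> and the other factor stays, whichever it
  is.\<close>

lemma decay_mult_lag_le: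
  assumes "0 \<le> \<tau>"
  shows "decay \<tau> (lag k l) * decay \<tau> (lag l c)
    \<le> 2 powr \<tau> * decay \<tau> (lag k c) * (decay \<tau> (lag k l) + decay \<tau> (lag l c))"
proof -
  have half: "decay \<tau> m \<le> 2 powr \<tau> * decay \<tau> (lag k c)" if "lag k c \<le> 2 * m" for m
  proof -
    have "1 + real (lag k c) \<le> 2 * (1 + real m)"
      using that of_nat_le_iff[of "lag k c" "2 * m", where 'a = real]
      by (simp del: of_nat_le_iff)
    then have "(1 + real (lag k c)) powr \<tau> \<le> (2 * (1 + real m)) powr \<tau>"
      using assms by (intro powr_mono2) auto
    also have "\<dots> = 2 powr \<tau> * (1 + real m) powr \<tau>"
      by (rule powr_mult)
    finally have "(1 + real (lag k c)) powr \<tau> \<le> 2 powr \<tau> * (1 + real m) powr \<tau>" .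
    moreover have "0 < (1 + real (lag k c)) powr \<tau>" "0 < (1 + real m) powr \<tau>"
      by (simp_all add: add_pos_nonneg)
    ultimately show ?thesis
      unfolding decay_def powr_minus by (simp add: field_simps)
  qed
  have "lag k c \<le> 2 * lag k l \<or> lag k c \<le> 2 * lag l c"
    using lag_triangle[of k c l] by linarith
  then show ?thesis
  proof
    assume "lag k c \<le> 2 * lag k l"
    from half[OF this] have "decay \<tau> (lag k l) * decay \<tau> (lag l c)
        \<le> 2 powr \<tau> * decay \<tau> (lag k c) * decay \<tau> (lag l c)"
      by (intro mult_right_mono) auto
    also have "\<dots> \<le> 2 powr \<tau> * decay \<tau> (lag k c) * (decay \<tau> (lag k l) + decay \<tau> (lag l c))"
      by (intro mult_left_mono) auto
    finally show ?thesis .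
  next
    assume "lag k c \<le> 2 * lag l c"
    from half[OF this] have "decay \<tau> (lag k l) * decay \<tau> (lag l c)
        \<le> decay \<tau> (lag k l) * (2 powr \<tau> * decay \<tau> (lag k c))"
      by (intro mult_left_mono) auto
    also have "\<dots> \<le> 2 powr \<tau> * decay \<tau> (lag k c) * (decay \<tau> (lag k l) + decay \<tau> (lag l c))"
      by (simp add: algebra_simps)
    finally show ?thesis .
  qed
qed

text \<open>The decay class is closed under matrix products. This is what keeps the residual of the
  truncated equations decaying at large lags.\<close>

lemma decay_convolution_le:
  assumes "1 < \<tau>" "finite I"
  shows "(\<Sum>l\<in>I. decay \<tau> (lag k l) * decay \<tau> (lag l c))
    \<le> 4 * 2 powr \<tau> * suminf (decay \<tau>) * decay \<tau> (lag k c)"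
proof -
  let ?P = "2 powr \<tau> * decay \<tau> (lag k c)"
  have "(\<Sum>l\<in>I. decay \<tau> (lag k l) * decay \<tau> (lag l c))
      \<le> (\<Sum>l\<in>I. ?P * (decay \<tau> (lag k l) + decay \<tau> (lag c l)))"
    using decay_mult_lag_le[of \<tau> k _ c] assms(1) by (intro sum_mono) (simp add: lag_commute[of c])
  also have "\<dots> = ?P * ((\<Sum>l\<in>I. decay \<tau> (lag k l)) + (\<Sum>l\<in>I. decay \<tau> (lag c l)))"
    by (simp add: sum_distrib_left sum.distrib distrib_left)
  also have "\<dots> \<le> ?P * (2 * suminf (decay \<tau>) + 2 * suminf (decay \<tau>))"
    using assms summable_decay by (intro mult_left_mono add_mono sum_lag_le) auto
  finally show ?thesis
    by (simp add: algebra_simps)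
qed

text \<open>Uniform continuity of \<open>y \<mapsto> y powr s\<close> near \<open>1\<close> handles weights far from the
  center; the remaining ones are bounded.\<close>

lemma powr_diff_le:
  fixes s \<epsilon> :: real and N :: nat
  assumes "0 < s" "0 < \<epsilon>"
  obtains K where "0 \<le> K"
    "\<And>a a'. 1 \<le> a \<Longrightarrow> 1 \<le> a' \<Longrightarrow> \<bar>a - a'\<bar> \<le> real N \<Longrightarrow> \<bar>a powr s - a' powr s\<bar> \<le> \<epsilon> * a' powr s + K"
proof -
  have "isCont (\<lambda>y::real. y powr s) 1"
    by (intro continuous_intros) auto
  then obtain \<delta> where \<delta>: "0 < \<delta>" "\<And>y::real. \<bar>y - 1\<bar> < \<delta> \<Longrightarrow> \<bar>y powr s - 1\<bar> < \<epsilon>"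
    using assms(2) unfolding continuous_at_real_range by (auto simp: real_norm_def)
  \<comment> \<open>For a' > R the ratio a / a' differs from 1 by at most N / a' < \<delta>. The
    summand 1 makes the inequality strict and R positive.\<close>
  define R where "R = real N / \<delta> + 1"
  have R: "0 < R" "real N < R * \<delta>"
    using \<delta>(1) by (auto simp: R_def field_simps add_pos_nonneg)
  show ?thesis
  proof
    \<comment> \<open>The witness for K: if a' \<le> R, then both a and a' are at most R +
      N.\<close>
    show "0 \<le> (R + real N) powr s" by simp
    fix a a' :: real
    assume a: "1 \<le> a" "1 \<le> a'" "\<bar>a - a'\<bar> \<le> real N"
    show "\<bar>a powr s - a' powr s\<bar> \<le> \<epsilon> * a' powr s + (R + real N) powr s"
    proof (cases "a' \<le> R")
      case True
      have "a powr s \<le> (R + real N) powr s" "a' powr s \<le> (R + real N) powr s"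
        using a True assms by (auto intro!: powr_mono2)
      moreover have "0 \<le> a powr s" "0 \<le> a' powr s" "0 \<le> \<epsilon> * a' powr s"
        using assms by auto
      ultimately show ?thesis by linarith
    next
      case False
      have "\<bar>a / a' - 1\<bar> = \<bar>a - a'\<bar> / a'"
      proof -
        have "a / a' - 1 = (a - a') / a'"
          using a by (simp add: field_simps)
        with a show ?thesis by simp
      qed
      also have "\<dots> < \<delta>"
      proof -
        have "R * \<delta> \<le> a' * \<delta>"
          using False \<delta>(1) by (intro mult_right_mono) auto
        then have "\<bar>a - a'\<bar> < \<delta> * a'"
          using a(3) R(2) by (simp add: mult.commute)
        then show ?thesis
          using a(2) by (subst pos_divide_less_eq) auto
      qed
      finally have "\<bar>(a / a') powr s - 1\<bar> < \<epsilon>"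
        by (rule \<delta>(2))
      then have "\<bar>(a / a') powr s - 1\<bar> * a' powr s \<le> \<epsilon> * a' powr s"
        by (intro mult_right_mono) auto
      moreover have "\<bar>(a / a') powr s - 1\<bar> * a' powr s = \<bar>a powr s - a' powr s\<bar>"
      proof -
        have "((a / a') powr s - 1) * a' powr s = a powr s - a' powr s"
          using a by (simp add: powr_divide left_diff_distrib)
        then show ?thesis
          by (metis abs_mult abs_of_nonneg powr_ge_zero)
      qed
      ultimately show ?thesis
        using powr_ge_zero[of "R + real N" s] by linarith
    qed
  qed
qed

text \<open>Here \<open>decay (- s) m\<close> is the growing weight (1 + m) powr s. Up to lag N the
  weight varies slowly, which costs \<epsilon> times the weight plus a constant. Beyond N the
  difference is at most 2 powr s times the sum of the weight and (1 + lag) powr s, and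
  \<open>decay \<tau>\<close> turns the latter into a kernel of exponent \<tau> - s. All terms that
  carry the weight have coefficients that \<epsilon> and N make small.\<close>

lemma commutator_kernel_le:
  fixes s \<epsilon> :: real and N :: nat
  assumes "0 < s" "0 < \<epsilon>"
  obtains K where "0 \<le> K"
    "\<And>c k l. decay \<tau> (lag k l) * \<bar>decay (- s) (lag c k) - decay (- s) (lag c l)\<bar>
      \<le> (\<epsilon> * decay \<tau> (lag k l) + 2 powr s * decay_from \<tau> N (lag k l)) * decay (- s) (lag c l)
        + K * decay \<tau> (lag k l) + 2 powr s * decay_from (\<tau> - s) N (lag k l)"
proof -
  obtain K where K: "0 \<le> K"
    "\<And>a a'. 1 \<le> a \<Longrightarrow> 1 \<le> a' \<Longrightarrow> \<bar>a - a'\<bar> \<le> real N \<Longrightarrow> \<bar>a powr s - a' powr s\<bar> \<le> \<epsilon> * a' powr s + K"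
    using powr_diff_le[OF assms, of N] by metis
  show ?thesis
  proof (rule that[OF K(1)])
    fix c k l
    let ?a = "1 + real (lag c k)" and ?a' = "1 + real (lag c l)" and ?m = "lag k l"
    have aa: "\<bar>?a - ?a'\<bar> \<le> real ?m"
      using lag_triangle[of c k l] lag_triangle[of c l k] lag_commute[of k l] by linarith
    show "decay \<tau> ?m * \<bar>decay (- s) (lag c k) - decay (- s) (lag c l)\<bar>
      \<le> (\<epsilon> * decay \<tau> ?m + 2 powr s * decay_from \<tau> N ?m) * decay (- s) (lag c l)
        + K * decay \<tau> ?m + 2 powr s * decay_from (\<tau> - s) N ?m"
    proof (cases "?m \<le> N")
      case True
      have "\<bar>?a powr s - ?a' powr s\<bar> \<le> \<epsilon> * ?a' powr s + K"
        using aa True by (intro K(2)) auto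
      then have "decay \<tau> ?m * \<bar>?a powr s - ?a' powr s\<bar> \<le> decay \<tau> ?m * (\<epsilon> * ?a' powr s + K)"
        by (rule mult_left_mono) simp
      with True show ?thesis
        by (simp add: decay_from_def decay_def[of "- s"] algebra_simps)
    next
      case False
      have "\<bar>?a powr s - ?a' powr s\<bar> \<le> 2 powr s * (?a' powr s + (1 + real ?m) powr s)"
      proof -
        define z where "z = max ?a' (1 + real ?m)"
        have "?a' \<le> z" "1 + real ?m \<le> z"
          by (simp_all only: z_def max.cobounded1 max.cobounded2)
        then have z: "?a \<le> 2 * z" "?a' \<le> 2 * z" "0 \<le> z"
          using aa by linarith+
        have "?a powr s \<le> (2 * z) powr s" "?a' powr s \<le> (2 * z) powr s"
          using z assms(1) by (auto intro!: powr_mono2)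
        then have "\<bar>?a powr s - ?a' powr s\<bar> \<le> (2 * z) powr s"
          using powr_ge_zero[of ?a s] powr_ge_zero[of ?a' s] by linarith
        also have "\<dots> = 2 powr s * z powr s"
          using z by (simp add: powr_mult)
        also have "z powr s \<le> ?a' powr s + (1 + real ?m) powr s"
          by (auto simp: z_def max_def)
        finally show ?thesis by simp
      qed
      then have "decay \<tau> ?m * \<bar>?a powr s - ?a' powr s\<bar>
          \<le> decay \<tau> ?m * (2 powr s * (?a' powr s + (1 + real ?m) powr s))"
        by (rule mult_left_mono) simp
      also have "\<dots> = 2 powr s * decay \<tau> ?m * ?a' powr s + 2 powr s * decay (\<tau> - s) ?m"
        using decay_mult[of \<tau> ?m "- s"] by (simp add: decay_def[of "- s"] algebra_simps)
      also have "\<dots> \<le> (\<epsilon> * decay \<tau> ?m + 2 powr s * decay \<tau> ?m) * ?a' powr s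
          + K * decay \<tau> ?m + 2 powr s * decay (\<tau> - s) ?m"
      proof -
        have "0 \<le> \<epsilon> * decay \<tau> ?m * ?a' powr s" "0 \<le> K * decay \<tau> ?m"
          using assms K(1) by auto
        then show ?thesis
          by (simp add: algebra_simps)
      qed
      finally show ?thesis
        using False by (simp add: decay_from_def decay_def[of "- s"])
    qed
  qed
qed

section \<open>Coercive matrices with off-diagonal decay\<close>

text \<open>Formulated for functions on an arbitrary index set rather than for matrices, so that
  principal blocks, shifted or reversed, are obtained by reindexing.\<close>

definition coercive :: "real \<Rightarrow> 'a set \<Rightarrow> ('a \<Rightarrow> 'a \<Rightarrow> real) \<Rightarrow> bool" where
  "coercive \<kappa> I A \<longleftrightarrow>
     (\<forall>u. \<kappa> * (\<Sum>k\<in>I. (u k)\<^sup>2) \<le> (\<Sum>j\<in>I. \<Sum>k\<in>I. A j k * u j * u k))"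

lemma coerciveD:
  "coercive \<kappa> I A \<Longrightarrow> \<kappa> * (\<Sum>k\<in>I. (u k)\<^sup>2) \<le> (\<Sum>j\<in>I. \<Sum>k\<in>I. A j k * u j * u k)"
  by (auto simp: coercive_def)

text \<open>Cauchy-Schwarz for the pairing of A u with u, divided by the norm of u.\<close>

lemma coercive_L2_set:
  assumes "coercive \<kappa> I A"
  shows "\<kappa> * L2_set u I \<le> L2_set (\<lambda>j. \<Sum>k\<in>I. A j k * u k) I"
proof (cases "L2_set u I = 0")
  case False
  then have pos: "0 < L2_set u I"
    by (simp add: order_less_le)
  have "\<kappa> * L2_set u I * L2_set u I = \<kappa> * (\<Sum>k\<in>I. (u k)\<^sup>2)"
    by (simp add: L2_set_def sum_nonneg)
  also have "\<dots> \<le> (\<Sum>j\<in>I. \<Sum>k\<in>I. A j k * u j * u k)"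
    by (rule coerciveD[OF assms])
  also have "\<dots> = (\<Sum>j\<in>I. (\<Sum>k\<in>I. A j k * u k) * u j)"
    by (simp add: sum_distrib_left sum_distrib_right mult_ac)
  also have "\<dots> \<le> (\<Sum>j\<in>I. \<bar>\<Sum>k\<in>I. A j k * u k\<bar> * \<bar>u j\<bar>)"
    by (intro sum_mono) (simp add: abs_mult[symmetric])
  also have "\<dots> \<le> L2_set (\<lambda>j. \<Sum>k\<in>I. A j k * u k) I * L2_set u I"
    by (rule L2_set_mult_ineq)
  finally show ?thesis
    using pos by simp
qed simp

lemma coercive_injective:
  assumes "coercive \<kappa> I A" "0 < \<kappa>" "finite I"
    and "\<And>j. j \<in> I \<Longrightarrow> (\<Sum>k\<in>I. A j k * u k) = 0" and "k \<in> I"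
  shows "u k = 0"
proof -
  have "L2_set (\<lambda>j. \<Sum>k\<in>I. A j k * u k) I = 0"
    using assms(4) by (intro L2_set_0') auto
  then have "\<kappa> * L2_set u I \<le> 0"
    using coercive_L2_set[OF assms(1), of u] by simp
  then have "L2_set u I = 0"
    using assms(2) L2_set_nonneg[of u I] by (simp add: mult_le_0_iff)
  with assms show ?thesis
    by (simp add: L2_set_eq_0_iff)
qed

text \<open>Test vectors on \<open>I\<close> are transported along \<open>f\<close> and extended by
  zero to \<open>J\<close>. The uses are shifted blocks \<open>p n + j\<close> and the predecessors
  \<open>i - k\<close> in reversed order.\<close>

lemma coercive_reindex:
  fixes f :: "'a \<Rightarrow> 'b"
  assumes "coercive \<kappa> J S" "inj_on f I" "f ` I \<subseteq> J" "finite J"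
  shows "coercive \<kappa> I (\<lambda>j k. S (f j) (f k))"
  unfolding coercive_def
proof
  fix u :: "'a \<Rightarrow> real"
  define v :: "'b \<Rightarrow> real" where "v = (\<lambda>y. if y \<in> f ` I then u (the_inv_into I f y) else 0)"
  have v: "v (f k) = u k" if "k \<in> I" for k
    using that assms(2) by (simp add: v_def the_inv_into_f_f)
  have red: "(\<Sum>y\<in>J. g y) = (\<Sum>k\<in>I. g (f k))" if "\<And>y. v y = 0 \<Longrightarrow> g y = 0" for g :: "'b \<Rightarrow> real"
  proof -
    have "(\<Sum>y\<in>J. g y) = (\<Sum>y\<in>f ` I. g y)"
      using assms by (intro sum.mono_neutral_right) (auto intro!: that simp: v_def)
    also have "\<dots> = (\<Sum>k\<in>I. g (f k))"
      by (simp add: sum.reindex[OF assms(2)])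
    finally show ?thesis .
  qed
  have "\<kappa> * (\<Sum>y\<in>J. (v y)\<^sup>2) \<le> (\<Sum>y\<in>J. \<Sum>z\<in>J. S y z * v y * v z)"
    by (rule coerciveD[OF assms(1)])
  also have "\<dots> = (\<Sum>j\<in>I. \<Sum>z\<in>J. S (f j) z * v (f j) * v z)"
    by (rule red) simp
  also have "\<dots> = (\<Sum>j\<in>I. \<Sum>k\<in>I. S (f j) (f k) * v (f j) * v (f k))"
    by (intro sum.cong refl red) simp
  finally have "\<kappa> * (\<Sum>k\<in>I. (v (f k))\<^sup>2) \<le> (\<Sum>j\<in>I. \<Sum>k\<in>I. S (f j) (f k) * v (f j) * v (f k))"
    by (subst (asm) red) auto
  then show "\<kappa> * (\<Sum>k\<in>I. (u k)\<^sup>2) \<le> (\<Sum>j\<in>I. \<Sum>k\<in>I. S (f j) (f k) * u j * u k)"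
    by (simp add: v)
qed

section \<open>Invertibility of coercive matrices\<close>

lemma sum_lessThan_shift: "(\<Sum>k\<in>{0..<m}. g (Suc k)) = (\<Sum>k=1..m. g k)" for g :: "nat \<Rightarrow> real"
  using sum.shift_bounds_Suc_ivl[of g 0 m] by (simp add: atLeastLessThanSuc_atLeastAtMost)

lemma coercive_det_nonzero:
  fixes A :: "nat \<Rightarrow> nat \<Rightarrow> real"
  assumes "coercive \<kappa> {1..m} A" "0 < \<kappa>"
  shows "Determinant.det (Matrix.mat m m (\<lambda>(j, k). A (j + 1) (k + 1))) \<noteq> 0"
proof
  define P where "P = Matrix.mat m m (\<lambda>(j, k). A (j + 1) (k + 1))"
  have P: "P \<in> carrier_mat m m"
    by (simp add: P_def)
  assume "Determinant.det (Matrix.mat m m (\<lambda>(j, k). A (j + 1) (k + 1))) = 0"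
  then have "Determinant.det P = 0" by (simp add: P_def)
  then obtain v where v: "v \<in> carrier_vec m" "v \<noteq> 0\<^sub>v m" "P *\<^sub>v v = 0\<^sub>v m"
    using det_0_iff_vec_prod_zero[OF P] by auto
  define u where "u = (\<lambda>k. vec_index v (k - 1))"
  have "(\<Sum>k=1..m. A j k * u k) = 0" if "j \<in> {1..m}" for j
  proof -
    have "j - 1 < m" "Suc (j - 1) = j"
      using that by auto
    have "vec_index (P *\<^sub>v v) (j - 1) = 0"
      using \<open>j - 1 < m\<close> v(3) by simp
    moreover have "vec_index (P *\<^sub>v v) (j - 1) = (\<Sum>k\<in>{0..<m}. A j (Suc k) * u (Suc k))"
      using \<open>j - 1 < m\<close> \<open>Suc (j - 1) = j\<close> v(1) by (auto simp: P_def scalar_prod_def u_def)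
    ultimately show ?thesis
      using sum_lessThan_shift[of "\<lambda>k. A j k * u k"] by simp
  qed
  then have "u k = 0" if "k \<in> {1..m}" for k
    using coercive_injective[OF assms _ _ that] by blast
  then have "vec_index v k = 0" if "k < m" for k
    using that \<open>\<And>k. k \<in> {1..m} \<Longrightarrow> u k = 0\<close>[of "Suc k"] by (simp add: u_def)
  with v(1,2) show False
    by (auto intro!: eq_vecI)
qed

lemma coercive_inverse_exists:
  fixes A :: "nat \<Rightarrow> nat \<Rightarrow> real"
  assumes "coercive \<kappa> {1..m} A" "0 < \<kappa>"
  obtains B where "\<And>j c. j \<in> {1..m} \<Longrightarrow> c \<in> {1..m} \<Longrightarrow> (\<Sum>k=1..m. A j k * B k c) = (if j = c then 1 else 0)"
proof -
  define P where "P = Matrix.mat m m (\<lambda>(j, k). A (j + 1) (k + 1))"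
  have P: "P \<in> carrier_mat m m"
    by (simp add: P_def)
  have "Determinant.det P \<noteq> 0"
    unfolding P_def by (rule coercive_det_nonzero[OF assms])
  define Q where "Q = (1 / Determinant.det P) \<cdot>\<^sub>m adj_mat P"
  have Q: "Q \<in> carrier_mat m m"
    using adj_mat(1)[OF P] by (simp add: Q_def)
  have PQ: "P * Q = 1\<^sub>m m"
    using adj_mat(1,2)[OF P] P \<open>Determinant.det P \<noteq> 0\<close>
    by (auto simp: Q_def mult_smult_distrib[OF P] intro!: eq_matI)
  show ?thesis
  proof (rule that[of "\<lambda>k c. Q $$ (k - 1, c - 1)"])
    fix j c
    assume jc: "j \<in> {1..m}" "c \<in> {1..m}"
    have "(P * Q) $$ (j - 1, c - 1) = (\<Sum>k\<in>{0..<m}. A j (Suc k) * Q $$ (Suc k - 1, c - 1))"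
      using jc P Q by (auto simp: scalar_prod_def P_def intro!: sum.cong)
    also have "\<dots> = (\<Sum>k=1..m. A j k * Q $$ (k - 1, c - 1))"
      by (rule sum_lessThan_shift)
    finally show "(\<Sum>k=1..m. A j k * Q $$ (k - 1, c - 1)) = (if j = c then 1 else 0)"
      using jc by (auto simp: PQ split: if_splits)
  qed
qed

text \<open>Schur's test: Cauchy-Schwarz after splitting the kernel into two square roots uses the
  row sums, and exchanging the order of summation uses the column sums.\<close>

lemma L2_set_kernel_le:
  assumes "\<And>k l. 0 \<le> a k l"
    and row: "\<And>k. k \<in> I \<Longrightarrow> (\<Sum>l\<in>I. a k l) \<le> R"
    and col: "\<And>l. l \<in> I \<Longrightarrow> (\<Sum>k\<in>I. a k l) \<le> R"
    and "0 \<le> R"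
  shows "L2_set (\<lambda>k. \<Sum>l\<in>I. a k l * u l) I \<le> R * L2_set u I"
proof -
  have "(\<Sum>k\<in>I. (\<Sum>l\<in>I. a k l * u l)\<^sup>2) \<le> (\<Sum>k\<in>I. R * (\<Sum>l\<in>I. a k l * (u l)\<^sup>2))"
  proof (rule sum_mono)
    fix k assume k: "k \<in> I"
    have "(\<Sum>l\<in>I. a k l * u l)\<^sup>2 = (\<Sum>l\<in>I. sqrt (a k l) * (sqrt (a k l) * u l))\<^sup>2"
      using assms(1) by (simp add: mult.assoc[symmetric])
    also have "\<dots> \<le> (\<Sum>l\<in>I. (sqrt (a k l))\<^sup>2) * (\<Sum>l\<in>I. (sqrt (a k l) * u l)\<^sup>2)"
      by (rule Cauchy_Schwarz_ineq_sum)
    also have "\<dots> = (\<Sum>l\<in>I. a k l) * (\<Sum>l\<in>I. a k l * (u l)\<^sup>2)"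
      using assms(1) by (simp add: power_mult_distrib)
    also have "\<dots> \<le> R * (\<Sum>l\<in>I. a k l * (u l)\<^sup>2)"
      using assms(1) by (intro mult_right_mono row k sum_nonneg) auto
    finally show "(\<Sum>l\<in>I. a k l * u l)\<^sup>2 \<le> R * (\<Sum>l\<in>I. a k l * (u l)\<^sup>2)" .
  qed
  also have "\<dots> = R * (\<Sum>l\<in>I. (\<Sum>k\<in>I. a k l) * (u l)\<^sup>2)"
    by (simp only: sum_distrib_left[symmetric] sum_distrib_right) (subst sum.swap, rule refl)
  also have "\<dots> \<le> R * (\<Sum>l\<in>I. R * (u l)\<^sup>2)"
    using assms by (intro mult_left_mono sum_mono mult_right_mono) auto
  also have "\<dots> = R\<^sup>2 * (\<Sum>l\<in>I. (u l)\<^sup>2)"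
    by (simp add: sum_distrib_left power2_eq_square mult_ac)
  finally have "sqrt (\<Sum>k\<in>I. (\<Sum>l\<in>I. a k l * u l)\<^sup>2) \<le> sqrt (R\<^sup>2 * (\<Sum>l\<in>I. (u l)\<^sup>2))"
    by (rule real_sqrt_le_mono)
  then show ?thesis
    using assms(4) by (simp add: L2_set_def real_sqrt_mult)
qed

section \<open>Weighted estimates for solutions of coercive systems\<close>

lemma L2_set_sum_le:
  "finite J \<Longrightarrow> L2_set (\<lambda>k. \<Sum>l\<in>J. f l k) I \<le> (\<Sum>l\<in>J. L2_set (f l) I)"
proof (induction rule: finite_induct)
  case (insert x F)
  then show ?case
    using L2_set_triangle_ineq[of "f x" "\<lambda>k. \<Sum>l\<in>F. f l k" I] by simp
qed (simp add: L2_set_0')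

text \<open>Row k of the identity A (w u) = w (A u) - [w, A] u. The hypothesis on the kernel
  separates the commutator into a part \<open>P\<close> acting on the weighted solution and a part
  \<open>Q\<close> acting on the solution itself.\<close>

lemma abs_commutator_le:
  assumes "finite I" "0 \<le> C" "k \<in> I"
    and A: "\<And>l. l \<in> I \<Longrightarrow> \<bar>A k l\<bar> \<le> C * decay \<tau> (lag k l)"
    and ker: "\<And>l. decay \<tau> (lag k l) * \<bar>w k - w l\<bar> \<le> P l * w l + Q l"
    and w: "\<And>l. 0 \<le> w l"
  shows "\<bar>\<Sum>l\<in>I. A k l * (w l * u l)\<bar> \<le> w k * \<bar>\<Sum>l\<in>I. A k l * u l\<bar>
    + C * ((\<Sum>l\<in>I. P l * (w l * \<bar>u l\<bar>)) + (\<Sum>l\<in>I. Q l * \<bar>u l\<bar>))"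
proof -
  have "(\<Sum>l\<in>I. A k l * (w l * u l)) = w k * (\<Sum>l\<in>I. A k l * u l) - (\<Sum>l\<in>I. A k l * (w k - w l) * u l)"
    by (simp add: sum_distrib_left sum_subtractf[symmetric] algebra_simps)
  then have "\<bar>\<Sum>l\<in>I. A k l * (w l * u l)\<bar>
      \<le> w k * \<bar>\<Sum>l\<in>I. A k l * u l\<bar> + \<bar>\<Sum>l\<in>I. A k l * (w k - w l) * u l\<bar>"
    using abs_triangle_ineq4[of "w k * (\<Sum>l\<in>I. A k l * u l)"] w[of k] by (simp add: abs_mult)
  also have "\<bar>\<Sum>l\<in>I. A k l * (w k - w l) * u l\<bar> \<le> (\<Sum>l\<in>I. C * ((P l * w l + Q l) * \<bar>u l\<bar>))"
  proof (rule order_trans[OF sum_abs], rule sum_mono)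
    fix l assume l: "l \<in> I"
    have "\<bar>A k l * (w k - w l) * u l\<bar> \<le> (C * decay \<tau> (lag k l)) * \<bar>w k - w l\<bar> * \<bar>u l\<bar>"
      unfolding abs_mult using A[OF l] by (intro mult_right_mono) auto
    also have "\<dots> = C * (decay \<tau> (lag k l) * \<bar>w k - w l\<bar>) * \<bar>u l\<bar>"
      by simp
    also have "\<dots> \<le> C * (P l * w l + Q l) * \<bar>u l\<bar>"
      using assms(2) by (intro mult_right_mono mult_left_mono ker) auto
    finally show "\<bar>A k l * (w k - w l) * u l\<bar> \<le> C * ((P l * w l + Q l) * \<bar>u l\<bar>)"
      by (simp add: mult.assoc)
  qed
  also have "\<dots> = (\<Sum>l\<in>I. C * (P l * (w l * \<bar>u l\<bar>)) + C * (Q l * \<bar>u l\<bar>))"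
    by (intro sum.cong) (simp_all add: algebra_simps)
  also have "\<dots> = C * ((\<Sum>l\<in>I. P l * (w l * \<bar>u l\<bar>)) + (\<Sum>l\<in>I. Q l * \<bar>u l\<bar>))"
    by (simp only: sum.distrib sum_distrib_left distrib_left)
  finally show ?thesis by simp
qed

lemma decay_from_eventually_small:
  assumes "1 < \<tau>" "0 < \<delta>"
  obtains N where "suminf (decay_from \<tau> N) < \<delta>"
proof -
  have "eventually (\<lambda>N. suminf (decay_from \<tau> N) < \<delta>) sequentially"
    using order_tendstoD(2)[OF suminf_decay_from_tendsto_0[OF assms(1)] assms(2)] .
  then show ?thesis
    using that by (auto simp: eventually_sequentially)
qed

lemma sum_near_kernel_le:
  assumes "1 < \<tau>" "finite I" "0 \<le> \<epsilon>" "0 \<le> \<rho>"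
  shows "(\<Sum>l\<in>I. \<epsilon> * decay \<tau> (lag k l) + \<rho> * decay_from \<tau> N (lag k l))
    \<le> 2 * (\<epsilon> * suminf (decay \<tau>) + \<rho> * suminf (decay_from \<tau> N))"
proof -
  have "(\<Sum>l\<in>I. decay \<tau> (lag k l)) \<le> 2 * suminf (decay \<tau>)"
       "(\<Sum>l\<in>I. decay_from \<tau> N (lag k l)) \<le> 2 * suminf (decay_from \<tau> N)"
    using assms summable_decay summable_decay_from by (auto intro!: sum_lag_le)
  then have "\<epsilon> * (\<Sum>l\<in>I. decay \<tau> (lag k l)) \<le> \<epsilon> * (2 * suminf (decay \<tau>))"
       "\<rho> * (\<Sum>l\<in>I. decay_from \<tau> N (lag k l)) \<le> \<rho> * (2 * suminf (decay_from \<tau> N))"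
    using assms by (auto intro: mult_left_mono)
  then show ?thesis
    by (simp add: sum.distrib sum_distrib_left[symmetric])
qed

lemma L2_set_abs: "L2_set (\<lambda>k. \<bar>u k\<bar>) I = L2_set u I"
  by (simp add: L2_set_def)

text \<open>The weight is centered at the column index c, where the right-hand side sits. Everything
  is reduced to the weighted norm \<open>X\<close>: the unweighted norm \<open>U\<close> is at most
  1 / \<kappa> by coercivity, and the sum norm \<open>V\<close> is a multiple of \<open>X\<close>.
  The part of the estimate proportional to \<open>X\<close> is absorbed.\<close>

lemma column_sum_bound:
  fixes \<tau> \<kappa> C :: real
  assumes \<tau>: "1 < \<tau>" and \<kappa>: "0 < \<kappa>" and C: "0 \<le> C"
  obtains M where "0 \<le> M"
    "\<And>I A c u. finite I \<Longrightarrow> coercive \<kappa> I A \<Longrightarrow>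
       (\<And>j k. j \<in> I \<Longrightarrow> k \<in> I \<Longrightarrow> \<bar>A j k\<bar> \<le> C * decay \<tau> (lag j k)) \<Longrightarrow> c \<in> I \<Longrightarrow>
       (\<And>j. j \<in> I \<Longrightarrow> (\<Sum>k\<in>I. A j k * u k) = (if j = c then 1 else 0)) \<Longrightarrow>
       (\<Sum>k\<in>I. \<bar>u k\<bar>) \<le> M"
proof -
  define Z where "Z = suminf (decay \<tau>)"
  define s where "s = \<tau> / 2"
  \<comment> \<open>A positive majorant of \<open>C\<close>, which may be 0, so that it can stand in
    denominators.\<close>
  define D where "D = C + 1"
  define \<rho> where "\<rho> = 2 powr s"
  \<comment> \<open>Budget for the absorption: slowly varying weights get \<kappa> / 4, the tail
    acting on the weighted solution \<kappa> / 8, and the tail acting on the sum norm \<kappa> / 4.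
    This leaves 3 \<kappa> / 8 on the left.\<close>
  define \<epsilon> where "\<epsilon> = \<kappa> / (8 * D * Z)"
  have Z: "1 \<le> Z" using suminf_decay_ge_1[OF \<tau>] by (simp add: Z_def)
  have D: "0 < D" "C \<le> D" using C by (auto simp: D_def)
  have \<rho>: "0 < \<rho>" by (simp add: \<rho>_def)
  have s: "0 < s" using \<tau> by (simp add: s_def)
  have \<epsilon>: "0 < \<epsilon>" using \<kappa> Z D by (simp add: \<epsilon>_def)
  \<comment> \<open>The first threshold serves \<open>near\<close>, where the tail mass enters
    linearly. The second serves \<open>far\<close>, where it enters through its square root.\<close>
  have "0 < min (\<kappa> / (16 * D * \<rho>)) ((\<kappa> / (8 * D * \<rho>))\<^sup>2 / Z)"
    using \<kappa> Z D \<rho> by simp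
  from decay_from_eventually_small[OF \<tau> this] obtain N where
    N: "suminf (decay_from \<tau> N) < min (\<kappa> / (16 * D * \<rho>)) ((\<kappa> / (8 * D * \<rho>))\<^sup>2 / Z)" .
  define t where "t = suminf (decay_from \<tau> N)"
  have t: "0 \<le> t" using suminf_decay_from_nonneg[OF \<tau>] by (simp add: t_def)
  obtain K where K: "0 \<le> K" and
    ker: "\<And>c k l. decay \<tau> (lag k l) * \<bar>decay (- s) (lag c k) - decay (- s) (lag c l)\<bar>
      \<le> (\<epsilon> * decay \<tau> (lag k l) + 2 powr s * decay_from \<tau> N (lag k l)) * decay (- s) (lag c l)
        + K * decay \<tau> (lag k l) + 2 powr s * decay_from (\<tau> - s) N (lag k l)"
    using commutator_kernel_le[OF s \<epsilon>, of \<tau> N] by blast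
  have near: "C * (2 * (\<epsilon> * Z + \<rho> * t)) \<le> 3 * \<kappa> / 8"
  proof -
    have "D * (\<epsilon> * Z) = \<kappa> / 8"
      using D Z by (simp add: \<epsilon>_def)
    moreover have "D * (\<rho> * t) \<le> \<kappa> / 16"
    proof -
      have "t < \<kappa> / (16 * D * \<rho>)" using N by (simp add: t_def)
      then have "D * \<rho> * t \<le> D * \<rho> * (\<kappa> / (16 * D * \<rho>))"
        using D \<rho> by (intro mult_left_mono) auto
      then show ?thesis using D \<rho> by (simp add: mult.assoc)
    qed
    moreover have "C * (2 * (\<epsilon> * Z + \<rho> * t)) \<le> D * (2 * (\<epsilon> * Z + \<rho> * t))"
      using D \<epsilon> Z \<rho> t by (intro mult_right_mono) auto
    ultimately show ?thesis by (simp add: algebra_simps)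
  qed
  have far: "C * (\<rho> * (sqrt (2 * t) * sqrt (2 * Z))) \<le> \<kappa> / 4"
  proof -
    have "t * Z \<le> (\<kappa> / (8 * D * \<rho>))\<^sup>2"
      using N Z by (simp add: t_def pos_less_divide_eq less_imp_le)
    then have "sqrt (t * Z) \<le> \<kappa> / (8 * D * \<rho>)"
      using \<kappa> D \<rho> by (simp add: real_le_lsqrt)
    moreover have "sqrt (2 * t) * sqrt (2 * Z) = 2 * sqrt (t * Z)"
      by (simp add: real_sqrt_mult)
    ultimately have "D * \<rho> * (sqrt (2 * t) * sqrt (2 * Z)) \<le> D * \<rho> * (2 * (\<kappa> / (8 * D * \<rho>)))"
      using D \<rho> by (intro mult_left_mono) auto
    also have "\<dots> = \<kappa> / 4"
      using D \<rho> by simp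
    finally have "D * (\<rho> * (sqrt (2 * t) * sqrt (2 * Z))) \<le> \<kappa> / 4"
      by (simp add: mult.assoc)
    moreover have "C * (\<rho> * (sqrt (2 * t) * sqrt (2 * Z))) \<le> D * (\<rho> * (sqrt (2 * t) * sqrt (2 * Z)))"
      using D \<rho> t Z by (intro mult_right_mono) auto
    ultimately show ?thesis by linarith
  qed
  define M where "M = sqrt (2 * Z) * (8 / (3 * \<kappa>) * (1 + C * (K * (2 * Z * (1 / \<kappa>)))))"
  show ?thesis
  proof (rule that[of M])
    show "0 \<le> M"
      using Z \<kappa> C K by (auto simp: M_def intro!: mult_nonneg_nonneg add_nonneg_nonneg)
    fix I :: "nat set" and A c u
    assume I: "finite I" and co: "coercive \<kappa> I A"
      and A: "\<And>j k. j \<in> I \<Longrightarrow> k \<in> I \<Longrightarrow> \<bar>A j k\<bar> \<le> C * decay \<tau> (lag j k)"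
      and c: "c \<in> I" and u: "\<And>j. j \<in> I \<Longrightarrow> (\<Sum>k\<in>I. A j k * u k) = (if j = c then 1 else 0)"
    define w where "w = (\<lambda>k. decay (- s) (lag c k))"
    define X where "X = L2_set (\<lambda>k. w k * \<bar>u k\<bar>) I"
    define U where "U = L2_set (\<lambda>k. \<bar>u k\<bar>) I"
    define V where "V = (\<Sum>k\<in>I. \<bar>u k\<bar>)"
    have w: "0 \<le> w k" for k by (simp add: w_def)
    have X0: "0 \<le> X" by (simp add: X_def)
    \<comment> \<open>The weight and \<open>decay s\<close> are reciprocal, and the square of
      \<open>decay s\<close> is \<open>decay \<tau>\<close>; this is one of the two places where s =
      \<tau> / 2 is needed.\<close>
    have V: "V \<le> sqrt (2 * Z) * X"
    proof -
      have "V = (\<Sum>k\<in>I. \<bar>decay s (lag c k)\<bar> * \<bar>w k * \<bar>u k\<bar>\<bar>)"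
        unfolding V_def using w by (intro sum.cong refl)
          (simp add: abs_mult mult.assoc[symmetric] w_def decay_mult, simp add: decay_def)
      also have "\<dots> \<le> L2_set (\<lambda>k. decay s (lag c k)) I * X"
        unfolding X_def by (rule L2_set_mult_ineq)
      also have "L2_set (\<lambda>k. decay s (lag c k)) I = sqrt (\<Sum>k\<in>I. decay \<tau> (lag c k))"
        by (simp add: L2_set_def decay_power2 s_def)
      also have "\<dots> \<le> sqrt (2 * Z)"
        unfolding Z_def using I summable_decay[OF \<tau>]
        by (intro real_sqrt_le_mono sum_lag_le) auto
      finally show ?thesis using X0 by (simp add: mult_right_mono)
    qed
    have U: "U \<le> 1 / \<kappa>"
    proof -
      have "\<kappa> * U \<le> L2_set (\<lambda>j. \<Sum>k\<in>I. A j k * u k) I"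
        unfolding U_def L2_set_abs by (rule coercive_L2_set[OF co])
      also have "\<dots> = L2_set (\<lambda>j. if j = c then 1 else 0) I"
        by (intro L2_set_cong refl u)
      also have "\<dots> = 1"
        using c I by (simp add: L2_set_def if_distrib[of "\<lambda>x. x\<^sup>2"] cong: if_cong)
      finally show ?thesis using \<kappa> by (simp add: field_simps)
    qed
    define g1 where "g1 = (\<lambda>k. \<Sum>l\<in>I. (\<epsilon> * decay \<tau> (lag k l) + \<rho> * decay_from \<tau> N (lag k l)) * (w l * \<bar>u l\<bar>))"
    define g2 where "g2 = (\<lambda>k. \<Sum>l\<in>I. decay \<tau> (lag k l) * \<bar>u l\<bar>)"
    define g3 where "g3 = (\<lambda>k. \<Sum>l\<in>I. decay_from (\<tau> - s) N (lag k l) * \<bar>u l\<bar>)"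
    have g0: "0 \<le> g1 k" "0 \<le> g2 k" "0 \<le> g3 k" for k
      using \<epsilon> \<rho> w by (auto simp: g1_def g2_def g3_def intro!: sum_nonneg mult_nonneg_nonneg add_nonneg_nonneg)
    have G1: "L2_set g1 I \<le> 2 * (\<epsilon> * Z + \<rho> * t) * X"
      unfolding g1_def X_def
    proof (rule L2_set_kernel_le)
      show row: "(\<Sum>l\<in>I. \<epsilon> * decay \<tau> (lag k l) + \<rho> * decay_from \<tau> N (lag k l)) \<le> 2 * (\<epsilon> * Z + \<rho> * t)" for k
        unfolding Z_def t_def using \<epsilon> \<rho> I by (intro sum_near_kernel_le[OF \<tau>]) auto
      show "(\<Sum>k\<in>I. \<epsilon> * decay \<tau> (lag k l) + \<rho> * decay_from \<tau> N (lag k l)) \<le> 2 * (\<epsilon> * Z + \<rho> * t)" for l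
        using row[of l] by (simp add: lag_commute[of l])
    qed (use \<epsilon> \<rho> Z t in auto)
    have G2: "L2_set g2 I \<le> 2 * Z * U"
      unfolding g2_def U_def
    proof (rule L2_set_kernel_le)
      show row: "(\<Sum>l\<in>I. decay \<tau> (lag k l)) \<le> 2 * Z" for k
        unfolding Z_def using summable_decay[OF \<tau>] I by (intro sum_lag_le) auto
      show "(\<Sum>k\<in>I. decay \<tau> (lag k l)) \<le> 2 * Z" for l
        using row[of l] by (simp add: lag_commute[of l])
    qed (use Z in auto)
    have G3: "L2_set g3 I \<le> sqrt (2 * t) * V"
    proof -
      have "L2_set g3 I \<le> (\<Sum>l\<in>I. L2_set (\<lambda>k. decay_from (\<tau> - s) N (lag k l) * \<bar>u l\<bar>) I)"
        unfolding g3_def by (rule L2_set_sum_le[OF I])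
      also have "\<dots> = (\<Sum>l\<in>I. L2_set (\<lambda>k. decay_from (\<tau> - s) N (lag k l)) I * \<bar>u l\<bar>)"
        by (simp add: L2_set_left_distrib)
      also have "\<dots> \<le> (\<Sum>l\<in>I. sqrt (2 * t) * \<bar>u l\<bar>)"
      proof (intro sum_mono mult_right_mono)
        fix l
        have "(decay_from (\<tau> - s) N m)\<^sup>2 = decay_from \<tau> N m" for m
          by (simp add: decay_from_def decay_power2 s_def)
        then have "L2_set (\<lambda>k. decay_from (\<tau> - s) N (lag k l)) I = sqrt (\<Sum>k\<in>I. decay_from \<tau> N (lag l k))"
          by (simp add: L2_set_def lag_commute[of l])
        also have "\<dots> \<le> sqrt (2 * t)"
          unfolding t_def using I summable_decay_from[OF \<tau>]
          by (intro real_sqrt_le_mono sum_lag_le) auto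
        finally show "L2_set (\<lambda>k. decay_from (\<tau> - s) N (lag k l)) I \<le> sqrt (2 * t)" .
      qed simp
      finally show ?thesis by (simp add: V_def sum_distrib_left)
    qed
    define e where "e = (\<lambda>k. if k = c then 1 else (0::real))"
    \<comment> \<open>The weighted right-hand side is still the unit vector, since the weight is 1
      at its center c.\<close>
    have row: "\<bar>\<Sum>l\<in>I. A k l * (w l * u l)\<bar> \<le> e k + C * (g1 k + (K * g2 k + \<rho> * g3 k))" if k: "k \<in> I" for k
    proof -
      have "\<bar>\<Sum>l\<in>I. A k l * (w l * u l)\<bar> \<le> w k * \<bar>\<Sum>l\<in>I. A k l * u l\<bar>
        + C * ((\<Sum>l\<in>I. (\<epsilon> * decay \<tau> (lag k l) + \<rho> * decay_from \<tau> N (lag k l)) * (w l * \<bar>u l\<bar>))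
          + (\<Sum>l\<in>I. (K * decay \<tau> (lag k l) + \<rho> * decay_from (\<tau> - s) N (lag k l)) * \<bar>u l\<bar>))"
        using ker[of k _ c] by (intro abs_commutator_le[where \<tau> = \<tau>] I C k A w) (simp_all add: w_def \<rho>_def add.assoc)
      also have "w k * \<bar>\<Sum>l\<in>I. A k l * u l\<bar> = e k"
        using u[OF k] by (simp add: e_def w_def)
      also have "(\<Sum>l\<in>I. (K * decay \<tau> (lag k l) + \<rho> * decay_from (\<tau> - s) N (lag k l)) * \<bar>u l\<bar>)
          = K * g2 k + \<rho> * g3 k"
        by (simp only: g2_def g3_def sum_distrib_left sum.distrib[symmetric] distrib_right mult.assoc)
      finally show ?thesis by (simp only: g1_def)
    qed
    have "\<kappa> * X = \<kappa> * L2_set (\<lambda>k. w k * u k) I"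
      using w by (simp add: X_def L2_set_def power_mult_distrib)
    also have "\<dots> \<le> L2_set (\<lambda>j. \<Sum>l\<in>I. A j l * (w l * u l)) I"
      by (rule coercive_L2_set[OF co])
    also have "\<dots> = L2_set (\<lambda>j. \<bar>\<Sum>l\<in>I. A j l * (w l * u l)\<bar>) I"
      by (simp only: L2_set_abs)
    also have "\<dots> \<le> L2_set (\<lambda>k. e k + C * (g1 k + (K * g2 k + \<rho> * g3 k))) I"
      by (intro L2_set_mono row) auto
    also have "\<dots> \<le> L2_set e I + C * (L2_set g1 I + (K * L2_set g2 I + \<rho> * L2_set g3 I))"
    proof -
      have "L2_set (\<lambda>k. K * g2 k + \<rho> * g3 k) I \<le> K * L2_set g2 I + \<rho> * L2_set g3 I"
        using L2_set_triangle_ineq[of "\<lambda>k. K * g2 k" "\<lambda>k. \<rho> * g3 k" I] K \<rho>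
        by (simp add: L2_set_right_distrib)
      with L2_set_triangle_ineq[of g1 "\<lambda>k. K * g2 k + \<rho> * g3 k" I]
      have "L2_set (\<lambda>k. g1 k + (K * g2 k + \<rho> * g3 k)) I \<le> L2_set g1 I + (K * L2_set g2 I + \<rho> * L2_set g3 I)"
        by linarith
      then have "C * L2_set (\<lambda>k. g1 k + (K * g2 k + \<rho> * g3 k)) I
          \<le> C * (L2_set g1 I + (K * L2_set g2 I + \<rho> * L2_set g3 I))"
        using C by (rule mult_left_mono)
      with L2_set_triangle_ineq[of e "\<lambda>k. C * (g1 k + (K * g2 k + \<rho> * g3 k))" I] C
      show ?thesis by (simp add: L2_set_right_distrib)
    qed
    also have "L2_set e I = 1"
      using c I by (simp add: e_def L2_set_def if_distrib[of "\<lambda>x. x\<^sup>2"] cong: if_cong)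
    also have "1 + C * (L2_set g1 I + (K * L2_set g2 I + \<rho> * L2_set g3 I))
      \<le> 1 + C * (2 * (\<epsilon> * Z + \<rho> * t) * X + (K * (2 * Z * (1 / \<kappa>)) + \<rho> * (sqrt (2 * t) * (sqrt (2 * Z) * X))))"
    proof (intro add_left_mono mult_left_mono add_mono C K G1)
      show "L2_set g2 I \<le> 2 * Z * (1 / \<kappa>)"
        by (rule order_trans[OF G2 mult_left_mono[OF U]]) (use Z in auto)
      show "L2_set g3 I \<le> sqrt (2 * t) * (sqrt (2 * Z) * X)"
        by (rule order_trans[OF G3 mult_left_mono[OF V]]) (use t in auto)
      show "0 \<le> \<rho>" using \<rho> by simp
    qed
    also have "\<dots> = 1 + C * (K * (2 * Z * (1 / \<kappa>))) + (C * (2 * (\<epsilon> * Z + \<rho> * t))) * X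
        + (C * (\<rho> * (sqrt (2 * t) * sqrt (2 * Z)))) * X"
      by (simp add: algebra_simps)
    also have "\<dots> \<le> 1 + C * (K * (2 * Z * (1 / \<kappa>))) + (3 * \<kappa> / 8) * X + (\<kappa> / 4) * X"
      by (intro add_mono mult_right_mono near far X0 order_refl)
    finally have "\<kappa> * X \<le> 1 + C * (K * (2 * Z * (1 / \<kappa>))) + 3 * \<kappa> / 8 * X + \<kappa> / 4 * X" .
    \<comment> \<open>Absorption: 1 - 3 / 8 - 1 / 4 = 3 / 8. It is legitimate because
      \<open>X\<close> is a finite number for each finite index set.\<close>
    then have "3 * \<kappa> / 8 * X \<le> 1 + C * (K * (2 * Z * (1 / \<kappa>)))"
      by linarith
    then have "8 / (3 * \<kappa>) * (3 * \<kappa> / 8 * X) \<le> 8 / (3 * \<kappa>) * (1 + C * (K * (2 * Z * (1 / \<kappa>))))"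
      using \<kappa> by (intro mult_left_mono) auto
    then have "X \<le> 8 / (3 * \<kappa>) * (1 + C * (K * (2 * Z * (1 / \<kappa>))))"
      using \<kappa> by simp
    then have "sqrt (2 * Z) * X \<le> M"
      unfolding M_def by (rule mult_left_mono) (use Z in auto)
    with V show "(\<Sum>k\<in>I. \<bar>u k\<bar>) \<le> M"
      by (simp add: V_def)
  qed
qed

definition coercive_decaying :: "real \<Rightarrow> real \<Rightarrow> real \<Rightarrow> nat \<Rightarrow> (nat \<Rightarrow> nat \<Rightarrow> real) \<Rightarrow> bool" where
  "coercive_decaying \<tau> \<kappa> C m A \<longleftrightarrow> coercive \<kappa> {1..m} A \<and>
     (\<forall>j\<in>{1..m}. \<forall>k\<in>{1..m}. \<bar>A j k\<bar> \<le> C * decay \<tau> (lag j k) \<and> A j k = A k j)"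

text \<open>Symmetry lets the columns of the inverse, bounded in the sum norm, act as rows, which
  gives the sup-norm bound. The sum-norm bound is its dual.\<close>

lemma solution_bounds:
  fixes \<tau> \<kappa> C :: real
  assumes \<tau>: "1 < \<tau>" and \<kappa>: "0 < \<kappa>" and C: "0 \<le> C"
  shows "\<exists>M\<ge>0. \<forall>m A u. coercive_decaying \<tau> \<kappa> C m A \<longrightarrow>
    (\<forall>F. (\<forall>j\<in>{1..m}. \<bar>\<Sum>k=1..m. A j k * u k\<bar> \<le> F) \<longrightarrow> (\<forall>k\<in>{1..m}. \<bar>u k\<bar> \<le> M * F)) \<and>
    (\<Sum>k=1..m. \<bar>u k\<bar>) \<le> M * (\<Sum>j=1..m. \<bar>\<Sum>k=1..m. A j k * u k\<bar>)"
proof -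
  obtain M where M: "0 \<le> M" and col: "\<And>I A c u. finite I \<Longrightarrow> coercive \<kappa> I A \<Longrightarrow>
       (\<And>j k. j \<in> I \<Longrightarrow> k \<in> I \<Longrightarrow> \<bar>A j k\<bar> \<le> C * decay \<tau> (lag j k)) \<Longrightarrow> c \<in> I \<Longrightarrow>
       (\<And>j. j \<in> I \<Longrightarrow> (\<Sum>k\<in>I. A j k * u k) = (if j = c then 1 else 0)) \<Longrightarrow>
       (\<Sum>k\<in>I. \<bar>u k\<bar>) \<le> M"
    using column_sum_bound[OF assms] by blast
  \<comment> \<open>\<open>B\<close> is built as a right inverse. Pairing A u with column k of
    \<open>B\<close> and using the symmetry of \<open>A\<close> recovers \<open>u k\<close>, so
    \<open>B\<close> also represents every vector by its image.\<close>
  have repr: "\<exists>B. (\<forall>c\<in>{1..m}. (\<Sum>k=1..m. \<bar>B k c\<bar>) \<le> M) \<and>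
      (\<forall>c\<in>{1..m}. \<forall>j\<in>{1..m}. (\<Sum>k=1..m. A j k * B k c) = (if j = c then 1 else 0)) \<and>
      (\<forall>u. \<forall>k\<in>{1..m}. u k = (\<Sum>j=1..m. B j k * (\<Sum>l=1..m. A j l * u l)))"
    if co: "coercive \<kappa> {1..m} A"
      and A: "\<And>j k. j \<in> {1..m} \<Longrightarrow> k \<in> {1..m} \<Longrightarrow> \<bar>A j k\<bar> \<le> C * decay \<tau> (lag j k)"
      and sym: "\<And>j k. j \<in> {1..m} \<Longrightarrow> k \<in> {1..m} \<Longrightarrow> A j k = A k j" for m :: nat and A
  proof -
    let ?I = "{1..m}"
    obtain B where B: "\<And>j c. j \<in> ?I \<Longrightarrow> c \<in> ?I \<Longrightarrow> (\<Sum>k\<in>?I. A j k * B k c) = (if j = c then 1 else 0)"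
      using coercive_inverse_exists[OF co \<kappa>] by blast
    have "(\<Sum>k\<in>?I. \<bar>B k c\<bar>) \<le> M" if "c \<in> ?I" for c
      using col[OF _ co A that] B[OF _ that] by simp
    moreover have "u k = (\<Sum>j\<in>?I. B j k * (\<Sum>l\<in>?I. A j l * u l))" if k: "k \<in> ?I" for u k
    proof -
      have "(\<Sum>j\<in>?I. B j k * (\<Sum>l\<in>?I. A j l * u l)) = (\<Sum>j\<in>?I. \<Sum>l\<in>?I. A j l * B j k * u l)"
        by (simp add: sum_distrib_left mult_ac)
      also have "\<dots> = (\<Sum>l\<in>?I. \<Sum>j\<in>?I. A j l * B j k * u l)"
        by (rule sum.swap)
      also have "\<dots> = (\<Sum>l\<in>?I. (\<Sum>j\<in>?I. A l j * B j k) * u l)"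
        unfolding sum_distrib_right by (intro sum.cong refl) (simp add: sym)
      also have "\<dots> = (\<Sum>l\<in>?I. (if l = k then 1 else 0) * u l)"
        using k by (intro sum.cong refl) (simp only: B)
      also have "\<dots> = u k"
        using k by (subst sum.cong[OF refl, of _ _ "\<lambda>l. if l = k then u l else 0"]) auto
      finally show ?thesis by simp
    qed
    ultimately show ?thesis
      using B by blast
  qed
  have sup: "\<forall>k\<in>{1..m}. \<bar>u k\<bar> \<le> M * F"
    if co: "coercive \<kappa> {1..m} A"
      and A: "\<And>j k. j \<in> {1..m} \<Longrightarrow> k \<in> {1..m} \<Longrightarrow> \<bar>A j k\<bar> \<le> C * decay \<tau> (lag j k)"
      and sym: "\<And>j k. j \<in> {1..m} \<Longrightarrow> k \<in> {1..m} \<Longrightarrow> A j k = A k j"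
      and F: "\<And>j. j \<in> {1..m} \<Longrightarrow> \<bar>\<Sum>k=1..m. A j k * u k\<bar> \<le> F" for m :: nat and A u F
  proof
    fix k assume k: "k \<in> {1..m}"
    obtain B where B: "(\<Sum>j=1..m. \<bar>B j k\<bar>) \<le> M"
        "u k = (\<Sum>j=1..m. B j k * (\<Sum>l=1..m. A j l * u l))"
      using repr[OF co A sym] k by blast
    have "0 \<le> F" using F[OF k] by linarith
    have "\<bar>u k\<bar> \<le> (\<Sum>j=1..m. \<bar>B j k\<bar> * F)"
      unfolding B(2)
    proof (rule order_trans[OF sum_abs], rule sum_mono)
      fix j assume "j \<in> {1..m}"
      from F[OF this] show "\<bar>B j k * (\<Sum>l=1..m. A j l * u l)\<bar> \<le> \<bar>B j k\<bar> * F"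
        unfolding abs_mult by (rule mult_left_mono) simp
    qed
    also have "\<dots> \<le> M * F"
      unfolding sum_distrib_right[symmetric] using B(1) \<open>0 \<le> F\<close> by (rule mult_right_mono)
    finally show "\<bar>u k\<bar> \<le> M * F" .
  qed
  show ?thesis
  proof (intro exI[of _ M] conjI allI impI M)
    fix m :: nat and A :: "nat \<Rightarrow> nat \<Rightarrow> real" and u :: "nat \<Rightarrow> real" and F :: real
    assume "coercive_decaying \<tau> \<kappa> C m A" "\<forall>j\<in>{1..m}. \<bar>\<Sum>k=1..m. A j k * u k\<bar> \<le> F"
    then show "\<forall>k\<in>{1..m}. \<bar>u k\<bar> \<le> M * F"
      by (intro sup[of m A]) (auto simp: coercive_decaying_def)
  next
    fix m :: nat and A :: "nat \<Rightarrow> nat \<Rightarrow> real" and u :: "nat \<Rightarrow> real"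
    let ?I = "{1..m}"
    assume cd: "coercive_decaying \<tau> \<kappa> C m A"
    then have co: "coercive \<kappa> ?I A"
      and A: "\<And>j k. j \<in> ?I \<Longrightarrow> k \<in> ?I \<Longrightarrow> \<bar>A j k\<bar> \<le> C * decay \<tau> (lag j k)"
      and sym: "\<And>j k. j \<in> ?I \<Longrightarrow> k \<in> ?I \<Longrightarrow> A j k = A k j"
      unfolding coercive_decaying_def by blast+
    obtain B where B: "\<forall>c\<in>?I. \<forall>j\<in>?I. (\<Sum>k\<in>?I. A j k * B k c) = (if j = c then 1 else 0)"
        "\<forall>u. \<forall>k\<in>?I. u k = (\<Sum>j\<in>?I. B j k * (\<Sum>l\<in>?I. A j l * u l))"
      using repr[OF co A sym] by blast
    define f where "f = (\<lambda>j. \<Sum>k\<in>?I. A j k * u k)"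
    \<comment> \<open>Duality: \<open>y\<close> solves A y = sgn u and is therefore bounded by M,
      while the sum of the \<open>\<bar>u k\<bar>\<close> equals the pairing of \<open>y\<close>
      with f = A u.\<close>
    define y where "y = (\<lambda>j. \<Sum>k\<in>?I. B j k * sgn (u k))"
    have "(\<Sum>k\<in>?I. A j k * y k) = sgn (u j)" if j: "j \<in> ?I" for j
    proof -
      have "(\<Sum>k\<in>?I. A j k * y k) = (\<Sum>k\<in>?I. \<Sum>c\<in>?I. A j k * B k c * sgn (u c))"
        by (simp add: y_def sum_distrib_left mult.assoc)
      also have "\<dots> = (\<Sum>c\<in>?I. \<Sum>k\<in>?I. A j k * B k c * sgn (u c))"
        by (rule sum.swap)
      also have "\<dots> = (\<Sum>c\<in>?I. (if j = c then 1 else 0) * sgn (u c))"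
        unfolding sum_distrib_right[symmetric] using B(1) j by (intro sum.cong refl) simp
      also have "\<dots> = sgn (u j)"
        using j by (subst sum.cong[OF refl, of _ _ "\<lambda>c. if j = c then sgn (u c) else 0"]) auto
      finally show ?thesis .
    qed
    then have y: "\<forall>k\<in>?I. \<bar>y k\<bar> \<le> M * 1"
      by (intro sup[OF co A sym]) (auto simp: sgn_real_def)
    have "(\<Sum>k\<in>?I. \<bar>u k\<bar>) = (\<Sum>k\<in>?I. sgn (u k) * u k)"
      by (intro sum.cong refl) (auto simp: sgn_real_def)
    also have "\<dots> = (\<Sum>k\<in>?I. sgn (u k) * (\<Sum>j\<in>?I. B j k * f j))"
      using B(2) by (intro sum.cong refl) (simp add: f_def)
    also have "\<dots> = (\<Sum>k\<in>?I. \<Sum>j\<in>?I. B j k * sgn (u k) * f j)"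
      by (simp add: sum_distrib_left mult_ac)
    also have "\<dots> = (\<Sum>j\<in>?I. y j * f j)"
      by (subst sum.swap) (simp add: y_def sum_distrib_right)
    also have "\<dots> \<le> (\<Sum>j\<in>?I. M * \<bar>f j\<bar>)"
    proof (rule sum_mono)
      fix j assume "j \<in> ?I"
      then have "\<bar>y j\<bar> * \<bar>f j\<bar> \<le> M * \<bar>f j\<bar>"
        using y by (intro mult_right_mono) auto
      then show "y j * f j \<le> M * \<bar>f j\<bar>"
        using abs_ge_self[of "y j * f j"] by (simp add: abs_mult)
    qed
    finally show "(\<Sum>k\<in>?I. \<bar>u k\<bar>) \<le> M * (\<Sum>j\<in>?I. \<bar>\<Sum>k\<in>?I. A j k * u k\<bar>)"
      by (simp add: f_def sum_distrib_left)
  qed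
qed

text \<open>The full weight, in the sup norm, with the sup bound for solutions taking the place of
  coercivity. The far kernel has exponent 0 and is bounded by 1, so it meets the sum norm of u. That
  norm is already controlled because the right-hand side is summable.\<close>

lemma solution_decay:
  fixes \<tau> \<kappa> C :: real
  assumes \<tau>: "1 < \<tau>" and \<kappa>: "0 < \<kappa>" and C: "0 \<le> C"
  shows "\<exists>M\<ge>0. \<forall>m A u F. coercive_decaying \<tau> \<kappa> C m A \<longrightarrow>
    (\<forall>j\<in>{1..m}. \<bar>\<Sum>k=1..m. A j k * u k\<bar> \<le> F * decay \<tau> j) \<longrightarrow>
    (\<forall>k\<in>{1..m}. \<bar>u k\<bar> \<le> M * F * decay \<tau> k)"
proof -
  obtain M1 where M1: "0 \<le> M1"
    and bounds: "\<forall>m A u. coercive_decaying \<tau> \<kappa> C m A \<longrightarrow>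
    (\<forall>F. (\<forall>j\<in>{1..m}. \<bar>\<Sum>k=1..m. A j k * u k\<bar> \<le> F) \<longrightarrow> (\<forall>k\<in>{1..m}. \<bar>u k\<bar> \<le> M1 * F)) \<and>
    (\<Sum>k=1..m. \<bar>u k\<bar>) \<le> M1 * (\<Sum>j=1..m. \<bar>\<Sum>k=1..m. A j k * u k\<bar>)"
    using solution_bounds[OF assms] by blast
  define Z where "Z = suminf (decay \<tau>)"
  \<comment> \<open>A positive majorant of \<open>M1 * C\<close>, the factor in front of the
    commutator.\<close>
  define D where "D = (M1 + 1) * (C + 1)"
  define \<rho> where "\<rho> = 2 powr \<tau>"
  define \<epsilon> where "\<epsilon> = 1 / (8 * D * Z)"
  have Z: "1 \<le> Z" using suminf_decay_ge_1[OF \<tau>] by (simp add: Z_def)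
  have D: "0 < D" using C M1 by (simp add: D_def)
  have \<rho>: "0 < \<rho>" by (simp add: \<rho>_def)
  have \<epsilon>: "0 < \<epsilon>" using Z D by (simp add: \<epsilon>_def)
  have "0 < 1 / (8 * D * \<rho>)" using D \<rho> by simp
  from decay_from_eventually_small[OF \<tau> this] obtain N where
    N: "suminf (decay_from \<tau> N) < 1 / (8 * D * \<rho>)" .
  define t where "t = suminf (decay_from \<tau> N)"
  have t: "0 \<le> t" using suminf_decay_from_nonneg[OF \<tau>] by (simp add: t_def)
  have \<tau>0: "0 < \<tau>" using \<tau> by simp
  obtain K where K: "0 \<le> K" and
    ker: "\<And>c k l. decay \<tau> (lag k l) * \<bar>decay (- \<tau>) (lag c k) - decay (- \<tau>) (lag c l)\<bar>
      \<le> (\<epsilon> * decay \<tau> (lag k l) + 2 powr \<tau> * decay_from \<tau> N (lag k l)) * decay (- \<tau>) (lag c l)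
        + K * decay \<tau> (lag k l) + 2 powr \<tau> * decay_from (\<tau> - \<tau>) N (lag k l)"
    using commutator_kernel_le[OF \<tau>0 \<epsilon>, of \<tau> N] by blast
  have near: "M1 * C * (2 * (\<epsilon> * Z + \<rho> * t)) \<le> 1 / 2"
  proof -
    have "D * (\<epsilon> * Z) = 1 / 8"
      using D Z by (simp add: \<epsilon>_def)
    moreover have "D * (\<rho> * t) \<le> 1 / 8"
    proof -
      have "t < 1 / (8 * D * \<rho>)" using N by (simp add: t_def)
      then have "D * \<rho> * t \<le> D * \<rho> * (1 / (8 * D * \<rho>))"
        using D \<rho> by (intro mult_left_mono) auto
      then show ?thesis using D \<rho> by (simp add: mult.assoc)
    qed
    moreover have "M1 * C * (2 * (\<epsilon> * Z + \<rho> * t)) \<le> D * (2 * (\<epsilon> * Z + \<rho> * t))"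
      using \<epsilon> Z \<rho> t C M1 unfolding D_def by (intro mult_right_mono mult_mono) auto
    ultimately show ?thesis by (simp add: algebra_simps)
  qed
  \<comment> \<open>The leading 2 comes from absorbing X / 2, which \<open>near\<close>
    provides.\<close>
  define M where "M = 2 * (M1 * (1 + C * (K * (2 * Z * M1) + \<rho> * (M1 * Z))))"
  show ?thesis
  proof (intro exI[of _ M] conjI allI impI)
    show "0 \<le> M"
      using Z M1 \<rho> C K by (auto simp: M_def intro!: mult_nonneg_nonneg add_nonneg_nonneg)
    fix m :: nat and A :: "nat \<Rightarrow> nat \<Rightarrow> real" and u :: "nat \<Rightarrow> real" and F
    let ?I = "{1..m}"
    assume cd: "coercive_decaying \<tau> \<kappa> C m A"
    then have co: "coercive \<kappa> ?I A"
      and A: "\<And>j k. j \<in> ?I \<Longrightarrow> k \<in> ?I \<Longrightarrow> \<bar>A j k\<bar> \<le> C * decay \<tau> (lag j k)"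
      and sym: "\<And>j k. j \<in> ?I \<Longrightarrow> k \<in> ?I \<Longrightarrow> A j k = A k j"
      unfolding coercive_decaying_def by blast+
    assume F: "\<forall>j\<in>?I. \<bar>\<Sum>k\<in>?I. A j k * u k\<bar> \<le> F * decay \<tau> j"
    then have F: "\<And>j. j \<in> ?I \<Longrightarrow> \<bar>\<Sum>k\<in>?I. A j k * u k\<bar> \<le> F * decay \<tau> j"
      by blast
    show "\<forall>k\<in>?I. \<bar>u k\<bar> \<le> M * F * decay \<tau> k"
    proof (cases "m = 0")
      case False
      then have ne: "?I \<noteq> {}" and one: "1 \<in> ?I" by auto
      \<comment> \<open>For a nonempty system the hypothesis itself forces F to be nonnegative, as
        it bounds an absolute value.\<close>
      have F0: "0 \<le> F"
      proof -
        have "0 * decay \<tau> 1 \<le> F * decay \<tau> 1"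
          using order_trans[OF abs_ge_zero F[OF one]] by simp
        then show ?thesis
          by (rule mult_right_le_imp_le) simp
      qed
      \<comment> \<open>The center 0 lies outside the index set: indices are distances to the
        predicted time, and 0 is that time itself.\<close>
      define w where "w = (\<lambda>k. decay (- \<tau>) (lag 0 k))"
      have w: "0 \<le> w k" for k by (simp add: w_def)
      have wd: "w k * decay \<tau> k = 1" for k
        by (simp add: w_def decay_mult) (simp add: decay_def)
      define X where "X = Max ((\<lambda>k. w k * \<bar>u k\<bar>) ` ?I)"
      have X: "w k * \<bar>u k\<bar> \<le> X" if "k \<in> ?I" for k
        unfolding X_def using that by (intro Max_ge) auto
      have X0: "0 \<le> X"
        using order_trans[OF mult_nonneg_nonneg[OF w abs_ge_zero] X[OF one]] .
      have u_sup: "\<bar>u k\<bar> \<le> M1 * F" if "k \<in> ?I" for k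
      proof -
        have "\<bar>\<Sum>k\<in>?I. A j k * u k\<bar> \<le> F" if "j \<in> ?I" for j
          using F[OF that] mult_left_mono[OF decay_le_1[of \<tau> j] F0] \<tau> by simp
        with bounds cd that show ?thesis by blast
      qed
      have u_sum: "(\<Sum>k\<in>?I. \<bar>u k\<bar>) \<le> M1 * (F * Z)"
      proof (rule order_trans[OF conjunct2[OF bounds[rule_format, OF cd]]])
        have "(\<Sum>j\<in>?I. \<bar>\<Sum>k\<in>?I. A j k * u k\<bar>) \<le> (\<Sum>j\<in>?I. F * decay \<tau> j)"
          by (intro sum_mono F)
        also have "\<dots> \<le> F * Z"
          unfolding sum_distrib_left[symmetric] Z_def using F0 by (intro mult_left_mono sum_decay_le \<tau>) auto
        finally show "M1 * (\<Sum>j\<in>?I. \<bar>\<Sum>k\<in>?I. A j k * u k\<bar>) \<le> M1 * (F * Z)"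
          using M1 by (rule mult_left_mono)
      qed
      have row: "\<bar>\<Sum>l\<in>?I. A k l * (w l * u l)\<bar>
          \<le> F + C * (2 * (\<epsilon> * Z + \<rho> * t) * X + (K * (2 * Z * (M1 * F)) + \<rho> * (M1 * (F * Z))))"
        if k: "k \<in> ?I" for k
      proof -
        have "\<bar>\<Sum>l\<in>?I. A k l * (w l * u l)\<bar> \<le> w k * \<bar>\<Sum>l\<in>?I. A k l * u l\<bar>
          + C * ((\<Sum>l\<in>?I. (\<epsilon> * decay \<tau> (lag k l) + \<rho> * decay_from \<tau> N (lag k l)) * (w l * \<bar>u l\<bar>))
            + (\<Sum>l\<in>?I. (K * decay \<tau> (lag k l) + \<rho> * decay_from 0 N (lag k l)) * \<bar>u l\<bar>))"
          using ker[of k _ 0] by (intro abs_commutator_le[where \<tau> = \<tau>] finite_atLeastAtMost C k A w)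
            (simp_all add: w_def \<rho>_def add.assoc)
        also have "\<dots> \<le> F + C * (2 * (\<epsilon> * Z + \<rho> * t) * X + (K * (2 * Z * (M1 * F)) + \<rho> * (M1 * (F * Z))))"
        proof (intro add_mono mult_left_mono C)
          have "w k * \<bar>\<Sum>l\<in>?I. A k l * u l\<bar> \<le> w k * (F * decay \<tau> k)"
            by (intro mult_left_mono F k w)
          also have "\<dots> = F" using wd[of k] by (simp add: mult_ac)
          finally show "w k * \<bar>\<Sum>l\<in>?I. A k l * u l\<bar> \<le> F" .
          have "(\<Sum>l\<in>?I. (\<epsilon> * decay \<tau> (lag k l) + \<rho> * decay_from \<tau> N (lag k l)) * (w l * \<bar>u l\<bar>))
            \<le> (\<Sum>l\<in>?I. \<epsilon> * decay \<tau> (lag k l) + \<rho> * decay_from \<tau> N (lag k l)) * X"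
            unfolding sum_distrib_right using \<epsilon> \<rho> by (intro sum_mono mult_left_mono X) auto
          also have "\<dots> \<le> 2 * (\<epsilon> * Z + \<rho> * t) * X"
            unfolding Z_def t_def using \<epsilon> \<rho> X0 by (intro mult_right_mono sum_near_kernel_le[OF \<tau>]) auto
          finally show "(\<Sum>l\<in>?I. (\<epsilon> * decay \<tau> (lag k l) + \<rho> * decay_from \<tau> N (lag k l)) * (w l * \<bar>u l\<bar>))
            \<le> 2 * (\<epsilon> * Z + \<rho> * t) * X" .
          have "(\<Sum>l\<in>?I. (K * decay \<tau> (lag k l) + \<rho> * decay_from 0 N (lag k l)) * \<bar>u l\<bar>)
            \<le> (\<Sum>l\<in>?I. K * decay \<tau> (lag k l) * (M1 * F) + \<rho> * \<bar>u l\<bar>)"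
          proof (rule sum_mono)
            fix l assume l: "l \<in> ?I"
            have "\<rho> * decay_from 0 N (lag k l) * \<bar>u l\<bar> \<le> \<rho> * 1 * \<bar>u l\<bar>"
              using \<rho> by (intro mult_right_mono mult_left_mono) (auto simp: decay_from_def decay_le_1)
            moreover have "K * decay \<tau> (lag k l) * \<bar>u l\<bar> \<le> K * decay \<tau> (lag k l) * (M1 * F)"
              using K by (intro mult_left_mono u_sup l) auto
            ultimately show "(K * decay \<tau> (lag k l) + \<rho> * decay_from 0 N (lag k l)) * \<bar>u l\<bar>
                \<le> K * decay \<tau> (lag k l) * (M1 * F) + \<rho> * \<bar>u l\<bar>"
              by (simp add: distrib_right)
          qed
          also have "\<dots> = K * ((\<Sum>l\<in>?I. decay \<tau> (lag k l)) * (M1 * F)) + \<rho> * (\<Sum>l\<in>?I. \<bar>u l\<bar>)"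
            by (simp only: sum.distrib sum_distrib_left sum_distrib_right mult.assoc)
          also have "\<dots> \<le> K * (2 * Z * (M1 * F)) + \<rho> * (M1 * (F * Z))"
            unfolding Z_def using K \<rho> M1 F0 u_sum[unfolded Z_def] summable_decay[OF \<tau>]
            by (intro add_mono mult_left_mono mult_right_mono sum_lag_le) auto
          finally show "(\<Sum>l\<in>?I. (K * decay \<tau> (lag k l) + \<rho> * decay_from 0 N (lag k l)) * \<bar>u l\<bar>)
            \<le> K * (2 * Z * (M1 * F)) + \<rho> * (M1 * (F * Z))" .
        qed
        finally show ?thesis .
      qed
      \<comment> \<open>The sup bound is applied to the weighted vector \<open>w l * u l\<close>,
        whose image under \<open>A\<close> is bounded by \<open>row\<close>.\<close>
      have "\<forall>k\<in>?I. \<bar>w k * u k\<bar> \<le> M1 * (F + C * (2 * (\<epsilon> * Z + \<rho> * t) * X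
          + (K * (2 * Z * (M1 * F)) + \<rho> * (M1 * (F * Z)))))"
        by (rule conjunct1[OF bounds[rule_format, OF cd, of "\<lambda>l. w l * u l"], THEN spec, THEN mp])
          (use row in blast)
      then have "X \<le> M1 * (F + C * (2 * (\<epsilon> * Z + \<rho> * t) * X
          + (K * (2 * Z * (M1 * F)) + \<rho> * (M1 * (F * Z)))))"
        using ne w by (subst (1) X_def, subst Max_le_iff) (auto simp: abs_mult)
      also have "\<dots> = (M1 * C * (2 * (\<epsilon> * Z + \<rho> * t))) * X + M / 2 * F"
        by (simp add: M_def algebra_simps)
      also have "\<dots> \<le> 1 / 2 * X + M / 2 * F"
        by (intro add_right_mono mult_right_mono near X0)
      finally have XM: "X \<le> M * F" by simp
      show ?thesis
      proof
        fix k assume "k \<in> ?I"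
        then have "w k * \<bar>u k\<bar> \<le> M * F" using order_trans[OF X XM] by blast
        then have "w k * \<bar>u k\<bar> * decay \<tau> k \<le> M * F * decay \<tau> k"
          by (rule mult_right_mono) simp
        moreover have "w k * \<bar>u k\<bar> * decay \<tau> k = \<bar>u k\<bar>"
          using arg_cong[OF wd[of k], of "\<lambda>z. z * \<bar>u k\<bar>"] by (simp only: mult_ac mult_1_left mult_1_right)
        ultimately show "\<bar>u k\<bar> \<le> M * F * decay \<tau> k" by simp
      qed
    qed simp
  qed
qed

section \<open>Regularity of the coefficient functions\<close>

lemma continuously_differentiable_on_0:
  "continuously_differentiable_on 0 S f \<longleftrightarrow> continuous_on S f"
  unfolding continuously_differentiable_on_def
proof
  assume "\<exists>D. (\<forall>t\<in>S. D 0 t = f t) \<and>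
    (\<forall>m<0. \<forall>t\<in>S. (D m has_real_derivative D (Suc m) t) (at t within S)) \<and> continuous_on S (D 0)"
  then obtain D where "\<forall>t\<in>S. D 0 t = f t" "continuous_on S (D (0::nat))" by blast
  then show "continuous_on S f"
    by (subst (asm) continuous_on_cong[OF refl]) auto
qed (auto intro: exI[of _ "\<lambda>_. f"])

text \<open>A recursive form of the definition, on which all closure properties below are proved by
  induction on d with the function kept arbitrary. The derivative has to be transferred from
  \<open>D 0\<close> to \<open>f\<close> because the two agree only on \<open>S\<close>.\<close>

lemma continuously_differentiable_on_Suc:
  "continuously_differentiable_on (Suc d) S f \<longleftrightarrow>
    (\<exists>f'. (\<forall>t\<in>S. (f has_real_derivative f' t) (at t within S)) \<and> continuously_differentiable_on d S f')"
proof
  assume "continuously_differentiable_on (Suc d) S f"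
  then obtain D where D: "\<forall>t\<in>S. D 0 t = f t"
    "\<forall>m<Suc d. \<forall>t\<in>S. (D m has_real_derivative D (Suc m) t) (at t within S)"
    "continuous_on S (D (Suc d))"
    unfolding continuously_differentiable_on_def by blast
  have "(f has_real_derivative D 1 t) (at t within S)" if "t \<in> S" for t
  proof (rule has_field_derivative_transform_within[where d = 1])
    show "(D 0 has_real_derivative D 1 t) (at t within S)"
      using D(2) that by simp
  qed (use D(1) that in auto)
  moreover have "continuously_differentiable_on d S (D 1)"
    unfolding continuously_differentiable_on_def using D(2,3)
    by (intro exI[of _ "\<lambda>m. D (Suc m)"]) auto
  ultimately show "\<exists>f'. (\<forall>t\<in>S. (f has_real_derivative f' t) (at t within S)) \<and>
      continuously_differentiable_on d S f'"
    by blast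
next
  assume "\<exists>f'. (\<forall>t\<in>S. (f has_real_derivative f' t) (at t within S)) \<and> continuously_differentiable_on d S f'"
  then obtain f' D where f': "\<forall>t\<in>S. (f has_real_derivative f' t) (at t within S)"
    and D: "\<forall>t\<in>S. D 0 t = f' t"
    "\<forall>m<d. \<forall>t\<in>S. (D m has_real_derivative D (Suc m) t) (at t within S)" "continuous_on S (D d)"
    unfolding continuously_differentiable_on_def by blast
  show "continuously_differentiable_on (Suc d) S f"
    unfolding continuously_differentiable_on_def
    using f' D by (intro exI[of _ "case_nat f D"]) (auto simp: less_Suc_eq_0_disj)
qed

lemma continuously_differentiable_on_cong:
  "(\<And>t. t \<in> S \<Longrightarrow> f t = g t) \<Longrightarrow>
    continuously_differentiable_on d S f \<longleftrightarrow> continuously_differentiable_on d S g"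
  unfolding continuously_differentiable_on_def by (intro ex_cong1) auto

lemma continuously_differentiable_on_pred:
  "continuously_differentiable_on (Suc d) S f \<Longrightarrow> continuously_differentiable_on d S f"
proof (induction d arbitrary: f)
  case 0
  then show ?case
    unfolding continuously_differentiable_on_Suc continuously_differentiable_on_0
    by (auto intro: DERIV_continuous_on)
next
  case (Suc d)
  then obtain f' where "\<forall>t\<in>S. (f has_real_derivative f' t) (at t within S)"
    "continuously_differentiable_on (Suc d) S f'"
    unfolding continuously_differentiable_on_Suc[of "Suc d"] by blast
  with Suc.IH show ?case
    unfolding continuously_differentiable_on_Suc[of d] by blast
qed

lemma continuously_differentiable_on_const: "continuously_differentiable_on d S (\<lambda>_. c)"
proof (induction d arbitrary: c)
  case (Suc d)
  show ?case
    unfolding continuously_differentiable_on_Suc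
    by (rule exI[of _ "\<lambda>_. 0"]) (auto simp: Suc)
qed (simp add: continuously_differentiable_on_0)

lemma continuously_differentiable_on_add:
  "continuously_differentiable_on d S f \<Longrightarrow> continuously_differentiable_on d S g \<Longrightarrow>
    continuously_differentiable_on d S (\<lambda>t. f t + g t)"
proof (induction d arbitrary: f g)
  case 0
  then show ?case by (simp add: continuously_differentiable_on_0 continuous_on_add)
next
  case (Suc d)
  then obtain f' g' where "\<forall>t\<in>S. (f has_real_derivative f' t) (at t within S)"
    "continuously_differentiable_on d S f'" "\<forall>t\<in>S. (g has_real_derivative g' t) (at t within S)"
    "continuously_differentiable_on d S g'"
    unfolding continuously_differentiable_on_Suc by blast
  with Suc.IH[of f' g'] show ?case
    unfolding continuously_differentiable_on_Suc
    by (intro exI[of _ "\<lambda>t. f' t + g' t"]) (auto intro!: derivative_eq_intros)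
qed

lemma continuously_differentiable_on_mult:
  "continuously_differentiable_on d S f \<Longrightarrow> continuously_differentiable_on d S g \<Longrightarrow>
    continuously_differentiable_on d S (\<lambda>t. f t * g t)"
proof (induction d arbitrary: f g)
  case 0
  then show ?case by (simp add: continuously_differentiable_on_0 continuous_on_mult)
next
  case (Suc d)
  then obtain f' g' where f': "\<forall>t\<in>S. (f has_real_derivative f' t) (at t within S)"
    "continuously_differentiable_on d S f'" and g': "\<forall>t\<in>S. (g has_real_derivative g' t) (at t within S)"
    "continuously_differentiable_on d S g'"
    unfolding continuously_differentiable_on_Suc by blast
  have "continuously_differentiable_on d S (\<lambda>t. f' t * g t + f t * g' t)"
    using Suc.IH[OF f'(2) continuously_differentiable_on_pred[OF Suc.prems(2)]]
      Suc.IH[OF continuously_differentiable_on_pred[OF Suc.prems(1)] g'(2)]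
    by (rule continuously_differentiable_on_add)
  with f'(1) g'(1) show ?case
    unfolding continuously_differentiable_on_Suc
    by (intro exI[of _ "\<lambda>t. f' t * g t + f t * g' t"]) (auto intro!: derivative_eq_intros)
qed

lemma continuously_differentiable_on_inverse:
  "continuously_differentiable_on d S f \<Longrightarrow> (\<And>t. t \<in> S \<Longrightarrow> f t \<noteq> 0) \<Longrightarrow>
    continuously_differentiable_on d S (\<lambda>t. inverse (f t))"
proof (induction d arbitrary: f)
  case 0
  then show ?case by (simp add: continuously_differentiable_on_0 continuous_on_inverse)
next
  case (Suc d)
  then obtain f' where f': "\<forall>t\<in>S. (f has_real_derivative f' t) (at t within S)"
    "continuously_differentiable_on d S f'"
    unfolding continuously_differentiable_on_Suc by blast
  have "continuously_differentiable_on d S (\<lambda>t. inverse (f t))"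
    by (rule Suc.IH[OF continuously_differentiable_on_pred[OF Suc.prems(1)] Suc.prems(2)])
  then have "continuously_differentiable_on d S (\<lambda>t. - 1 * f' t * (inverse (f t) * inverse (f t)))"
    using f' by (intro continuously_differentiable_on_mult continuously_differentiable_on_const)
  with f'(1) Suc.prems(2) show ?case
    unfolding continuously_differentiable_on_Suc
    by (intro exI[of _ "\<lambda>t. - 1 * f' t * (inverse (f t) * inverse (f t))"])
      (auto intro!: derivative_eq_intros simp: power2_eq_square)
qed

lemma continuously_differentiable_on_sum:
  "(\<And>i. i \<in> I \<Longrightarrow> continuously_differentiable_on d S (f i)) \<Longrightarrow>
    continuously_differentiable_on d S (\<lambda>t. \<Sum>i\<in>I. f i t)"
  by (induction I rule: infinite_finite_induct)
    (auto intro: continuously_differentiable_on_add continuously_differentiable_on_const)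

lemma continuously_differentiable_on_prod:
  "(\<And>i. i \<in> I \<Longrightarrow> continuously_differentiable_on d S (f i)) \<Longrightarrow>
    continuously_differentiable_on d S (\<lambda>t. \<Prod>i\<in>I. f i t)"
  by (induction I rule: infinite_finite_induct)
    (auto intro: continuously_differentiable_on_mult continuously_differentiable_on_const)

text \<open>By the Leibniz formula the determinant is a polynomial in the entries. Applied to
  minors, this gives the regularity of the adjugate.\<close>

lemma continuously_differentiable_on_det:
  assumes "\<And>t. A t \<in> carrier_mat m m"
    and "\<And>i j. i < m \<Longrightarrow> j < m \<Longrightarrow> continuously_differentiable_on d S (\<lambda>t. A t $$ (i, j))"
  shows "continuously_differentiable_on d S (\<lambda>t. Determinant.det (A t))"
proof -
  have "Determinant.det (A t)
      = (\<Sum>p | p permutes {0..<m}. signof p * (\<Prod>i = 0..<m. A t $$ (i, p i)))" for t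
    by (rule Determinant.det_def'[OF assms(1)])
  moreover have "p i < m" if "p permutes {0..<m}" "i < m" for p i
    using permutes_in_image[OF that(1), of i] that(2) by simp
  ultimately show ?thesis
    by (auto intro!: continuously_differentiable_on_sum continuously_differentiable_on_prod
        continuously_differentiable_on_mult continuously_differentiable_on_const assms(2))
qed

lemma continuously_differentiable_on_adj_mat:
  assumes "\<And>t. A t \<in> carrier_mat m m"
    and "\<And>i j. i < m \<Longrightarrow> j < m \<Longrightarrow> continuously_differentiable_on d S (\<lambda>t. A t $$ (i, j))"
    and "i < m" "j < m"
  shows "continuously_differentiable_on d S (\<lambda>t. adj_mat (A t) $$ (i, j))"
proof -
  have dim: "dim_row (A t) = m" "dim_col (A t) = m" for t
    using assms(1)[of t] by auto
  have "continuously_differentiable_on d S (\<lambda>t. Determinant.det (mat_delete (A t) j i))"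
  proof (rule continuously_differentiable_on_det[where m = "m - 1"])
    show "mat_delete (A t) j i \<in> carrier_mat (m - 1) (m - 1)" for t
      using mat_delete_carrier[OF assms(1)] .
    fix i' j' assume "i' < m - 1" "j' < m - 1"
    then show "continuously_differentiable_on d S (\<lambda>t. mat_delete (A t) j i $$ (i', j'))"
      using assms(2) by (auto simp: mat_delete_def dim)
  qed
  then show ?thesis
    using assms(3,4) by (auto simp: adj_mat_def Determinant.cofactor_def dim
        intro!: continuously_differentiable_on_mult continuously_differentiable_on_const)
qed

text \<open>The inverse in \<open>coef_vec\<close> comes from an elimination algorithm, whose
  dependence on t is opaque. Uniqueness of inverses identifies it with the adjugate formula, whose
  entries are rational functions of the entries of the matrix.\<close>

lemma Gamma_mat_inverse:
  assumes "coercive \<kappa> {1..b} (\<lambda>j k. \<gamma> t (lag j k))" "0 < \<kappa>"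
  shows "Determinant.det (Gamma_mat \<gamma> b t) \<noteq> 0"
    and "the (mat_inverse (Gamma_mat \<gamma> b t))
      = inverse (Determinant.det (Gamma_mat \<gamma> b t)) \<cdot>\<^sub>m adj_mat (Gamma_mat \<gamma> b t)" (is "?R = ?Q")
    and "Gamma_mat \<gamma> b t * the (mat_inverse (Gamma_mat \<gamma> b t)) = 1\<^sub>m b"
proof -
  let ?G = "Gamma_mat \<gamma> b t"
  have G: "?G \<in> carrier_mat b b"
    by (simp add: Gamma_mat_def)
  show det: "Determinant.det ?G \<noteq> 0"
    using coercive_det_nonzero[OF assms] by (simp add: Gamma_mat_def)
  obtain B where B: "mat_inverse ?G = Some B"
    by (metis not_None_eq mat_inverse(1)[OF G] det_non_zero_imp_unit[OF G det])
  from mat_inverse(2)[OF G B] have inv: "?G * B = 1\<^sub>m b" "B * ?G = 1\<^sub>m b" "B \<in> carrier_mat b b"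
    by auto
  show "?G * ?R = 1\<^sub>m b"
    using inv B by simp
  have Q: "?Q \<in> carrier_mat b b"
    using adj_mat(1)[OF G] by simp
  have GQ: "?G * ?Q = 1\<^sub>m b"
    using adj_mat(1,2)[OF G] G det by (auto simp: mult_smult_distrib[OF G] intro!: eq_matI)
  have "B = B * (?G * ?Q)"
    using GQ inv(3) by simp
  also have "\<dots> = (B * ?G) * ?Q"
    by (rule assoc_mult_mat[symmetric, OF inv(3) G Q])
  also have "\<dots> = ?Q"
    unfolding inv(2) by (rule left_mult_one_mat[OF Q])
  finally show "?R = ?Q"
    using B by simp
qed

lemma coef_fun_normal_equations:
  assumes "coercive \<kappa> {1..b} (\<lambda>j k. \<gamma> t (lag j k))" "0 < \<kappa>" "k \<in> {1..b}"
  shows "(\<Sum>j=1..b. \<gamma> t (lag k j) * coef_fun \<gamma> \<mu> b j t) = \<gamma> t k"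
proof -
  let ?G = "Gamma_mat \<gamma> b t" and ?v = "gamma_vec \<gamma> b t"
  let ?R = "the (mat_inverse ?G)"
  have G: "?G \<in> carrier_mat b b" and v: "?v \<in> carrier_vec b"
    by (simp_all add: Gamma_mat_def gamma_vec_def)
  have R: "?R \<in> carrier_mat b b"
    unfolding Gamma_mat_inverse(2)[of \<kappa> b \<gamma> t, OF assms(1,2)] using adj_mat(1)[OF G] by simp
  have c: "coef_vec \<gamma> b t \<in> carrier_vec b"
    unfolding coef_vec_def using R v by auto
  obtain i where k: "k = Suc i" "i < b"
    using assms(3) by (cases k) auto
  have "?G *\<^sub>v coef_vec \<gamma> b t = (?G * ?R) *\<^sub>v ?v"
    unfolding coef_vec_def using G R v by (simp add: assoc_mult_mat_vec)
  also have "\<dots> = ?v"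
    unfolding Gamma_mat_inverse(3)[of \<kappa> b \<gamma> t, OF assms(1,2)] using v by simp
  finally have "vec_index (?G *\<^sub>v coef_vec \<gamma> b t) i = \<gamma> t k"
    using k by (simp add: gamma_vec_def)
  moreover have "vec_index (?G *\<^sub>v coef_vec \<gamma> b t) i
      = (\<Sum>j\<in>{0..<b}. \<gamma> t (lag k (Suc j)) * coef_fun \<gamma> \<mu> b (Suc j) t)"
    using k c by (auto simp: Gamma_mat_def scalar_prod_def coef_fun_def intro!: sum.cong)
  ultimately show ?thesis
    using sum_lessThan_shift[of "\<lambda>j. \<gamma> t (lag k j) * coef_fun \<gamma> \<mu> b j t" b] by simp
qed

lemma continuously_differentiable_on_coef_fun:
  assumes co: "\<And>t. t \<in> S \<Longrightarrow> coercive \<kappa> {1..b} (\<lambda>j k. \<gamma> t (lag j k))" and "0 < \<kappa>"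
    and \<gamma>: "\<And>j. continuously_differentiable_on d S (\<lambda>t. \<gamma> t j)"
    and \<mu>: "continuously_differentiable_on d S \<mu>"
    and "j \<le> b"
  shows "continuously_differentiable_on d S (coef_fun \<gamma> \<mu> b j)"
proof -
  have G: "Gamma_mat \<gamma> b t \<in> carrier_mat b b" for t
    by (simp add: Gamma_mat_def)
  have entry: "continuously_differentiable_on d S (\<lambda>t. Gamma_mat \<gamma> b t $$ (i, k))" if "i < b" "k < b" for i k
    using that \<gamma> by (simp add: Gamma_mat_def)
  have vec: "continuously_differentiable_on d S (\<lambda>t. vec_index (coef_vec \<gamma> b t) i)" if i: "i < b" for i
  proof -
    have "vec_index (coef_vec \<gamma> b t) i = (\<Sum>k\<in>{0..<b}.
        inverse (Determinant.det (Gamma_mat \<gamma> b t)) * adj_mat (Gamma_mat \<gamma> b t) $$ (i, k) * \<gamma> t (Suc k))"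
      if "t \<in> S" for t
      using i adj_mat(1)[OF G[of t]] unfolding coef_vec_def Gamma_mat_inverse(2)[of \<kappa> b \<gamma> t, OF co[OF that] assms(2)]
      by (auto simp: scalar_prod_def gamma_vec_def intro!: sum.cong)
    then have "continuously_differentiable_on d S (\<lambda>t. vec_index (coef_vec \<gamma> b t) i)
        \<longleftrightarrow> continuously_differentiable_on d S (\<lambda>t. \<Sum>k\<in>{0..<b}.
        inverse (Determinant.det (Gamma_mat \<gamma> b t)) * adj_mat (Gamma_mat \<gamma> b t) $$ (i, k) * \<gamma> t (Suc k))"
      by (rule continuously_differentiable_on_cong)
    also have "\<dots>"
      using i by (intro continuously_differentiable_on_sum continuously_differentiable_on_mult
          continuously_differentiable_on_inverse continuously_differentiable_on_det[where m = b] G entry \<gamma>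
          continuously_differentiable_on_adj_mat[where m = b] Gamma_mat_inverse(1)[where \<kappa> = \<kappa>] co assms(2)) auto
    finally show ?thesis .
  qed
  show ?thesis
  proof (cases "j = 0")
    case True
    have "continuously_differentiable_on d S
        (\<lambda>t. \<mu> t + - 1 * (\<Sum>k=1..b. vec_index (coef_vec \<gamma> b t) (k - 1) * \<mu> t))"
      by (intro continuously_differentiable_on_add continuously_differentiable_on_mult
          continuously_differentiable_on_const continuously_differentiable_on_sum \<mu> vec) auto
    with True show ?thesis
      by (simp add: coef_fun_def[abs_def])
  next
    case False
    with \<open>j \<le> b\<close> vec[of "j - 1"] show ?thesis
      by (simp add: coef_fun_def[abs_def])
  qed
qed

section \<open>Covariances and best linear prediction\<close>

lemma integrable_mult_square_integrable:
  assumes "square_integrable M X" "square_integrable M Y"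
  shows "integrable M (\<lambda>\<omega>. X \<omega> * Y \<omega>)"
proof (rule Bochner_Integration.integrable_bound)
  show "integrable M (\<lambda>\<omega>. (X \<omega>)\<^sup>2 + (Y \<omega>)\<^sup>2)"
    using assms by (auto simp: square_integrable_def)
  show "(\<lambda>\<omega>. X \<omega> * Y \<omega>) \<in> borel_measurable M"
    using assms by (auto simp: square_integrable_def)
  have "\<bar>X \<omega> * Y \<omega>\<bar> \<le> (X \<omega>)\<^sup>2 + (Y \<omega>)\<^sup>2" for \<omega>
  proof -
    have "0 \<le> (\<bar>X \<omega>\<bar> - \<bar>Y \<omega>\<bar>)\<^sup>2" by simp
    then have "2 * (\<bar>X \<omega>\<bar> * \<bar>Y \<omega>\<bar>) \<le> (X \<omega>)\<^sup>2 + (Y \<omega>)\<^sup>2"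
      by (simp add: power2_eq_square algebra_simps)
    moreover have "0 \<le> \<bar>X \<omega>\<bar> * \<bar>Y \<omega>\<bar>" by simp
    ultimately show ?thesis unfolding abs_mult by linarith
  qed
  then show "AE \<omega> in M. norm (X \<omega> * Y \<omega>) \<le> norm ((X \<omega>)\<^sup>2 + (Y \<omega>)\<^sup>2)"
    by simp
qed

lemma square_integrable_cmult:
  "square_integrable M X \<Longrightarrow> square_integrable M (\<lambda>\<omega>. c * X \<omega>)"
  by (auto simp: square_integrable_def power_mult_distrib)

lemma square_integrable_add:
  assumes "square_integrable M X" "square_integrable M Y"
  shows "square_integrable M (\<lambda>\<omega>. X \<omega> + Y \<omega>)"
proof -
  have "integrable M (\<lambda>\<omega>. (X \<omega>)\<^sup>2 + (Y \<omega>)\<^sup>2 + 2 * (X \<omega> * Y \<omega>))"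
    using assms integrable_mult_square_integrable[OF assms]
    by (auto simp: square_integrable_def)
  then show ?thesis
    using assms by (auto simp: square_integrable_def power2_sum mult.assoc)
qed

lemma square_integrable_diff:
  "square_integrable M X \<Longrightarrow> square_integrable M Y \<Longrightarrow> square_integrable M (\<lambda>\<omega>. X \<omega> - Y \<omega>)"
  using square_integrable_add[OF _ square_integrable_cmult[of M Y "- 1"], of X] by simp

lemma square_integrable_const: "prob_space M \<Longrightarrow> square_integrable M (\<lambda>_. c)"
  by (auto simp: square_integrable_def prob_space.finite_measure finite_measure.integrable_const)

lemma square_integrable_sum:
  assumes "prob_space M" "\<And>k. k \<in> K \<Longrightarrow> square_integrable M (X k)"
  shows "square_integrable M (\<lambda>\<omega>. \<Sum>k\<in>K. X k \<omega>)"
  using assms(2) by (induction K rule: infinite_finite_induct)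
    (auto intro: square_integrable_add square_integrable_const[OF assms(1)])

lemma square_integrable_integrable:
  "prob_space M \<Longrightarrow> square_integrable M X \<Longrightarrow> integrable M X"
  using integrable_mult_square_integrable[OF _ square_integrable_const[of M 1]] by simp

lemma covariance_eq:
  assumes "prob_space M" "square_integrable M X" "square_integrable M Y"
  shows "covariance M X Y = (LINT \<omega>|M. X \<omega> * Y \<omega>) - (LINT \<omega>|M. X \<omega>) * (LINT \<omega>|M. Y \<omega>)"
proof -
  interpret prob_space M by fact
  let ?a = "LINT \<omega>|M. X \<omega>" and ?b = "LINT \<omega>|M. Y \<omega>"
  note int = integrable_mult_square_integrable[OF assms(2,3)]
    square_integrable_integrable[OF assms(1,2)] square_integrable_integrable[OF assms(1,3)]
  have "covariance M X Y = (LINT \<omega>|M. X \<omega> * Y \<omega> - ?b * X \<omega> - ?a * Y \<omega> + ?a * ?b)"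
    unfolding covariance_def by (intro Bochner_Integration.integral_cong refl) (simp add: algebra_simps)
  also have "\<dots> = (LINT \<omega>|M. X \<omega> * Y \<omega>) - ?b * ?a - ?a * ?b + ?a * ?b"
    using int by (simp add: prob_space)
  finally show ?thesis by simp
qed

lemma covariance_commute: "covariance M X Y = covariance M Y X"
  by (simp add: covariance_def mult.commute)

text \<open>First-order condition at a minimum, tested at h = - a / (\<bar>q\<bar> + 1). It yields
  both the normal equations of the best predictor and the eigenvector equation for a minimizer of
  the Rayleigh quotient.\<close>

lemma linear_coefficient_eq_0:
  fixes a q :: real
  assumes "\<And>h. 0 \<le> 2 * h * a + h\<^sup>2 * q"
  shows "a = 0"
proof (rule ccontr)
  assume "a \<noteq> 0"
  define r where "r = \<bar>q\<bar> + 1"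
  have r: "0 < r" "q < r" by (auto simp: r_def)
  have "0 \<le> 2 * (- a / r) * a + (- a / r)\<^sup>2 * q"
    by (rule assms)
  also have "\<dots> = a\<^sup>2 / r\<^sup>2 * (q - 2 * r)"
    using r by (simp add: field_simps power2_eq_square)
  also have "\<dots> < 0"
    using r \<open>a \<noteq> 0\<close> by (intro mult_pos_neg) auto
  finally show False by simp
qed

text \<open>Changing a single coefficient shows that the residual is orthogonal to the constants and
  to each predecessor. The first relation is the equation for the means; using it to eliminate
  \<open>c 0\<close> from the second turns second moments into covariances.\<close>

lemma best_linear_prediction_normal_equations:
  assumes M: "prob_space M" and X: "\<And>j. j \<in> {1..i} \<Longrightarrow> square_integrable M (X j)"
    and best: "best_linear_prediction M X i c" and i: "1 \<le> i"
  shows "(LINT \<omega>|M. X i \<omega>) = c 0 + (\<Sum>j=1..i - 1. c j * (LINT \<omega>|M. X (i - j) \<omega>))"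
    and "\<And>k. k \<in> {1..i - 1} \<Longrightarrow>
      (\<Sum>j=1..i - 1. covariance M (X (i - k)) (X (i - j)) * c j) = covariance M (X (i - k)) (X i)"
proof -
  interpret prob_space M by fact
  define R where "R = prediction_error X i c"
  have X': "square_integrable M (X (i - j))" if "j \<in> {1..i - 1}" for j
    using that i by (intro X) auto
  have Xi: "square_integrable M (X i)"
    using i by (intro X) auto
  have lp: "square_integrable M (linear_prediction X i c)" for c
    unfolding linear_prediction_def[abs_def]
    by (intro square_integrable_add square_integrable_const square_integrable_sum square_integrable_cmult X' M)
  have R: "square_integrable M R"
    unfolding R_def prediction_error_def[abs_def] by (intro square_integrable_diff Xi lp)
  have orth: "(LINT \<omega>|M. R \<omega> * Y \<omega>) = 0"
    if Y: "square_integrable M Y"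
      and c': "\<And>h. \<exists>c'. \<forall>\<omega>. linear_prediction X i c' \<omega> = linear_prediction X i c \<omega> - h * Y \<omega>" for Y
  proof (rule linear_coefficient_eq_0)
    fix h :: real
    obtain c' where "\<forall>\<omega>. linear_prediction X i c' \<omega> = linear_prediction X i c \<omega> - h * Y \<omega>"
      using c' by blast
    then have "(LINT \<omega>|M. (R \<omega>)\<^sup>2) \<le> (LINT \<omega>|M. (R \<omega> + h * Y \<omega>)\<^sup>2)"
      using best[unfolded best_linear_prediction_def, rule_format, of c']
      by (simp add: R_def prediction_error_def diff_diff_eq2 add_diff_eq diff_add_eq)
    also have "\<dots> = (LINT \<omega>|M. (R \<omega>)\<^sup>2 + 2 * h * (R \<omega> * Y \<omega>) + h\<^sup>2 * (Y \<omega>)\<^sup>2)"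
      by (intro Bochner_Integration.integral_cong refl) (simp add: power2_eq_square algebra_simps)
    also have "\<dots> = (LINT \<omega>|M. (R \<omega>)\<^sup>2) + 2 * h * (LINT \<omega>|M. R \<omega> * Y \<omega>) + h\<^sup>2 * (LINT \<omega>|M. (Y \<omega>)\<^sup>2)"
      using R Y integrable_mult_square_integrable[OF R Y] by (simp add: square_integrable_def)
    finally show "0 \<le> 2 * h * (LINT \<omega>|M. R \<omega> * Y \<omega>) + h\<^sup>2 * (LINT \<omega>|M. (Y \<omega>)\<^sup>2)"
      by simp
  qed
  have R_eq: "R \<omega> = X i \<omega> - c 0 - (\<Sum>j=1..i - 1. c j * X (i - j) \<omega>)" for \<omega>
    by (simp add: R_def prediction_error_def linear_prediction_def)
  have "(LINT \<omega>|M. R \<omega> * 1) = 0"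
  proof (rule orth)
    fix h :: real
    show "\<exists>c'. \<forall>\<omega>. linear_prediction X i c' \<omega> = linear_prediction X i c \<omega> - h * 1"
      by (rule exI[of _ "c(0 := c 0 - h)"]) (auto simp: linear_prediction_def intro!: sum.cong)
  qed (rule square_integrable_const[OF M])
  moreover have "(LINT \<omega>|M. R \<omega>) = (LINT \<omega>|M. X i \<omega>) - c 0 - (\<Sum>j=1..i - 1. c j * (LINT \<omega>|M. X (i - j) \<omega>))"
  proof -
    have "integrable M (\<lambda>\<omega>. \<Sum>j=1..i - 1. c j * X (i - j) \<omega>)"
      by (intro Bochner_Integration.integrable_sum integrable_mult_right square_integrable_integrable[OF M X'])
    moreover have "(LINT \<omega>|M. (\<Sum>j=1..i - 1. c j * X (i - j) \<omega>))
        = (\<Sum>j=1..i - 1. c j * (LINT \<omega>|M. X (i - j) \<omega>))"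
      by (subst Bochner_Integration.integral_sum)
        (auto intro!: integrable_mult_right square_integrable_integrable[OF M X'])
    ultimately show ?thesis
      unfolding R_eq using square_integrable_integrable[OF M Xi]
      by (simp add: prob_space del: One_nat_def)
  qed
  ultimately show mean: "(LINT \<omega>|M. X i \<omega>) = c 0 + (\<Sum>j=1..i - 1. c j * (LINT \<omega>|M. X (i - j) \<omega>))"
    by simp
  fix k assume k: "k \<in> {1..i - 1}"
  have "(LINT \<omega>|M. R \<omega> * X (i - k) \<omega>) = 0"
  proof (rule orth[OF X'[OF k]])
    fix h :: real
    have "(\<Sum>j=1..i - 1. (c(k := c k - h)) j * X (i - j) \<omega>)
        = (\<Sum>j=1..i - 1. c j * X (i - j) \<omega> - (if j = k then h * X (i - k) \<omega> else 0))" for \<omega>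
      by (intro sum.cong refl) (auto simp: algebra_simps)
    then show "\<exists>c'. \<forall>\<omega>. linear_prediction X i c' \<omega> = linear_prediction X i c \<omega> - h * X (i - k) \<omega>"
      using k by (intro exI[of _ "c(k := c k - h)"]) (simp add: linear_prediction_def sum_subtractf)
  qed
  moreover have "(LINT \<omega>|M. R \<omega> * X (i - k) \<omega>) = (LINT \<omega>|M. X (i - k) \<omega> * X i \<omega>)
      - c 0 * (LINT \<omega>|M. X (i - k) \<omega>) - (\<Sum>j=1..i - 1. (LINT \<omega>|M. X (i - k) \<omega> * X (i - j) \<omega>) * c j)"
  proof -
    have "R \<omega> * X (i - k) \<omega> = X (i - k) \<omega> * X i \<omega> - c 0 * X (i - k) \<omega>
        - (\<Sum>j=1..i - 1. (X (i - k) \<omega> * X (i - j) \<omega>) * c j)" for \<omega>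
      by (simp add: R_eq sum_distrib_left sum_distrib_right algebra_simps)
    moreover have "integrable M (\<lambda>\<omega>. \<Sum>j=1..i - 1. (X (i - k) \<omega> * X (i - j) \<omega>) * c j)"
      by (intro Bochner_Integration.integrable_sum integrable_mult_left
          integrable_mult_square_integrable[OF X'[OF k] X'])
    moreover have "(LINT \<omega>|M. (\<Sum>j=1..i - 1. (X (i - k) \<omega> * X (i - j) \<omega>) * c j))
        = (\<Sum>j=1..i - 1. (LINT \<omega>|M. X (i - k) \<omega> * X (i - j) \<omega>) * c j)"
      by (subst Bochner_Integration.integral_sum)
        (auto intro!: integrable_mult_left integrable_mult_square_integrable[OF X'[OF k] X'])
    ultimately show ?thesis
      using integrable_mult_square_integrable[OF X'[OF k] Xi] square_integrable_integrable[OF M X'[OF k]]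
      by (simp del: One_nat_def)
  qed
  ultimately have eq: "(\<Sum>j=1..i - 1. (LINT \<omega>|M. X (i - k) \<omega> * X (i - j) \<omega>) * c j)
      = (LINT \<omega>|M. X (i - k) \<omega> * X i \<omega>) - c 0 * (LINT \<omega>|M. X (i - k) \<omega>)"
    by simp
  have "(\<Sum>j=1..i - 1. covariance M (X (i - k)) (X (i - j)) * c j)
      = (\<Sum>j=1..i - 1. (LINT \<omega>|M. X (i - k) \<omega> * X (i - j) \<omega>) * c j
          - (LINT \<omega>|M. X (i - k) \<omega>) * (c j * (LINT \<omega>|M. X (i - j) \<omega>)))"
    by (intro sum.cong refl) (simp add: covariance_eq[OF M X'[OF k] X'] left_diff_distrib right_diff_distrib mult_ac)
  also have "\<dots> = covariance M (X (i - k)) (X i)"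
    unfolding sum_subtractf eq sum_distrib_left[symmetric] covariance_eq[OF M X'[OF k] Xi] mean
    by (simp add: algebra_simps)
  finally show "(\<Sum>j=1..i - 1. covariance M (X (i - k)) (X (i - j)) * c j) = covariance M (X (i - k)) (X i)" .
qed

text \<open>A minimizer of the Rayleigh quotient is an eigenvector.\<close>

lemma coercive_Min_spectrum:
  fixes A :: "nat \<Rightarrow> nat \<Rightarrow> real"
  assumes sym: "\<And>j k. j \<in> {1..n} \<Longrightarrow> k \<in> {1..n} \<Longrightarrow> A j k = A k j"
    and \<kappa>: "\<kappa> \<le> Min (spectrum (Matrix.mat n n (\<lambda>(i, j). A (i + 1) (j + 1))))"
  shows "coercive \<kappa> {1..n} A"
\<comment> \<open>For n = 0 the spectrum is empty and \<open>Min\<close> is unspecified, but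
  coercivity over an empty index set is trivial.\<close>
proof (cases "n = 0")
  case False
  define I where "I = {1..n}"
  have I: "finite I" "1 \<in> I" using False by (auto simp: I_def)
  define Q where "Q = (\<lambda>u :: nat \<Rightarrow> real. \<Sum>j\<in>I. \<Sum>k\<in>I. A j k * u j * u k)"
  \<comment> \<open>The unit sphere inside the space of all functions on nat. Coordinates outside
    \<open>I\<close> are pinned to 0 and the others confined to [-1, 1], which the sphere implies
    anyway, so that Tychonoff's theorem gives compactness.\<close>
  define S :: "(nat \<Rightarrow> real) set" where
    "S = (\<Pi>\<^sub>E i\<in>UNIV. if i \<in> I then {-1..1} else {0}) \<inter> {u. (\<Sum>i\<in>I. (u i)\<^sup>2) = 1}"
  have "compact (\<Pi>\<^sub>E i\<in>UNIV. if i \<in> I then {-1..1} else {0 :: real})"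
    using compactin_PiE[of "\<lambda>_. euclidean :: real topology" UNIV "\<lambda>i. if i \<in> I then {-1..1} else {0 :: real}"]
    by (simp add: euclidean_product_topology compactin_euclidean_iff)
  moreover have "closed {u :: nat \<Rightarrow> real. (\<Sum>i\<in>I. (u i)\<^sup>2) = 1}"
    by (intro closed_Collect_eq continuous_intros continuous_on_product_coordinates)
  ultimately have "compact S"
    unfolding S_def by (rule compact_Int_closed)
  moreover have "S \<noteq> {}"
  proof -
    have "(\<lambda>i. if i = 1 then 1 else 0) \<in> S"
      using I by (auto simp: S_def if_distrib[of "\<lambda>x. x\<^sup>2"] cong: if_cong)
    then show ?thesis by blast
  qed
  moreover have "continuous_on S Q"
    unfolding Q_def
    by (intro continuous_intros continuous_on_subset[OF continuous_on_product_coordinates]) auto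
  ultimately obtain v where v: "v \<in> S" and min: "\<And>y. y \<in> S \<Longrightarrow> Q v \<le> Q y"
    using continuous_attains_inf[of S Q] by blast
  have v1: "(\<Sum>i\<in>I. (v i)\<^sup>2) = 1"
    using v by (simp add: S_def)
  have rayleigh: "Q v * (\<Sum>i\<in>I. (u i)\<^sup>2) \<le> Q u" for u
  proof (cases "(\<Sum>i\<in>I. (u i)\<^sup>2) = 0")
    case True
    then have "\<forall>i\<in>I. u i = 0"
      using I by (simp add: sum_nonneg_eq_0_iff)
    with True show ?thesis
      by (simp add: Q_def)
  next
    case nz: False
    define r where "r = sqrt (\<Sum>i\<in>I. (u i)\<^sup>2)"
    have r2: "r\<^sup>2 = (\<Sum>i\<in>I. (u i)\<^sup>2)"
      by (simp add: r_def sum_nonneg)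
    have r: "0 < r"
      using nz by (simp add: r_def order_less_le sum_nonneg)
    define y where "y = (\<lambda>i. if i \<in> I then u i / r else 0)"
    have "(\<Sum>i\<in>I. (y i)\<^sup>2) = (\<Sum>i\<in>I. (u i)\<^sup>2 / r\<^sup>2)"
      by (intro sum.cong) (simp_all add: y_def power_divide)
    also have "\<dots> = 1"
      using r by (simp add: sum_divide_distrib[symmetric] r2[symmetric])
    finally have y1: "(\<Sum>i\<in>I. (y i)\<^sup>2) = 1" .
    have "\<bar>y i\<bar> \<le> 1" if "i \<in> I" for i
    proof -
      have "(y i)\<^sup>2 \<le> (\<Sum>i\<in>I. (y i)\<^sup>2)"
        using that I by (intro member_le_sum) auto
      with y1 show ?thesis
        by (simp add: abs_square_le_1)
    qed
    then have "y i \<in> (if i \<in> I then {-1..1} else {0})" for i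
      by (cases "i \<in> I") (fastforce simp: abs_le_iff, simp add: y_def)
    then have "y \<in> S"
      using y1 by (simp add: S_def PiE_UNIV_domain)
    then have "Q v \<le> Q y"
      by (rule min)
    also have "Q y = (\<Sum>j\<in>I. \<Sum>k\<in>I. A j k * u j * u k / r\<^sup>2)"
      unfolding Q_def by (intro sum.cong) (simp_all add: y_def power2_eq_square)
    also have "\<dots> = Q u / r\<^sup>2"
      by (simp add: Q_def sum_divide_distrib)
    finally show ?thesis
      using r by (simp add: r2[symmetric] field_simps)
  qed
  \<comment> \<open>Perturbing the minimizer in the coordinate direction k keeps the Rayleigh
    inequality; its linear coefficient in h is the k-th component of the eigenvalue
    equation.\<close>
  have eig: "(\<Sum>l\<in>I. A k l * v l) = Q v * v k" if k: "k \<in> I" for k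
  proof -
    have "(\<Sum>l\<in>I. A k l * v l) - Q v * v k = 0"
    proof (rule linear_coefficient_eq_0)
      fix h :: real
      define e where "e = (\<lambda>i. if i = k then 1 else (0 :: real))"
      have d: "(\<Sum>i\<in>I. f i * e i) = f k" for f
        using k I by (subst sum.cong[OF refl, of _ _ "\<lambda>i. if i = k then f i else 0"]) (auto simp: e_def)
      have "(\<Sum>i\<in>I. (v i + h * e i)\<^sup>2) = (\<Sum>i\<in>I. (v i)\<^sup>2 + 2 * h * (v i * e i) + h\<^sup>2 * (e i * e i))"
        by (intro sum.cong refl) (simp add: power2_eq_square algebra_simps)
      also have "\<dots> = 1 + 2 * h * v k + h\<^sup>2"
        unfolding sum.distrib sum_distrib_left[symmetric] d v1 by (simp add: e_def)
      finally have n: "(\<Sum>i\<in>I. (v i + h * e i)\<^sup>2) = 1 + 2 * h * v k + h\<^sup>2" .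
      have "Q (\<lambda>i. v i + h * e i) = (\<Sum>j\<in>I. \<Sum>l\<in>I. A j l * v j * v l + h * (A j l * v j * e l)
          + h * (A j l * v l) * e j + h\<^sup>2 * ((A j l * e l) * e j))"
        unfolding Q_def by (intro sum.cong refl) (simp add: power2_eq_square algebra_simps)
      also have "\<dots> = Q v + h * (\<Sum>j\<in>I. A j k * v j) + h * (\<Sum>l\<in>I. A k l * v l) + h\<^sup>2 * A k k"
        unfolding sum.distrib sum_distrib_left[symmetric] sum_distrib_right[symmetric] d Q_def by simp
      also have "(\<Sum>j\<in>I. A j k * v j) = (\<Sum>l\<in>I. A k l * v l)"
        using sym k by (intro sum.cong refl) (auto simp: I_def)
      finally show "0 \<le> 2 * h * ((\<Sum>l\<in>I. A k l * v l) - Q v * v k) + h\<^sup>2 * (A k k - Q v)"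
        using rayleigh[of "\<lambda>i. v i + h * e i"] unfolding n by (simp add: algebra_simps)
    qed
    then show ?thesis by simp
  qed
  let ?P = "Matrix.mat n n (\<lambda>(i, j). A (i + 1) (j + 1))"
  define x where "x = Matrix.vec n (\<lambda>i. v (i + 1))"
  have "x \<noteq> 0\<^sub>v n"
  proof
    assume "x = 0\<^sub>v n"
    then have "v (i + 1) = 0" if "i < n" for i
      using that by (metis x_def index_vec index_zero_vec(1))
    then have "\<forall>i\<in>I. v i = 0"
      unfolding I_def by (metis Suc_eq_plus1 Suc_le_lessD atLeastAtMost_iff One_nat_def Suc_pred)
    with v1 show False by simp
  qed
  moreover have "?P *\<^sub>v x = Q v \<cdot>\<^sub>v x"
  proof (rule eq_vecI)
    fix i assume "i < dim_vec (Q v \<cdot>\<^sub>v x)"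
    then have i: "i < n" by (simp add: x_def)
    then have "vec_index (?P *\<^sub>v x) i = (\<Sum>l\<in>{0..<n}. A (Suc i) (Suc l) * v (Suc l))"
      by (auto simp: scalar_prod_def x_def intro!: sum.cong)
    also have "\<dots> = (\<Sum>l\<in>I. A (Suc i) l * v l)"
      unfolding I_def by (rule sum_lessThan_shift)
    also have "\<dots> = Q v * v (Suc i)"
      using i by (intro eig) (auto simp: I_def)
    finally show "vec_index (?P *\<^sub>v x) i = vec_index (Q v \<cdot>\<^sub>v x) i"
      using i by (simp add: x_def)
  qed (simp add: x_def)
  ultimately have "Q v \<in> spectrum ?P"
    unfolding spectrum_def eigenvalue_def eigenvector_def
    by (intro CollectI exI[of _ x]) (simp add: x_def)
  \<comment> \<open>\<open>Min\<close> is known to lie below every member only for finite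
    sets.\<close>
  moreover have "finite (spectrum ?P)"
    by (rule card_finite_spectrum(1)) auto
  ultimately have "\<kappa> \<le> Q v"
    using \<kappa> Min_le order_trans by blast
  show ?thesis
    unfolding coercive_def
  proof
    fix u :: "nat \<Rightarrow> real"
    have "\<kappa> * (\<Sum>i\<in>I. (u i)\<^sup>2) \<le> Q v * (\<Sum>i\<in>I. (u i)\<^sup>2)"
      using \<open>\<kappa> \<le> Q v\<close> by (intro mult_right_mono sum_nonneg) auto
    also have "\<dots> \<le> Q u"
      by (rule rayleigh)
    finally show "\<kappa> * (\<Sum>k = 1..n. (u k)\<^sup>2) \<le> (\<Sum>j = 1..n. \<Sum>k = 1..n. A j k * u j * u k)"
      by (simp add: I_def Q_def)
  qed
qed (simp add: coercive_def)

section \<open>Limits of covariance blocks\<close>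

text \<open>Positions of a block of length b whose relative location tends to t. Scaling by n - b
  instead of n keeps the block inside the row even for t = 1.\<close>

lemma block_position_tendsto:
  fixes t :: real and b :: nat
  assumes "t \<in> {0..1}"
  defines "p \<equiv> \<lambda>n. nat \<lfloor>t * real (n - b)\<rfloor>"
  shows "b \<le> n \<Longrightarrow> p n + b \<le> n" and "(\<lambda>n. real (p n + a) / real n) \<longlonglongrightarrow> t"
proof -
  have up: "real (p n) \<le> t * real (n - b)" and lo: "t * real (n - b) - 1 \<le> real (p n)" for n
    using assms(1) unfolding p_def by (auto simp: zero_le_floor intro: of_int_floor_le)
  have le: "t * real (n - b) \<le> real (n - b)" for n
    using assms(1) by (simp add: mult_left_le_one_le)
  show "p n + b \<le> n" if "b \<le> n"
    using order_trans[OF up[of n] le[of n]] that by linarith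
  have nb: "real n - real b \<le> real (n - b)" for n
    by linarith
  show "(\<lambda>n. real (p n + a) / real n) \<longlonglongrightarrow> t"
  proof (rule real_tendsto_sandwich)
    show "\<forall>\<^sub>F n in sequentially. t - (real b + 1) / real n \<le> real (p n + a) / real n"
    proof (rule eventually_mono[OF eventually_gt_at_top[of 0]])
      fix n :: nat assume "0 < n"
      have "t * (real n - real b) - 1 \<le> real (p n)"
        using order_trans[OF diff_right_mono[OF mult_left_mono[OF nb]] lo] assms(1) by simp
      moreover have "t * real b \<le> real b"
        using assms(1) by (simp add: mult_left_le_one_le)
      ultimately have "t * real n - (real b + 1) \<le> real (p n + a)"
        by (simp add: right_diff_distrib)
      then have "(t * real n - (real b + 1)) / real n \<le> real (p n + a) / real n"
        by (rule divide_right_mono) simp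
      then show "t - (real b + 1) / real n \<le> real (p n + a) / real n"
        using \<open>0 < n\<close> by (simp add: diff_divide_distrib)
    qed
    show "\<forall>\<^sub>F n in sequentially. real (p n + a) / real n \<le> t + real a / real n"
    proof (rule eventually_mono[OF eventually_gt_at_top[of 0]])
      fix n :: nat assume "0 < n"
      have "t * real (n - b) \<le> t * real n"
        using assms(1) by (intro mult_left_mono) auto
      then have "real (p n + a) \<le> t * real n + real a"
        using up[of n] by simp
      then have "real (p n + a) / real n \<le> (t * real n + real a) / real n"
        by (rule divide_right_mono) simp
      then show "real (p n + a) / real n \<le> t + real a / real n"
        using \<open>0 < n\<close> by (simp add: add_divide_distrib)
    qed
    have "(\<lambda>n. t - (real b + 1) / real n) \<longlonglongrightarrow> t - 0"
      by (intro tendsto_intros lim_const_over_n)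
    then show "(\<lambda>n. t - (real b + 1) / real n) \<longlonglongrightarrow> t" by simp
    have "(\<lambda>n. t + real a / real n) \<longlonglongrightarrow> t + 0"
      by (intro tendsto_intros lim_const_over_n)
    then show "(\<lambda>n. t + real a / real n) \<longlonglongrightarrow> t" by simp
  qed
qed

lemma locally_stationaryD:
  assumes "locally_stationary M x \<gamma>"
  shows "\<exists>C\<ge>0. \<exists>L\<ge>0. (\<forall>n. \<forall>i\<in>{1..n}. \<forall>j\<in>{1..n}.
      \<bar>covariance (M n) (x n i) (x n j) - \<gamma> (real i / real n) (lag i j)\<bar> \<le> C * ((real (lag i j) + 1) / real n)) \<and>
      (\<forall>k. L-lipschitz_on {0..1} (\<lambda>t. \<gamma> t k))"
proof -
  obtain C L where C: "\<forall>n. \<forall>i\<in>{1..n}. \<forall>j\<in>{1..n}.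
        \<bar>covariance (M n) (x n i) (x n j) - \<gamma> (real i / real n) (lag i j)\<bar>
          \<le> C * ((real (lag i j) + 1) / real n)"
    and L: "\<forall>k. L-lipschitz_on {0..1} (\<lambda>t. \<gamma> t k)"
    using assms unfolding locally_stationary_def by blast
  have "\<bar>covariance (M n) (x n i) (x n j) - \<gamma> (real i / real n) (lag i j)\<bar>
          \<le> \<bar>C\<bar> * ((real (lag i j) + 1) / real n)" if "i \<in> {1..n}" "j \<in> {1..n}" for n i j :: nat
  proof -
    have "\<bar>covariance (M n) (x n i) (x n j) - \<gamma> (real i / real n) (lag i j)\<bar>
          \<le> C * ((real (lag i j) + 1) / real n)"
      using C that by blast
    also have "\<dots> \<le> \<bar>C\<bar> * ((real (lag i j) + 1) / real n)"
      by (intro mult_right_mono) auto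
    finally show ?thesis .
  qed
  moreover have "0 \<le> L"
    using L lipschitz_on_nonneg by blast
  ultimately show ?thesis
    using L by (intro exI[of _ "\<bar>C\<bar>"] exI[of _ L] conjI) auto
qed

text \<open>Every finite autocovariance block at time t is a limit of genuine covariance blocks.
  Closed conditions, such as decay bounds and coercivity, therefore pass from the array to
  \<open>\<gamma> t\<close>.\<close>

lemma covariance_block_tendsto:
  assumes ls: "locally_stationary M x \<gamma>" and t: "t \<in> {0..1}"
  shows "\<exists>p. (\<forall>n\<ge>b. p n + b \<le> n) \<and> (\<forall>a\<in>{1..b}. \<forall>a'\<in>{1..b}.
    (\<lambda>n. covariance (M n) (x n (p n + a)) (x n (p n + a'))) \<longlonglongrightarrow> \<gamma> t (lag a a'))"
proof -
  define p where "p = (\<lambda>n. nat \<lfloor>t * real (n - b)\<rfloor>)"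
  have p: "\<And>n. b \<le> n \<Longrightarrow> p n + b \<le> n" "\<And>a. (\<lambda>n. real (p n + a) / real n) \<longlonglongrightarrow> t"
    unfolding p_def using block_position_tendsto[OF t] by blast+
  obtain C L where C: "0 \<le> C"
    "\<forall>n. \<forall>i\<in>{1..n}. \<forall>j\<in>{1..n}.
      \<bar>covariance (M n) (x n i) (x n j) - \<gamma> (real i / real n) (lag i j)\<bar> \<le> C * ((real (lag i j) + 1) / real n)"
    and L: "0 \<le> L" "\<forall>k. L-lipschitz_on {0..1} (\<lambda>t. \<gamma> t k)"
    using locally_stationaryD[OF ls] by (elim exE conjE) (rule that)
  have "(\<lambda>n. covariance (M n) (x n (p n + a)) (x n (p n + a'))) \<longlonglongrightarrow> \<gamma> t (lag a a')"
    if a: "a \<in> {1..b}" "a' \<in> {1..b}" for a a'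
  proof -
    have ev: "\<forall>\<^sub>F n in sequentially. real (p n + a) / real n \<in> {0..1}"
    proof (rule eventually_mono[OF eventually_ge_at_top[of b]])
      fix n assume "b \<le> n"
      from p(1)[OF this] a have "p n + a \<le> n" "0 < n" by auto
      then show "real (p n + a) / real n \<in> {0..1}"
        by (simp add: divide_le_eq del: of_nat_add)
    qed
    have 1: "(\<lambda>n. \<gamma> (real (p n + a) / real n) (lag a a')) \<longlonglongrightarrow> \<gamma> t (lag a a')"
      using continuous_on_tendsto_compose[OF lipschitz_on_continuous_on[OF L(2)[rule_format]] p(2) t ev] .
    have 2: "(\<lambda>n. covariance (M n) (x n (p n + a)) (x n (p n + a')) - \<gamma> (real (p n + a) / real n) (lag a a')) \<longlonglongrightarrow> 0"
    proof (rule Lim_null_comparison)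
      show "(\<lambda>n. C * (real (lag a a') + 1) / real n) \<longlonglongrightarrow> 0"
        by (rule lim_const_over_n)
      show "\<forall>\<^sub>F n in sequentially. norm (covariance (M n) (x n (p n + a)) (x n (p n + a'))
          - \<gamma> (real (p n + a) / real n) (lag a a')) \<le> C * (real (lag a a') + 1) / real n"
      proof (rule eventually_mono[OF eventually_ge_at_top[of b]])
        fix n assume "b \<le> n"
        from p(1)[OF this] a have "p n + a \<in> {1..n}" "p n + a' \<in> {1..n}"
          by auto
        from C(2)[rule_format, OF this] show "norm (covariance (M n) (x n (p n + a)) (x n (p n + a'))
          - \<gamma> (real (p n + a) / real n) (lag a a')) \<le> C * (real (lag a a') + 1) / real n"
          by simp
      qed
    qed
    from tendsto_add[OF 2 1] show ?thesis by simp
  qed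
  with p(1) show ?thesis by blast
qed

text \<open>Short-range dependence covers only nonzero lags; there the shift from m to 1 + m costs
  the factor 2 powr \<tau>. Variances are bounded through \<gamma>: the Lipschitz condition compares
  their approximation with \<open>\<gamma> 0 0\<close>.\<close>

lemma covariance_decay:
  assumes ls: "locally_stationary M x \<gamma>" and srd: "short_range_dependent M x \<tau>" and \<tau>: "1 < \<tau>"
  shows "\<exists>K\<ge>0. \<forall>n. \<forall>i\<in>{1..n}. \<forall>j\<in>{1..n}. \<bar>covariance (M n) (x n i) (x n j)\<bar> \<le> K * decay \<tau> (lag i j)"
proof -
  obtain C L where C: "0 \<le> C"
    "\<forall>n. \<forall>i\<in>{1..n}. \<forall>j\<in>{1..n}.
      \<bar>covariance (M n) (x n i) (x n j) - \<gamma> (real i / real n) (lag i j)\<bar> \<le> C * ((real (lag i j) + 1) / real n)"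
    and L: "0 \<le> L" "\<forall>k. L-lipschitz_on {0..1} (\<lambda>t. \<gamma> t k)"
    using locally_stationaryD[OF ls] by (elim exE conjE) (rule that)
  obtain C' where C': "0 < C'"
    "\<forall>n. \<forall>k\<in>{1..n}. \<forall>r\<in>{- int k + 1..int n - int k} - {0}.
      \<bar>covariance (M n) (x n k) (x n (nat (int k + r)))\<bar> \<le> C' * \<bar>of_int r\<bar> powr (- \<tau>)"
    using srd unfolding short_range_dependent_def by (elim conjE exE) (rule that)
  define K where "K = 2 powr \<tau> * C' + (C + \<bar>\<gamma> 0 0\<bar> + L)"
  have "\<bar>covariance (M n) (x n i) (x n j)\<bar> \<le> K * decay \<tau> (lag i j)"
    if ij: "i \<in> {1..n}" "j \<in> {1..n}" for n i j
  proof (cases "i = j")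
    case True
    have n: "1 \<le> real n" "real i / real n \<in> {0..1}"
      using ij by auto
    have "\<bar>\<gamma> (real i / real n) 0 - \<gamma> 0 0\<bar> \<le> L * \<bar>real i / real n - 0\<bar>"
      using lipschitz_onD[OF L(2)[rule_format, of 0] n(2), of 0] by (simp add: dist_real_def)
    also have "\<dots> \<le> L * 1"
      using n L(1) by (intro mult_left_mono) auto
    finally have "\<bar>\<gamma> (real i / real n) 0\<bar> \<le> \<bar>\<gamma> 0 0\<bar> + L"
      by linarith
    moreover have "\<bar>covariance (M n) (x n i) (x n i) - \<gamma> (real i / real n) 0\<bar> \<le> C * (1 / real n)"
      using C(2)[rule_format, OF ij(1) ij(1)] by simp
    moreover have "C * (1 / real n) \<le> C * 1"
      using n C(1) by (intro mult_left_mono) auto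
    moreover have "0 \<le> 2 powr \<tau> * C'"
      using C' by simp
    ultimately have "\<bar>covariance (M n) (x n i) (x n i)\<bar> \<le> K"
      unfolding K_def by linarith
    with True show ?thesis by simp
  next
    case False
    define m where "m = lag i j"
    have m: "1 \<le> m" using False by (simp add: m_def)
    have "\<bar>covariance (M n) (x n i) (x n (nat (int i + (int j - int i))))\<bar>
        \<le> C' * \<bar>of_int (int j - int i)\<bar> powr (- \<tau>)"
      using ij False by (intro C'(2)[rule_format]) auto
    also have "\<bar>of_int (int j - int i)\<bar> = real m"
      by (simp add: m_def)
    also have "real m powr (- \<tau>) \<le> 2 powr \<tau> * decay \<tau> m"
    proof -
      have "(1 + real m) powr \<tau> \<le> (2 * real m) powr \<tau>"
        using m \<tau> by (intro powr_mono2) auto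
      also have "\<dots> = 2 powr \<tau> * real m powr \<tau>"
        by (rule powr_mult)
      finally show ?thesis
        using m unfolding decay_def powr_minus by (simp add: field_simps add_pos_nonneg)
    qed
    finally have "\<bar>covariance (M n) (x n i) (x n j)\<bar> \<le> (2 powr \<tau> * C') * decay \<tau> m"
      using C'(1) by (simp add: mult_ac)
    also have "\<dots> \<le> K * decay \<tau> m"
      using C L by (intro mult_right_mono) (auto simp: K_def)
    finally show ?thesis by (simp add: m_def)
  qed
  moreover have "0 \<le> K"
    using C C' L by (simp add: K_def)
  ultimately show ?thesis by blast
qed

lemma autocovariance_decay:
  assumes ls: "locally_stationary M x \<gamma>" and t: "t \<in> {0..1}"
    and K: "\<And>n i j. i \<in> {1..n} \<Longrightarrow> j \<in> {1..n} \<Longrightarrow> \<bar>covariance (M n) (x n i) (x n j)\<bar> \<le> K * decay \<tau> (lag i j)"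
  shows "\<bar>\<gamma> t k\<bar> \<le> K * decay \<tau> k"
proof -
  obtain p where p: "\<forall>n\<ge>Suc k. p n + Suc k \<le> n" and lim: "\<forall>a\<in>{1..Suc k}. \<forall>a'\<in>{1..Suc k}.
    (\<lambda>n. covariance (M n) (x n (p n + a)) (x n (p n + a'))) \<longlonglongrightarrow> \<gamma> t (lag a a')"
    using covariance_block_tendsto[OF ls t, of "Suc k"] by blast
  have lag: "lag 1 (Suc k) = k" by simp
  have "(\<lambda>n. \<bar>covariance (M n) (x n (p n + 1)) (x n (p n + Suc k))\<bar>) \<longlonglongrightarrow> \<bar>\<gamma> t (lag 1 (Suc k))\<bar>"
    by (intro tendsto_rabs lim[THEN bspec, THEN bspec]) auto
  then have 1: "(\<lambda>n. \<bar>covariance (M n) (x n (p n + 1)) (x n (p n + Suc k))\<bar>) \<longlonglongrightarrow> \<bar>\<gamma> t k\<bar>"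
    unfolding lag .
  have 2: "\<forall>\<^sub>F n in sequentially. \<bar>covariance (M n) (x n (p n + 1)) (x n (p n + Suc k))\<bar> \<le> K * decay \<tau> k"
  proof (rule eventually_mono[OF eventually_ge_at_top[of "Suc k"]])
    fix n assume "Suc k \<le> n"
    with p have "p n + Suc k \<le> n" by blast
    then have "p n + 1 \<in> {1..n}" "p n + Suc k \<in> {1..n}" by auto
    from K[OF this] lag show "\<bar>covariance (M n) (x n (p n + 1)) (x n (p n + Suc k))\<bar> \<le> K * decay \<tau> k"
      by simp
  qed
  show ?thesis
    by (rule tendsto_upperbound[OF 1 2 trivial_limit_sequentially])
qed

lemma UPDC_coercive:
  assumes "UPDC M x"
  obtains \<kappa> where "0 < \<kappa>"
    "\<forall>\<^sub>F n in sequentially. coercive \<kappa> {1..n} (\<lambda>i j. covariance (M n) (x n i) (x n j))"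
proof -
  obtain \<kappa> where "0 < \<kappa>" and ev: "\<forall>\<^sub>F n in sequentially. \<kappa> \<le> Min (spectrum (covariance_matrix (M n) (x n) n))"
    using assms unfolding UPDC_def by blast
  from ev have "\<forall>\<^sub>F n in sequentially. coercive \<kappa> {1..n} (\<lambda>i j. covariance (M n) (x n i) (x n j))"
    by (rule eventually_mono)
      (rule coercive_Min_spectrum, simp_all add: covariance_commute covariance_matrix_def)
  with \<open>0 < \<kappa>\<close> show ?thesis by (rule that)
qed

text \<open>Blocks of the covariance matrix inherit its lower bound, and the bound survives the
  limit in n. The constant is the same for all t and b.\<close>

lemma autocovariance_coercive:
  assumes ls: "locally_stationary M x \<gamma>" and t: "t \<in> {0..1}"
    and co: "\<forall>\<^sub>F n in sequentially. coercive \<kappa> {1..n} (\<lambda>i j. covariance (M n) (x n i) (x n j))"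
  shows "coercive \<kappa> {1..b} (\<lambda>j k. \<gamma> t (lag j k))"
  unfolding coercive_def
proof
  fix u :: "nat \<Rightarrow> real"
  obtain p where p: "\<forall>n\<ge>b. p n + b \<le> n" and lim: "\<forall>a\<in>{1..b}. \<forall>a'\<in>{1..b}.
    (\<lambda>n. covariance (M n) (x n (p n + a)) (x n (p n + a'))) \<longlonglongrightarrow> \<gamma> t (lag a a')"
    using covariance_block_tendsto[OF ls t, of b] by blast
  show "\<kappa> * (\<Sum>k=1..b. (u k)\<^sup>2) \<le> (\<Sum>j=1..b. \<Sum>k=1..b. \<gamma> t (lag j k) * u j * u k)"
  proof (rule tendsto_lowerbound)
    show "(\<lambda>n. \<Sum>j=1..b. \<Sum>k=1..b. covariance (M n) (x n (p n + j)) (x n (p n + k)) * u j * u k)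
      \<longlonglongrightarrow> (\<Sum>j=1..b. \<Sum>k=1..b. \<gamma> t (lag j k) * u j * u k)"
      using lim by (intro tendsto_sum tendsto_mult_right) blast
    show "\<forall>\<^sub>F n in sequentially. \<kappa> * (\<Sum>k=1..b. (u k)\<^sup>2)
      \<le> (\<Sum>j=1..b. \<Sum>k=1..b. covariance (M n) (x n (p n + j)) (x n (p n + k)) * u j * u k)"
      using co eventually_ge_at_top[of b]
    proof eventually_elim
      case (elim n)
      have "coercive \<kappa> {1..b} (\<lambda>j k. covariance (M n) (x n (p n + j)) (x n (p n + k)))"
      proof (rule coercive_reindex[OF elim(1), of "\<lambda>j. p n + j"])
        have "p n + b \<le> n"
          using p elim(2) by blast
        then show "(\<lambda>j. p n + j) ` {1..b} \<subseteq> {1..n}" by auto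
      qed auto
      then show ?case by (rule coerciveD)
    qed
  qed simp
qed

section \<open>Stability and residuals of the predictors\<close>

lemma sum_reverse_predecessors:
  fixes i :: nat and h :: "nat \<Rightarrow> real"
  shows "(\<Sum>l=1..i - 1. h l) = (\<Sum>j=1..i - 1. h (i - j))"
  by (rule sum.reindex_bij_witness[of _ "\<lambda>j. i - j" "\<lambda>l. i - l"]) auto

text \<open>The prediction equations say that the unit lower triangular matrix \<open>L\<close> with rows
  \<open>(- f i (i - l))\<close> makes \<open>L S L\<^sup>T\<close> diagonal, so \<open>L\<close> is inverted by \<open>S L\<^sup>T\<close> up to scaling.\<close>

lemma predictor_recursion_stable:
  fixes \<tau> \<kappa> K P :: real
  assumes \<tau>: "1 < \<tau>" and \<kappa>: "0 < \<kappa>" and K: "0 \<le> K" and P: "0 \<le> P"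
  shows "\<exists>M\<ge>0. \<forall>n S f. coercive_decaying \<tau> \<kappa> K n S \<longrightarrow>
    (\<forall>i\<in>{1..n}. \<forall>j\<in>{1..i - 1}. \<bar>f i j\<bar> \<le> P * decay \<tau> j) \<longrightarrow>
    (\<forall>i\<in>{1..n}. \<forall>k\<in>{1..i - 1}. (\<Sum>j=1..i - 1. S (i - k) (i - j) * f i j) = S (i - k) i) \<longrightarrow>
    (\<exists>H. (\<forall>i\<in>{1..n}. (\<Sum>k=1..n. \<bar>H i k\<bar>) \<le> M) \<and>
      (\<forall>e. \<forall>i\<in>{1..n}. e i = (\<Sum>k=1..n. H i k * (e k - (\<Sum>j=1..k - 1. f k j * e (k - j))))))"
proof -
  define Z where "Z = suminf (decay \<tau>)"
  have Z: "1 \<le> Z" using suminf_decay_ge_1[OF \<tau>] by (simp add: Z_def)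
  \<comment> \<open>The entries of S and L contribute K and P + 1, the two summations over lags
    contribute 2 Z each, and the division by the diagonal of \<open>T\<close> contributes 1 /
    \<kappa>.\<close>
  define M where "M = K * (P + 1) * (2 * Z) * (2 * Z) / \<kappa>"
  show ?thesis
  proof (intro exI[of _ M] conjI allI impI)
    show "0 \<le> M"
      using K P Z \<kappa> by (simp add: M_def)
    fix n :: nat and S :: "nat \<Rightarrow> nat \<Rightarrow> real" and f :: "nat \<Rightarrow> nat \<Rightarrow> real"
    let ?I = "{1..n}"
    assume cd: "coercive_decaying \<tau> \<kappa> K n S"
      and f: "\<forall>i\<in>?I. \<forall>j\<in>{1..i - 1}. \<bar>f i j\<bar> \<le> P * decay \<tau> j"
      and normal: "\<forall>i\<in>?I. \<forall>k\<in>{1..i - 1}. (\<Sum>j=1..i - 1. S (i - k) (i - j) * f i j) = S (i - k) i"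
    from cd have co: "coercive \<kappa> ?I S"
      and S: "\<And>j k. j \<in> ?I \<Longrightarrow> k \<in> ?I \<Longrightarrow> \<bar>S j k\<bar> \<le> K * decay \<tau> (lag j k)"
      and sym: "\<And>j k. j \<in> ?I \<Longrightarrow> k \<in> ?I \<Longrightarrow> S j k = S k j"
      unfolding coercive_decaying_def by blast+
    define L where "L = (\<lambda>i l. if l = i then 1 else if l < i then - f i (i - l) else 0)"
    have L_sum: "(\<Sum>l\<in>?I. L i l * g l) = g i - (\<Sum>j=1..i - 1. f i j * g (i - j))"
      if i: "i \<in> ?I" for i g
    proof -
      have "(\<Sum>l\<in>?I. L i l * g l) = (\<Sum>l=1..i. L i l * g l)"
        using i by (intro sum.mono_neutral_right) (auto simp: L_def)
      also have "{1..i} = insert i {1..i - 1}"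
        using i by auto
      also have "(\<Sum>l\<in>insert i {1..i - 1}. L i l * g l) = g i + (\<Sum>l=1..i - 1. L i l * g l)"
        using i by (subst sum.insert) (auto simp: L_def)
      also have "(\<Sum>l=1..i - 1. L i l * g l) = (\<Sum>j=1..i - 1. L i (i - j) * g (i - j))"
        by (rule sum_reverse_predecessors)
      also have "\<dots> = (\<Sum>j=1..i - 1. - (f i j * g (i - j)))"
        by (intro sum.cong refl) (auto simp: L_def)
      finally show ?thesis
        by (simp add: sum_negf)
    qed
    \<comment> \<open>\<open>G\<close> is S L^T. If S is a covariance matrix, its entry at (i, k) is
      the covariance of value i with innovation k, so the normal equations make it vanish for i <
      k.\<close>
    define G where "G = (\<lambda>i k. \<Sum>l\<in>?I. L k l * S i l)"
    have G0: "G i k = 0" if "i \<in> ?I" "k \<in> ?I" "i < k" for i k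
    proof -
      have "G i k = S i k - (\<Sum>j=1..k - 1. f k j * S i (k - j))"
        unfolding G_def by (rule L_sum[OF that(2)])
      also have "\<dots> = 0"
      proof -
        have "k - i \<in> {1..k - 1}" "k - (k - i) = i"
          using that by auto
        with normal[rule_format, OF that(2), of "k - i"] show ?thesis
          by (simp add: mult.commute)
      qed
      finally show ?thesis .
    qed
    \<comment> \<open>\<open>T\<close> is L S L^T. It vanishes above the diagonal because L is lower
      triangular and so is \<open>G\<close>; being symmetric, it is diagonal.\<close>
    define T where "T = (\<lambda>i k. \<Sum>j\<in>?I. L i j * G j k)"
    have T_sym: "T i k = T k i" for i k
    proof -
      have "T i k = (\<Sum>j\<in>?I. \<Sum>l\<in>?I. L i j * (L k l * S j l))"
        by (simp only: T_def G_def sum_distrib_left)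
      also have "\<dots> = (\<Sum>l\<in>?I. \<Sum>j\<in>?I. L i j * (L k l * S j l))"
        by (rule sum.swap)
      also have "\<dots> = (\<Sum>l\<in>?I. \<Sum>j\<in>?I. L k l * (L i j * S l j))"
        using sym by (intro sum.cong refl) (simp add: mult_ac)
      also have "\<dots> = T k i"
        by (simp only: T_def G_def sum_distrib_left)
      finally show ?thesis .
    qed
    have T_less: "T i k = 0" if "i \<in> ?I" "k \<in> ?I" "i < k" for i k
      unfolding T_def using that by (intro sum.neutral) (auto simp: L_def G0)
    have T_off: "T i k = 0" if "i \<in> ?I" "k \<in> ?I" "i \<noteq> k" for i k
      using T_less[of i k] T_less[of k i] T_sym[of i k] that by (cases "i < k") auto
    \<comment> \<open>Row k of L contains the entry 1, so its square norm is at least 1 and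
      coercivity bounds the innovation variance from below.\<close>
    have T_diag: "\<kappa> \<le> T k k" if k: "k \<in> ?I" for k
    proof -
      have "1 \<le> (\<Sum>l\<in>?I. (L k l)\<^sup>2)"
        using member_le_sum[of k ?I "\<lambda>l. (L k l)\<^sup>2"] k by (simp add: L_def)
      then have "\<kappa> * 1 \<le> \<kappa> * (\<Sum>l\<in>?I. (L k l)\<^sup>2)"
        using \<kappa> by (intro mult_left_mono) auto
      also have "\<dots> \<le> (\<Sum>j\<in>?I. \<Sum>l\<in>?I. S j l * L k j * L k l)"
        by (rule coerciveD[OF co])
      also have "\<dots> = T k k"
        by (simp add: T_def G_def sum_distrib_left mult_ac)
      finally show ?thesis by simp
    qed
    define H where "H = (\<lambda>i k. G i k / T k k)"
    have LH: "(\<Sum>j\<in>?I. L i j * H j k) = (if i = k then 1 else 0)" if "i \<in> ?I" "k \<in> ?I" for i k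
    proof -
      have "(\<Sum>j\<in>?I. L i j * H j k) = T i k / T k k"
        by (simp add: H_def T_def sum_divide_distrib)
      then show ?thesis
        using T_off[OF that] T_diag[OF that(2)] \<kappa> by auto
    qed
    have L_bound: "\<bar>L k l\<bar> \<le> (P + 1) * decay \<tau> (lag l k)" if "k \<in> ?I" "l \<in> ?I" for k l
    proof -
      consider "l = k" | "l < k" | "k < l" by linarith
      then show ?thesis
      proof cases
        case 2
        then have "k - l \<in> {1..k - 1}"
          using that by auto
        from f[rule_format, OF that(1) this] have "\<bar>f k (k - l)\<bar> \<le> P * decay \<tau> (k - l)" .
        also have "\<dots> \<le> (P + 1) * decay \<tau> (k - l)"
          by (intro mult_right_mono) auto
        finally have "\<bar>f k (k - l)\<bar> \<le> (P + 1) * decay \<tau> (k - l)" .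
        moreover have "lag l k = k - l"
          using 2 by auto
        ultimately show ?thesis
          using 2 by (simp only: L_def) simp
      qed (use P in \<open>auto simp: L_def\<close>)
    qed
    show "\<exists>H. (\<forall>i\<in>?I. (\<Sum>k\<in>?I. \<bar>H i k\<bar>) \<le> M) \<and>
      (\<forall>e. \<forall>i\<in>?I. e i = (\<Sum>k\<in>?I. H i k * (e k - (\<Sum>j=1..k - 1. f k j * e (k - j)))))"
    proof (intro exI[of _ H] conjI ballI allI)
      fix i assume i: "i \<in> ?I"
      have "(\<Sum>k\<in>?I. \<bar>H i k\<bar>) \<le> (\<Sum>k\<in>?I. \<Sum>l\<in>?I. K * decay \<tau> (lag i l) * ((P + 1) * decay \<tau> (lag l k)) / \<kappa>)"
      proof (rule sum_mono)
        fix k assume k: "k \<in> ?I"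
        have "\<bar>G i k\<bar> \<le> (\<Sum>l\<in>?I. \<bar>L k l * S i l\<bar>)"
          unfolding G_def by (rule sum_abs)
        also have "\<dots> \<le> (\<Sum>l\<in>?I. (K * decay \<tau> (lag i l)) * ((P + 1) * decay \<tau> (lag l k)))"
        proof (rule sum_mono)
          fix l assume l: "l \<in> ?I"
          have "\<bar>S i l\<bar> * \<bar>L k l\<bar> \<le> (K * decay \<tau> (lag i l)) * ((P + 1) * decay \<tau> (lag l k))"
            using S[OF i l] L_bound[OF k l] K by (intro mult_mono) auto
          then show "\<bar>L k l * S i l\<bar> \<le> (K * decay \<tau> (lag i l)) * ((P + 1) * decay \<tau> (lag l k))"
            by (simp only: abs_mult mult.commute)
        qed
        finally have "\<bar>G i k\<bar> / T k k \<le> (\<Sum>l\<in>?I. (K * decay \<tau> (lag i l)) * ((P + 1) * decay \<tau> (lag l k))) / \<kappa>"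
          using T_diag[OF k] \<kappa> by (intro frac_le) (auto intro!: sum_nonneg mult_nonneg_nonneg simp: K P)
        moreover have "\<bar>H i k\<bar> = \<bar>G i k\<bar> / T k k"
          using T_diag[OF k] \<kappa> by (simp add: H_def)
        ultimately show "\<bar>H i k\<bar> \<le> (\<Sum>l\<in>?I. K * decay \<tau> (lag i l) * ((P + 1) * decay \<tau> (lag l k)) / \<kappa>)"
          by (simp add: sum_divide_distrib)
      qed
      also have "\<dots> = (\<Sum>l\<in>?I. K * (P + 1) / \<kappa> * decay \<tau> (lag i l) * (\<Sum>k\<in>?I. decay \<tau> (lag l k)))"
        by (subst sum.swap) (simp add: sum_distrib_left sum_divide_distrib mult_ac)
      also have "\<dots> \<le> (\<Sum>l\<in>?I. K * (P + 1) / \<kappa> * decay \<tau> (lag i l) * (2 * Z))"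
        unfolding Z_def using K P \<kappa> summable_decay[OF \<tau>]
        by (intro sum_mono mult_left_mono sum_lag_le) auto
      also have "\<dots> = K * (P + 1) / \<kappa> * (2 * Z) * (\<Sum>l\<in>?I. decay \<tau> (lag i l))"
        unfolding sum_distrib_left by (intro sum.cong refl) (simp add: mult_ac)
      also have "\<dots> \<le> K * (P + 1) / \<kappa> * (2 * Z) * (2 * Z)"
        unfolding Z_def using K P \<kappa> Z summable_decay[OF \<tau>]
        by (intro mult_left_mono sum_lag_le) (auto simp: Z_def)
      finally show "(\<Sum>k\<in>?I. \<bar>H i k\<bar>) \<le> M"
        by (simp add: M_def)
    next
      fix e :: "nat \<Rightarrow> real" and i
      assume i: "i \<in> ?I"
      define g where "g = (\<lambda>k. e k - (\<Sum>j=1..k - 1. f k j * e (k - j)))"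
      \<comment> \<open>\<open>LH\<close> makes \<open>H\<close> only a right inverse. That it also
        recovers \<open>e\<close> from L e follows since the defect \<open>d\<close> is annihilated
        by the unit triangular L and hence vanishes by induction.\<close>
      define d where "d = (\<lambda>i. e i - (\<Sum>k\<in>?I. H i k * g k))"
      have Ld: "(\<Sum>l\<in>?I. L i l * d l) = 0" if i: "i \<in> ?I" for i
      proof -
        have "(\<Sum>l\<in>?I. L i l * d l) = (\<Sum>l\<in>?I. L i l * e l) - (\<Sum>l\<in>?I. \<Sum>k\<in>?I. L i l * H l k * g k)"
          by (simp add: d_def right_diff_distrib sum_subtractf sum_distrib_left mult.assoc)
        also have "(\<Sum>l\<in>?I. \<Sum>k\<in>?I. L i l * H l k * g k) = (\<Sum>k\<in>?I. (\<Sum>l\<in>?I. L i l * H l k) * g k)"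
          by (subst sum.swap) (simp add: sum_distrib_right)
        also have "\<dots> = (\<Sum>k\<in>?I. if i = k then g k else 0)"
        proof (intro sum.cong refl)
          fix k assume "k \<in> ?I"
          from LH[OF i this] show "(\<Sum>l\<in>?I. L i l * H l k) * g k = (if i = k then g k else 0)"
            by (simp split: if_splits)
        qed
        also have "\<dots> = g i"
          using i by simp
        also have "(\<Sum>l\<in>?I. L i l * e l) = g i"
          unfolding g_def by (rule L_sum[OF i])
        finally show ?thesis by simp
      qed
      have "i \<in> ?I \<longrightarrow> d i = 0" for i
      proof (induction i rule: less_induct)
        case (less i)
        show ?case
        proof
          assume i: "i \<in> ?I"
          have "d i = (\<Sum>j=1..i - 1. f i j * d (i - j))"
            using Ld[OF i] L_sum[OF i, of d] by simp
          also have "\<dots> = 0"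
            using less.IH i by (intro sum.neutral) auto
          finally show "d i = 0" .
        qed
      qed
      then have "d i = 0"
        using i by blast
      then show "e i = (\<Sum>k\<in>?I. H i k * (e k - (\<Sum>j=1..k - 1. f k j * e (k - j))))"
        by (simp add: d_def g_def)
    qed
  qed
qed

text \<open>The residual left when the true normal equations (matrix \<open>T\<close>, indexed by the distance to
  the predicted time) are tested with the solution of the stationary order-\<open>b\<close> equations.
  Lags up to \<open>N\<close> use the stationary approximation for coefficients up to \<open>J\<close>.\<close>

lemma truncated_residual_sum_le:
  fixes \<tau> K P \<nu> :: real
  assumes \<tau>: "1 < \<tau>" and K: "0 \<le> K" and P: "0 \<le> P" and \<nu>: "0 < \<nu>" and b: "b \<le> m" "N \<le> b"
    and T: "\<And>k j. k \<le> m \<Longrightarrow> j \<le> m \<Longrightarrow> \<bar>T k j\<bar> \<le> K * decay \<tau> (lag k j)"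
    and g: "\<And>k. \<bar>g k\<bar> \<le> K * decay \<tau> k"
    and Tg: "\<And>k j. k \<le> m \<Longrightarrow> j \<le> m \<Longrightarrow> \<bar>T k j - g (lag k j)\<bar> \<le> K * ((real k + real j + 1) / \<nu>)"
    and normal: "\<And>k. k \<in> {1..b} \<Longrightarrow> (\<Sum>j=1..b. g (lag k j) * c j) = g k"
    and c: "\<And>j. j \<in> {1..b} \<Longrightarrow> \<bar>c j\<bar> \<le> P * decay \<tau> j"
  shows "(\<Sum>k=1..m. \<bar>T k 0 - (\<Sum>j=1..b. T k j * c j)\<bar>)
    \<le> real N * (K * ((real N + real J + 1) / \<nu>) * (1 + P * suminf (decay \<tau>))
        + 2 * K * P * (\<Sum>j\<in>{J<..b}. decay \<tau> j))
      + K * (1 + P * (4 * 2 powr \<tau> * suminf (decay \<tau>))) * suminf (decay_from \<tau> N)"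
proof -
  define Z where "Z = suminf (decay \<tau>)"
  define B where "B = K * ((real N + real J + 1) / \<nu>) * (1 + P * Z) + 2 * K * P * (\<Sum>j\<in>{J<..b}. decay \<tau> j)"
  define Q where "Q = K * (1 + P * (4 * 2 powr \<tau> * Z))"
  have Z: "1 \<le> Z" using suminf_decay_ge_1[OF \<tau>] by (simp add: Z_def)
  have B0: "0 \<le> B" using K P Z \<nu> by (auto simp: B_def intro!: add_nonneg_nonneg mult_nonneg_nonneg sum_nonneg)
  define r where "r = (\<lambda>k. T k 0 - (\<Sum>j=1..b. T k j * c j))"
  \<comment> \<open>Subtracting the stationary equation for row k leaves only differences T - g. For
    j \<le> J they are small by local stationarity. For larger j, where that error would grow with
    j, the crude bound 2 K is used and the decay of \<open>c\<close> supplies the smallness.\<close>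
  have near: "\<bar>r k\<bar> \<le> B" if k: "k \<in> {1..N}" for k
  proof -
    let ?\<delta> = "K * ((real N + real J + 1) / \<nu>)"
    have \<delta>: "0 \<le> ?\<delta>" using K \<nu> by simp
    have kb: "k \<in> {1..b}" "k \<le> m" using k b by auto
    have "r k = (T k 0 - g (lag k 0)) - (\<Sum>j=1..b. (T k j - g (lag k j)) * c j)"
      using normal[OF kb(1)] by (simp add: r_def left_diff_distrib sum_subtractf)
    then have "\<bar>r k\<bar> \<le> \<bar>T k 0 - g (lag k 0)\<bar> + \<bar>\<Sum>j=1..b. (T k j - g (lag k j)) * c j\<bar>"
      by (metis abs_triangle_ineq4)
    also have "\<bar>\<Sum>j=1..b. (T k j - g (lag k j)) * c j\<bar>
        \<le> (\<Sum>j=1..b. ?\<delta> * (P * decay \<tau> j) + (if J < j then 2 * K * P * decay \<tau> j else 0))"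
    proof (rule order_trans[OF sum_abs], rule sum_mono)
      fix j assume j: "j \<in> {1..b}"
      then have jm: "j \<le> m" using b by simp
      have "\<bar>T k j - g (lag k j)\<bar> \<le> ?\<delta> + (if J < j then 2 * K else 0)"
      proof (cases "J < j")
        case True
        have "\<bar>T k j\<bar> \<le> K * decay \<tau> (lag k j)" "\<bar>g (lag k j)\<bar> \<le> K * decay \<tau> (lag k j)"
          using T[OF kb(2) jm] g by auto
        moreover have "K * decay \<tau> (lag k j) \<le> K * 1"
          using K \<tau> by (intro mult_left_mono decay_le_1) auto
        ultimately have "\<bar>T k j - g (lag k j)\<bar> \<le> 2 * K" by linarith
        with True \<delta> show ?thesis by simp
      next
        case False
        have "\<bar>T k j - g (lag k j)\<bar> \<le> K * ((real k + real j + 1) / \<nu>)"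
          by (rule Tg[OF kb(2) jm])
        also have "\<dots> \<le> ?\<delta>"
          using False k K \<nu> by (intro mult_left_mono divide_right_mono) auto
        finally show ?thesis using False by simp
      qed
      then have "\<bar>T k j - g (lag k j)\<bar> * \<bar>c j\<bar> \<le> (?\<delta> + (if J < j then 2 * K else 0)) * (P * decay \<tau> j)"
        using c[OF j] K \<delta> by (intro mult_mono) auto
      also have "\<dots> = ?\<delta> * (P * decay \<tau> j) + (if J < j then 2 * K * P * decay \<tau> j else 0)"
        by (simp add: distrib_right)
      finally show "\<bar>(T k j - g (lag k j)) * c j\<bar>
          \<le> ?\<delta> * (P * decay \<tau> j) + (if J < j then 2 * K * P * decay \<tau> j else 0)"
        by (simp only: abs_mult)
    qed
    also have "\<dots> = ?\<delta> * (P * (\<Sum>j=1..b. decay \<tau> j)) + 2 * K * P * (\<Sum>j\<in>{J<..b}. decay \<tau> j)"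
    proof -
      have "(\<Sum>j=1..b. if J < j then 2 * K * P * decay \<tau> j else 0) = (\<Sum>j\<in>{J<..b}. 2 * K * P * decay \<tau> j)"
        by (rule sum.mono_neutral_cong_right) auto
      then show ?thesis
        by (simp add: sum.distrib sum_distrib_left)
    qed
    also have "\<dots> \<le> ?\<delta> * (P * Z) + 2 * K * P * (\<Sum>j\<in>{J<..b}. decay \<tau> j)"
      unfolding Z_def using \<delta> P by (intro add_right_mono mult_left_mono sum_decay_le \<tau>) auto
    also have "\<bar>T k 0 - g (lag k 0)\<bar> \<le> ?\<delta>"
    proof -
      have "\<bar>T k 0 - g (lag k 0)\<bar> \<le> K * ((real k + real 0 + 1) / \<nu>)"
        using kb by (intro Tg) auto
      also have "\<dots> \<le> ?\<delta>"
        using k K \<nu> by (intro mult_left_mono divide_right_mono) auto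
      finally show ?thesis .
    qed
    finally have "\<bar>r k\<bar> \<le> ?\<delta> + (?\<delta> * (P * Z) + 2 * K * P * (\<Sum>j\<in>{J<..b}. decay \<tau> j))"
      by simp
    then show ?thesis
      unfolding B_def distrib_left[of ?\<delta>] by simp
  qed
  \<comment> \<open>A bound that makes no use of the stationary equations: both terms decay in k
    separately, the sum by the convolution estimate. It is used for k > N.\<close>
  have far: "\<bar>r k\<bar> \<le> Q * decay \<tau> k" if k: "k \<in> {1..m}" for k
  proof -
    have "\<bar>\<Sum>j=1..b. T k j * c j\<bar> \<le> (\<Sum>j=1..b. K * P * (decay \<tau> (lag k j) * decay \<tau> (lag j 0)))"
    proof (rule order_trans[OF sum_abs], rule sum_mono)
      fix j assume j: "j \<in> {1..b}"
      have "\<bar>T k j\<bar> * \<bar>c j\<bar> \<le> (K * decay \<tau> (lag k j)) * (P * decay \<tau> j)"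
        using T[of k j] c[OF j] j k b K by (intro mult_mono) auto
      then show "\<bar>T k j * c j\<bar> \<le> K * P * (decay \<tau> (lag k j) * decay \<tau> (lag j 0))"
        by (simp add: abs_mult mult_ac)
    qed
    also have "\<dots> \<le> K * P * (4 * 2 powr \<tau> * Z * decay \<tau> (lag k 0))"
      unfolding sum_distrib_left[symmetric] Z_def
      using K P by (intro mult_left_mono decay_convolution_le \<tau>) auto
    finally have "\<bar>\<Sum>j=1..b. T k j * c j\<bar> \<le> K * P * (4 * 2 powr \<tau> * Z * decay \<tau> k)"
      by simp
    moreover have "\<bar>T k 0\<bar> \<le> K * decay \<tau> k"
      using T[of k 0] k by simp
    ultimately have "\<bar>r k\<bar> \<le> K * decay \<tau> k + K * P * (4 * 2 powr \<tau> * Z * decay \<tau> k)"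
      unfolding r_def by linarith
    then show ?thesis
      by (simp add: Q_def algebra_simps)
  qed
  have Q0: "0 \<le> Q" using K P Z by (simp add: Q_def)
  have "(\<Sum>k=1..m. \<bar>r k\<bar>) \<le> (\<Sum>k=1..m. (if k \<le> N then B else 0) + Q * decay_from \<tau> N k)"
    using near far by (intro sum_mono) (auto simp: decay_from_def)
  also have "\<dots> = real (card {k\<in>{1..m}. k \<le> N}) * B + Q * (\<Sum>k=1..m. decay_from \<tau> N k)"
    by (simp add: sum.distrib sum_distrib_left sum.inter_filter[symmetric] del: One_nat_def)
  also have "\<dots> \<le> real N * B + Q * suminf (decay_from \<tau> N)"
  proof (intro add_mono mult_right_mono mult_left_mono B0 Q0)
    have "card {k\<in>{1..m}. k \<le> N} \<le> card {1..N}"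
      by (intro card_mono) auto
    then show "real (card {k\<in>{1..m}. k \<le> N}) \<le> real N" by simp
    show "(\<Sum>k=1..m. decay_from \<tau> N k) \<le> suminf (decay_from \<tau> N)"
      by (rule sum_le_suminf[OF summable_decay_from[OF \<tau>]]) auto
  qed
  finally show ?thesis
    by (simp only: r_def B_def Q_def Z_def)
qed

text \<open>The local approximation is re-centered: time is frozen at the predicted index i for all
  predecessors. Moving from (i - k) / n to i / n costs L k / n by the Lipschitz condition. One
  constant K is made to serve all bounds.\<close>

lemma array_constants:
  assumes ls: "locally_stationary M x \<gamma>" and updc: "UPDC M x"
    and \<tau>: "1 < \<tau>" and srd: "short_range_dependent M x \<tau>"
  obtains \<kappa> K n0 where "0 < \<kappa>" "0 \<le> K"
    "\<forall>n. \<forall>i\<in>{1..n}. \<forall>j\<in>{1..n}. \<bar>covariance (M n) (x n i) (x n j)\<bar> \<le> K * decay \<tau> (lag i j)"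
    "\<forall>t\<in>{0..1}. \<forall>k. \<bar>\<gamma> t k\<bar> \<le> K * decay \<tau> k"
    "\<forall>n. \<forall>i\<in>{1..n}. \<forall>k<i. \<forall>j<i. \<bar>covariance (M n) (x n (i - k)) (x n (i - j)) - \<gamma> (real i / real n) (lag k j)\<bar>
      \<le> K * ((real k + real j + 1) / real n)"
    "\<forall>t\<in>{0..1}. \<forall>b. coercive \<kappa> {1..b} (\<lambda>j k. \<gamma> t (lag j k))"
    "\<forall>n\<ge>n0. coercive \<kappa> {1..n} (\<lambda>i j. covariance (M n) (x n i) (x n j))"
proof -
  obtain K where K: "0 \<le> K" "\<forall>n. \<forall>i\<in>{1..n}. \<forall>j\<in>{1..n}. \<bar>covariance (M n) (x n i) (x n j)\<bar> \<le> K * decay \<tau> (lag i j)"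
    using covariance_decay[OF ls srd \<tau>] by blast
  obtain \<kappa> where \<kappa>: "0 < \<kappa>"
    and ev: "\<forall>\<^sub>F n in sequentially. coercive \<kappa> {1..n} (\<lambda>i j. covariance (M n) (x n i) (x n j))"
    using UPDC_coercive[OF updc] by blast
  from ev obtain n0 where n0: "\<forall>n\<ge>n0. coercive \<kappa> {1..n} (\<lambda>i j. covariance (M n) (x n i) (x n j))"
    unfolding eventually_sequentially by blast
  obtain C L where C: "0 \<le> C"
    "\<forall>n. \<forall>i\<in>{1..n}. \<forall>j\<in>{1..n}.
      \<bar>covariance (M n) (x n i) (x n j) - \<gamma> (real i / real n) (lag i j)\<bar> \<le> C * ((real (lag i j) + 1) / real n)"
    and L: "0 \<le> L" "\<forall>k. L-lipschitz_on {0..1} (\<lambda>t. \<gamma> t k)"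
    using locally_stationaryD[OF ls] by (elim exE conjE) (rule that)
  define K' where "K' = K + C + L"
  have K': "0 \<le> K'" "K \<le> K'" using K C L by (auto simp: K'_def)
  show ?thesis
  proof (rule that[OF \<kappa> K'(1)])
    have le: "K * decay \<tau> m \<le> K' * decay \<tau> m" for m
      using K' by (intro mult_right_mono) auto
    show "\<forall>n. \<forall>i\<in>{1..n}. \<forall>j\<in>{1..n}. \<bar>covariance (M n) (x n i) (x n j)\<bar> \<le> K' * decay \<tau> (lag i j)"
      using K(2) order_trans[OF _ le] by blast
    show "\<forall>t\<in>{0..1}. \<forall>k. \<bar>\<gamma> t k\<bar> \<le> K' * decay \<tau> k"
      using autocovariance_decay[OF ls, of _ K \<tau>] K(2) order_trans[OF _ le] by blast
    show "\<forall>t\<in>{0..1}. \<forall>b. coercive \<kappa> {1..b} (\<lambda>j k. \<gamma> t (lag j k))"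
      using autocovariance_coercive[OF ls _ ev] by blast
    show "\<forall>n. \<forall>i\<in>{1..n}. \<forall>k<i. \<forall>j<i. \<bar>covariance (M n) (x n (i - k)) (x n (i - j)) - \<gamma> (real i / real n) (lag k j)\<bar>
      \<le> K' * ((real k + real j + 1) / real n)"
    proof (intro allI ballI impI)
      fix n i k j :: nat assume i: "i \<in> {1..n}" and k: "k < i" and j: "j < i"
      let ?t = "real i / real n" and ?s = "real (i - k) / real n"
      have n: "0 < real n" using i by auto
      have lag: "lag (i - k) (i - j) = lag k j"
        using k j by linarith
      have mem: "i - k \<in> {1..n}" "i - j \<in> {1..n}" "?t \<in> {0..1}" "?s \<in> {0..1}"
        using i k j by (auto simp: divide_le_eq)
      have "real (lag k j) \<le> real k + real j" by linarith
      then have "C * ((real (lag k j) + 1) / real n) \<le> C * ((real k + real j + 1) / real n)"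
        using C(1) n by (intro mult_left_mono divide_right_mono) auto
      with C(2)[rule_format, OF mem(1,2)] have
        1: "\<bar>covariance (M n) (x n (i - k)) (x n (i - j)) - \<gamma> ?s (lag k j)\<bar> \<le> C * ((real k + real j + 1) / real n)"
        unfolding lag by linarith
      have "\<bar>\<gamma> ?s (lag k j) - \<gamma> ?t (lag k j)\<bar> \<le> L * \<bar>?s - ?t\<bar>"
        using lipschitz_onD[OF L(2)[rule_format] mem(4,3)] by (simp add: dist_real_def)
      also have "\<bar>?s - ?t\<bar> = real k / real n"
        using k n by (simp add: diff_divide_distrib[symmetric])
      also have "L * (real k / real n) \<le> L * ((real k + real j + 1) / real n)"
        using L(1) n by (intro mult_left_mono divide_right_mono) auto
      finally have 2: "\<bar>\<gamma> ?s (lag k j) - \<gamma> ?t (lag k j)\<bar> \<le> L * ((real k + real j + 1) / real n)" .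
      have "0 \<le> K * ((real k + real j + 1) / real n)"
        using K(1) n by simp
      with 1 2 show "\<bar>covariance (M n) (x n (i - k)) (x n (i - j)) - \<gamma> ?t (lag k j)\<bar>
          \<le> K' * ((real k + real j + 1) / real n)"
        unfolding K'_def distrib_right by linarith
    qed
  qed (rule n0)
qed

text \<open>The cutoffs N and J are left free in the coefficient bound, since it is needed once for
  a rate and once for smallness. The bound is in the sum norm, which controls the Euclidean norm,
  the intercepts and the mean-square errors alike.\<close>

lemma predictor_estimates:
  assumes soa: "second_order_array M x"
    and ls: "locally_stationary M x \<gamma>" and updc: "UPDC M x"
    and \<tau>: "1 < \<tau>" and srd: "short_range_dependent M x \<tau>"
  obtains P Q B n0 where "0 \<le> P" "0 \<le> Q" "0 \<le> B"
    "\<forall>t\<in>{0..1}. \<forall>b. \<forall>j\<in>{1..b}. \<bar>coef_fun \<gamma> \<mu> b j t\<bar> \<le> P * decay \<tau> j"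
    "\<forall>n\<ge>n0. \<forall>i\<in>{1..n}. \<forall>f. best_linear_prediction (M n) (x n) i f \<longrightarrow> (\<forall>b<i. \<forall>N\<le>b. \<forall>J.
       (\<Sum>j=1..i - 1. \<bar>f j - (if j \<le> b then coef_fun \<gamma> \<mu> b j (real i / real n) else 0)\<bar>)
       \<le> Q * (real N * ((real N + real J + 1) / real n + (\<Sum>j\<in>{J<..b}. decay \<tau> j)) + suminf (decay_from \<tau> N)))"
    "\<forall>n\<ge>n0. \<forall>f. (\<forall>i\<in>{1..n}. best_linear_prediction (M n) (x n) i (f i)) \<longrightarrow>
       (\<exists>H. (\<forall>i\<in>{1..n}. (\<Sum>k=1..n. \<bar>H i k\<bar>) \<le> B) \<and>
        (\<forall>e. \<forall>i\<in>{1..n}. e i = (\<Sum>k=1..n. H i k * (e k - (\<Sum>j=1..k - 1. f k j * e (k - j))))))"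
proof -
  obtain \<kappa> K n0 where \<kappa>: "0 < \<kappa>" and K: "0 \<le> K"
    and cov: "\<forall>n. \<forall>i\<in>{1..n}. \<forall>j\<in>{1..n}. \<bar>covariance (M n) (x n i) (x n j)\<bar> \<le> K * decay \<tau> (lag i j)"
    and \<gamma>: "\<forall>t\<in>{0..1}. \<forall>k. \<bar>\<gamma> t k\<bar> \<le> K * decay \<tau> k"
    and cov_\<gamma>: "\<forall>n. \<forall>i\<in>{1..n}. \<forall>k<i. \<forall>j<i. \<bar>covariance (M n) (x n (i - k)) (x n (i - j)) - \<gamma> (real i / real n) (lag k j)\<bar>
      \<le> K * ((real k + real j + 1) / real n)"
    and co_\<gamma>: "\<forall>t\<in>{0..1}. \<forall>b. coercive \<kappa> {1..b} (\<lambda>j k. \<gamma> t (lag j k))"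
    and co: "\<forall>n\<ge>n0. coercive \<kappa> {1..n} (\<lambda>i j. covariance (M n) (x n i) (x n j))"
    by (rule array_constants[OF ls updc \<tau> srd])
  obtain M1 where M1: "0 \<le> M1" and sol_sum: "\<forall>m A u. coercive_decaying \<tau> \<kappa> K m A \<longrightarrow>
    (\<forall>F. (\<forall>j\<in>{1..m}. \<bar>\<Sum>k=1..m. A j k * u k\<bar> \<le> F) \<longrightarrow> (\<forall>k\<in>{1..m}. \<bar>u k\<bar> \<le> M1 * F)) \<and>
    (\<Sum>k=1..m. \<bar>u k\<bar>) \<le> M1 * (\<Sum>j=1..m. \<bar>\<Sum>k=1..m. A j k * u k\<bar>)"
    using solution_bounds[OF \<tau> \<kappa> K] by blast
  obtain M2 where M2: "0 \<le> M2" and sol_decay: "\<forall>m A u F. coercive_decaying \<tau> \<kappa> K m A \<longrightarrow>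
    (\<forall>j\<in>{1..m}. \<bar>\<Sum>k=1..m. A j k * u k\<bar> \<le> F * decay \<tau> j) \<longrightarrow>
    (\<forall>k\<in>{1..m}. \<bar>u k\<bar> \<le> M2 * F * decay \<tau> k)"
    using solution_decay[OF \<tau> \<kappa> K] by blast
  \<comment> \<open>One constant for both kinds of coefficients: each family solves a system of the
    same class with right-hand side bounded by \<open>K * decay \<tau>\<close>.\<close>
  define P where "P = M2 * K"
  have P: "0 \<le> P" using M2 K by (simp add: P_def)
  define Z where "Z = suminf (decay \<tau>)"
  have Z: "1 \<le> Z" using suminf_decay_ge_1[OF \<tau>] by (simp add: Z_def)
  obtain B where B: "0 \<le> B" and stable: "\<forall>n S f. coercive_decaying \<tau> \<kappa> K n S \<longrightarrow>
    (\<forall>i\<in>{1..n}. \<forall>j\<in>{1..i - 1}. \<bar>f i j\<bar> \<le> P * decay \<tau> j) \<longrightarrow>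
    (\<forall>i\<in>{1..n}. \<forall>k\<in>{1..i - 1}. (\<Sum>j=1..i - 1. S (i - k) (i - j) * f i j) = S (i - k) i) \<longrightarrow>
    (\<exists>H. (\<forall>i\<in>{1..n}. (\<Sum>k=1..n. \<bar>H i k\<bar>) \<le> B) \<and>
      (\<forall>e. \<forall>i\<in>{1..n}. e i = (\<Sum>k=1..n. H i k * (e k - (\<Sum>j=1..k - 1. f k j * e (k - j))))))"
    using predictor_recursion_stable[OF \<tau> \<kappa> K P] by blast
  have cd_\<gamma>: "coercive_decaying \<tau> \<kappa> K b (\<lambda>j k. \<gamma> t (lag j k))" if "t \<in> {0..1}" for t b
    unfolding coercive_decaying_def using co_\<gamma> \<gamma> that by (auto simp: lag_commute)
  have coef: "\<forall>j\<in>{1..b}. \<bar>coef_fun \<gamma> \<mu> b j t\<bar> \<le> P * decay \<tau> j" if t: "t \<in> {0..1}" for t b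
  proof -
    have "\<forall>k\<in>{1..b}. \<bar>\<Sum>j=1..b. \<gamma> t (lag k j) * coef_fun \<gamma> \<mu> b j t\<bar> \<le> K * decay \<tau> k"
      using coef_fun_normal_equations[of \<kappa> b \<gamma> t, OF co_\<gamma>[rule_format, OF t] \<kappa>] \<gamma> t by simp
    from sol_decay[THEN spec, THEN spec, THEN spec, THEN spec, THEN mp, OF cd_\<gamma>[OF t],
        of b "\<lambda>j. coef_fun \<gamma> \<mu> b j t" K, THEN mp, OF this]
    show ?thesis
      unfolding P_def .
  qed
  have normal: "(\<Sum>j=1..i - 1. covariance (M n) (x n (i - k)) (x n (i - j)) * f j) = covariance (M n) (x n (i - k)) (x n i)"
    if "i \<in> {1..n}" "best_linear_prediction (M n) (x n) i f" "k \<in> {1..i - 1}" for n i f k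
    using that soa unfolding second_order_array_def
    by (intro best_linear_prediction_normal_equations(2)) auto
  \<comment> \<open>Predecessors are indexed by their distance to i, so decay in the index means
    decay away from the predicted time.\<close>
  have cd: "coercive_decaying \<tau> \<kappa> K (i - 1) (\<lambda>k j. covariance (M n) (x n (i - k)) (x n (i - j)))"
    if n: "n0 \<le> n" and i: "i \<in> {1..n}" for n i
  proof -
    have "coercive \<kappa> {1..i - 1} (\<lambda>k j. covariance (M n) (x n (i - k)) (x n (i - j)))"
      by (rule coercive_reindex[OF co[rule_format, OF n], of "\<lambda>k. i - k"]) (use i in \<open>auto simp: inj_on_def\<close>)
    moreover have "\<bar>covariance (M n) (x n (i - k)) (x n (i - j))\<bar> \<le> K * decay \<tau> (lag k j)"
      if "k \<in> {1..i - 1}" "j \<in> {1..i - 1}" for k j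
    proof -
      have "lag (i - k) (i - j) = lag k j" "i - k \<in> {1..n}" "i - j \<in> {1..n}"
        using that i by auto
      then show ?thesis using cov by metis
    qed
    ultimately show ?thesis
      unfolding coercive_decaying_def by (simp add: covariance_commute)
  qed
  have f_decay: "\<forall>j\<in>{1..i - 1}. \<bar>f j\<bar> \<le> P * decay \<tau> j"
    if n: "n0 \<le> n" and i: "i \<in> {1..n}" and f: "best_linear_prediction (M n) (x n) i f" for n i f
  proof -
    have "\<forall>k\<in>{1..i - 1}. \<bar>\<Sum>j=1..i - 1. covariance (M n) (x n (i - k)) (x n (i - j)) * f j\<bar> \<le> K * decay \<tau> k"
    proof
      fix k assume k: "k \<in> {1..i - 1}"
      have "lag (i - k) i = k" "i - k \<in> {1..n}"
        using k i by auto
      with cov i have "\<bar>covariance (M n) (x n (i - k)) (x n i)\<bar> \<le> K * decay \<tau> k"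
        by metis
      then show "\<bar>\<Sum>j=1..i - 1. covariance (M n) (x n (i - k)) (x n (i - j)) * f j\<bar> \<le> K * decay \<tau> k"
        unfolding normal[OF i f k] .
    qed
    from sol_decay[THEN spec, THEN spec, THEN spec, THEN spec, THEN mp, OF cd[OF n i],
        of f K, THEN mp, OF this]
    show ?thesis
      unfolding P_def .
  qed
  define Q where "Q = M1 * (K * (1 + P * (4 * 2 powr \<tau> * Z)) + 2 * K * P + K * (1 + P * Z))"
  have Q: "0 \<le> Q" using M1 K P Z by (simp add: Q_def)
  have diff: "(\<Sum>j=1..i - 1. \<bar>f j - (if j \<le> b then coef_fun \<gamma> \<mu> b j (real i / real n) else 0)\<bar>)
       \<le> Q * (real N * ((real N + real J + 1) / real n + (\<Sum>j\<in>{J<..b}. decay \<tau> j)) + suminf (decay_from \<tau> N))"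
    if n: "n0 \<le> n" and i: "i \<in> {1..n}" and f: "best_linear_prediction (M n) (x n) i f"
      and b: "b < i" "N \<le> b" for n i f b N J
  proof -
    define t where "t = real i / real n"
    have t: "t \<in> {0..1}" using i by (auto simp: t_def divide_le_eq)
    define T where "T = (\<lambda>k j. covariance (M n) (x n (i - k)) (x n (i - j)))"
    define c where "c = (\<lambda>j. coef_fun \<gamma> \<mu> b j t)"
    define v where "v = (\<lambda>j. f j - (if j \<le> b then c j else 0))"
    \<comment> \<open>The difference \<open>v\<close> between the exact coefficients and the
      zero-extended stationary ones solves the exact system, with the residual of the stationary
      ones as right-hand side.\<close>
    have Tv: "(\<Sum>j=1..i - 1. T k j * v j) = T k 0 - (\<Sum>j=1..b. T k j * c j)" if "k \<in> {1..i - 1}" for k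
    proof -
      have "(\<Sum>j=1..i - 1. T k j * v j) = (\<Sum>j=1..i - 1. T k j * f j) - (\<Sum>j=1..i - 1. if j \<le> b then T k j * c j else 0)"
        unfolding sum_subtractf[symmetric] by (intro sum.cong refl) (simp add: v_def right_diff_distrib)
      also have "(\<Sum>j=1..i - 1. if j \<le> b then T k j * c j else 0) = (\<Sum>j=1..b. T k j * c j)"
        using b(1) by (intro sum.mono_neutral_cong_right) auto
      also have "(\<Sum>j=1..i - 1. T k j * f j) = T k 0"
        unfolding T_def using normal[OF i f that] by simp
      finally show ?thesis .
    qed
    have "(\<Sum>j=1..i - 1. \<bar>v j\<bar>) \<le> M1 * (\<Sum>k=1..i - 1. \<bar>\<Sum>j=1..i - 1. T k j * v j\<bar>)"
      unfolding T_def by (rule conjunct2[OF sol_sum[rule_format, OF cd[OF n i]]])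
    also have "(\<Sum>k=1..i - 1. \<bar>\<Sum>j=1..i - 1. T k j * v j\<bar>)
        = (\<Sum>k=1..i - 1. \<bar>T k 0 - (\<Sum>j=1..b. T k j * c j)\<bar>)"
      by (intro sum.cong refl) (simp only: Tv)
    also have "\<dots> \<le> real N * (K * ((real N + real J + 1) / real n) * (1 + P * suminf (decay \<tau>))
        + 2 * K * P * (\<Sum>j\<in>{J<..b}. decay \<tau> j))
      + K * (1 + P * (4 * 2 powr \<tau> * suminf (decay \<tau>))) * suminf (decay_from \<tau> N)"
    proof (rule truncated_residual_sum_le[OF \<tau> K P, where g = "\<gamma> t"])
      show "0 < real n" "b \<le> i - 1" "N \<le> b" using i b by auto
      fix k
      show "\<bar>\<gamma> t k\<bar> \<le> K * decay \<tau> k" using \<gamma> t by blast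
      show "(\<Sum>j=1..b. \<gamma> t (lag k j) * c j) = \<gamma> t k" if "k \<in> {1..b}"
        unfolding c_def by (rule coef_fun_normal_equations[of \<kappa> b \<gamma> t, OF co_\<gamma>[rule_format, OF t] \<kappa> that])
      show "\<bar>c k\<bar> \<le> P * decay \<tau> k" if "k \<in> {1..b}"
        unfolding c_def using coef[OF t] that by blast
      fix j assume kj: "k \<le> i - 1" "j \<le> i - 1"
      then have lt: "k < i" "j < i" using i by auto
      show "\<bar>T k j - \<gamma> t (lag k j)\<bar> \<le> K * ((real k + real j + 1) / real n)"
        unfolding T_def t_def using cov_\<gamma> i lt by blast
      have "lag (i - k) (i - j) = lag k j" "i - k \<in> {1..n}" "i - j \<in> {1..n}"
        using lt i by auto
      then show "\<bar>T k j\<bar> \<le> K * decay \<tau> (lag k j)"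
        unfolding T_def using cov by metis
    qed
    also have "M1 * \<dots> \<le> Q * (real N * ((real N + real J + 1) / real n + (\<Sum>j\<in>{J<..b}. decay \<tau> j)) + suminf (decay_from \<tau> N))"
    proof -
      define q where "q = K * (1 + P * (4 * 2 powr \<tau> * Z)) + 2 * K * P + K * (1 + P * Z)"
      have q: "K * (1 + P * Z) \<le> q" "2 * K * P \<le> q" "K * (1 + P * (4 * 2 powr \<tau> * Z)) \<le> q"
        using K P Z by (auto simp: q_def)
      define X D t where "X = (real N + real J + 1) / real n"
        and "D = (\<Sum>j\<in>{J<..b}. decay \<tau> j)" and "t = suminf (decay_from \<tau> N)"
      have nonneg: "0 \<le> X" "0 \<le> D" "0 \<le> t"
        using suminf_decay_from_nonneg[OF \<tau>] by (auto simp: X_def D_def t_def intro: sum_nonneg)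
      have "K * X * (1 + P * Z) = K * (1 + P * Z) * X"
        by simp
      also have "\<dots> \<le> q * X"
        by (intro mult_right_mono q nonneg)
      finally have "K * X * (1 + P * Z) + 2 * K * P * D \<le> q * X + q * D"
        using mult_right_mono[OF q(2) nonneg(2)] by (rule add_mono)
      from mult_left_mono[OF this, of "real N"] mult_right_mono[OF q(3) nonneg(3)]
      have "real N * (K * X * (1 + P * Z) + 2 * K * P * D) + K * (1 + P * (4 * 2 powr \<tau> * Z)) * t
          \<le> real N * (q * X + q * D) + q * t"
        by linarith
      also have "\<dots> = q * (real N * (X + D) + t)"
        by (simp add: algebra_simps)
      finally have "real N * (K * X * (1 + P * Z) + 2 * K * P * D) + K * (1 + P * (4 * 2 powr \<tau> * Z)) * t
          \<le> q * (real N * (X + D) + t)" .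
      from mult_left_mono[OF this M1] show ?thesis
        unfolding Q_def q_def Z_def X_def D_def t_def by (simp only: mult.assoc)
    qed
    finally show ?thesis
      using M1 by (simp only: v_def c_def t_def mult_left_mono)
  qed
  show ?thesis
  proof (rule that[OF P Q B])
    show "\<forall>t\<in>{0..1}. \<forall>b. \<forall>j\<in>{1..b}. \<bar>coef_fun \<gamma> \<mu> b j t\<bar> \<le> P * decay \<tau> j"
      using coef by blast
    show "\<forall>n\<ge>n0. \<forall>i\<in>{1..n}. \<forall>f. best_linear_prediction (M n) (x n) i f \<longrightarrow> (\<forall>b<i. \<forall>N\<le>b. \<forall>J.
       (\<Sum>j=1..i - 1. \<bar>f j - (if j \<le> b then coef_fun \<gamma> \<mu> b j (real i / real n) else 0)\<bar>)
       \<le> Q * (real N * ((real N + real J + 1) / real n + (\<Sum>j\<in>{J<..b}. decay \<tau> j)) + suminf (decay_from \<tau> N)))"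
      using diff by blast
    show "\<forall>n\<ge>n0. \<forall>f. (\<forall>i\<in>{1..n}. best_linear_prediction (M n) (x n) i (f i)) \<longrightarrow>
       (\<exists>H. (\<forall>i\<in>{1..n}. (\<Sum>k=1..n. \<bar>H i k\<bar>) \<le> B) \<and>
        (\<forall>e. \<forall>i\<in>{1..n}. e i = (\<Sum>k=1..n. H i k * (e k - (\<Sum>j=1..k - 1. f k j * e (k - j))))))"
    proof (intro allI impI)
      fix n f assume n: "n0 \<le> n" and f: "\<forall>i\<in>{1..n}. best_linear_prediction (M n) (x n) i (f i)"
      have "coercive_decaying \<tau> \<kappa> K n (\<lambda>i j. covariance (M n) (x n i) (x n j))"
        unfolding coercive_decaying_def using co n cov by (auto simp: covariance_commute)
      from stable[rule_format, OF this] f_decay[OF n] normal f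
      show "\<exists>H. (\<forall>i\<in>{1..n}. (\<Sum>k=1..n. \<bar>H i k\<bar>) \<le> B) \<and>
        (\<forall>e. \<forall>i\<in>{1..n}. e i = (\<Sum>k=1..n. H i k * (e k - (\<Sum>j=1..k - 1. f k j * e (k - j)))))"
        by blast
    qed
  qed
qed

section \<open>Mean-square estimates\<close>

definition l2norm :: "'w measure \<Rightarrow> ('w \<Rightarrow> real) \<Rightarrow> real" where
  "l2norm M X = sqrt (LINT \<omega>|M. (X \<omega>)\<^sup>2)"

lemma l2norm_nonneg: "0 \<le> l2norm M X"
  by (simp add: l2norm_def)

lemma l2norm_power2: "(l2norm M X)\<^sup>2 = (LINT \<omega>|M. (X \<omega>)\<^sup>2)"
  by (simp add: l2norm_def)

lemma l2norm_cmult: "l2norm M (\<lambda>\<omega>. c * X \<omega>) = \<bar>c\<bar> * l2norm M X"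
  by (simp add: l2norm_def power_mult_distrib real_sqrt_mult)

lemma l2norm_Cauchy_Schwarz:
  assumes X: "square_integrable M X" and Y: "square_integrable M Y"
  shows "(LINT \<omega>|M. X \<omega> * Y \<omega>) \<le> l2norm M X * l2norm M Y"
proof -
  let ?a = "l2norm M X" and ?b = "l2norm M Y" and ?c = "LINT \<omega>|M. X \<omega> * Y \<omega>"
  have nonneg: "0 \<le> ?a\<^sup>2 + 2 * h * ?c + h\<^sup>2 * ?b\<^sup>2" for h
  proof -
    have "0 \<le> (LINT \<omega>|M. (X \<omega> + h * Y \<omega>)\<^sup>2)"
      by simp
    also have "\<dots> = (LINT \<omega>|M. (X \<omega>)\<^sup>2 + 2 * h * (X \<omega> * Y \<omega>) + h\<^sup>2 * (Y \<omega>)\<^sup>2)"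
      by (intro Bochner_Integration.integral_cong refl) (simp add: power2_eq_square algebra_simps)
    also have "\<dots> = ?a\<^sup>2 + 2 * h * ?c + h\<^sup>2 * ?b\<^sup>2"
      using X Y integrable_mult_square_integrable[OF X Y] by (simp add: square_integrable_def l2norm_power2)
    finally show ?thesis .
  qed
  show ?thesis
  proof (cases "?b = 0")
    case True
    have "?c \<le> 0"
    proof (rule ccontr)
      assume "\<not> ?c \<le> 0"
      then have "0 < ?c" by simp
      have "0 \<le> ?a\<^sup>2 + 2 * (- (?a\<^sup>2 + 1) / ?c) * ?c"
        using nonneg[of "- (?a\<^sup>2 + 1) / ?c"] True by simp
      also have "\<dots> = - ?a\<^sup>2 - 2"
        using \<open>0 < ?c\<close> by (simp add: field_simps)
      finally show False
        using zero_le_power2[of ?a] by linarith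
    qed
    with True show ?thesis by simp
  next
    case False
    then have b: "0 < ?b" using l2norm_nonneg[of M Y] by linarith
    have "0 \<le> ?a\<^sup>2 + 2 * (- ?c / ?b\<^sup>2) * ?c + (- ?c / ?b\<^sup>2)\<^sup>2 * ?b\<^sup>2"
      by (rule nonneg)
    also have "\<dots> = ?a\<^sup>2 - ?c\<^sup>2 / ?b\<^sup>2"
      using b by (simp add: field_simps power2_eq_square)
    finally have "?c\<^sup>2 \<le> (?a * ?b)\<^sup>2"
      using b by (simp add: pos_divide_le_eq power_mult_distrib)
    then show ?thesis
      by (rule power2_le_imp_le) (simp add: l2norm_nonneg)
  qed
qed

lemma l2norm_triangle:
  assumes X: "square_integrable M X" and Y: "square_integrable M Y"
  shows "l2norm M (\<lambda>\<omega>. X \<omega> + Y \<omega>) \<le> l2norm M X + l2norm M Y"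
proof (rule power2_le_imp_le)
  have "(l2norm M (\<lambda>\<omega>. X \<omega> + Y \<omega>))\<^sup>2 = (LINT \<omega>|M. (X \<omega>)\<^sup>2 + 2 * (X \<omega> * Y \<omega>) + (Y \<omega>)\<^sup>2)"
    unfolding l2norm_power2
    by (intro Bochner_Integration.integral_cong refl) (simp add: power2_eq_square algebra_simps)
  also have "\<dots> = (l2norm M X)\<^sup>2 + 2 * (LINT \<omega>|M. X \<omega> * Y \<omega>) + (l2norm M Y)\<^sup>2"
    using X Y integrable_mult_square_integrable[OF X Y] by (simp add: square_integrable_def l2norm_power2)
  also have "\<dots> \<le> (l2norm M X)\<^sup>2 + 2 * (l2norm M X * l2norm M Y) + (l2norm M Y)\<^sup>2"
    using l2norm_Cauchy_Schwarz[OF X Y] by simp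
  also have "\<dots> = (l2norm M X + l2norm M Y)\<^sup>2"
    by (simp add: power2_eq_square algebra_simps)
  finally show "(l2norm M (\<lambda>\<omega>. X \<omega> + Y \<omega>))\<^sup>2 \<le> (l2norm M X + l2norm M Y)\<^sup>2" .
qed (simp add: l2norm_nonneg)

lemma l2norm_sum_le:
  assumes M: "prob_space M" and Y: "\<And>k. k \<in> K \<Longrightarrow> square_integrable M (Y k)"
  shows "l2norm M (\<lambda>\<omega>. \<Sum>k\<in>K. h k * Y k \<omega>) \<le> (\<Sum>k\<in>K. \<bar>h k\<bar> * l2norm M (Y k))"
  using Y
proof (induction K rule: infinite_finite_induct)
  case (insert k K)
  have "l2norm M (\<lambda>\<omega>. h k * Y k \<omega> + (\<Sum>k\<in>K. h k * Y k \<omega>))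
      \<le> l2norm M (\<lambda>\<omega>. h k * Y k \<omega>) + l2norm M (\<lambda>\<omega>. \<Sum>k\<in>K. h k * Y k \<omega>)"
    using insert.prems
    by (intro l2norm_triangle square_integrable_cmult square_integrable_sum M) auto
  with insert show ?case
    by (simp add: l2norm_cmult)
qed (simp_all add: l2norm_def)

lemma l2norm_sum_le_uniform:
  assumes M: "prob_space M" and Y: "\<And>k. k \<in> K \<Longrightarrow> square_integrable M (Y k)"
    and G: "\<And>k. k \<in> K \<Longrightarrow> l2norm M (Y k) \<le> G"
  shows "l2norm M (\<lambda>\<omega>. \<Sum>k\<in>K. h k * Y k \<omega>) \<le> (\<Sum>k\<in>K. \<bar>h k\<bar>) * G"
  by (rule order_trans[OF l2norm_sum_le[OF M Y]])
    (auto simp: sum_distrib_right intro!: sum_mono mult_left_mono G)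

text \<open>Applying the exact recursion to the error e leaves \<delta> plus the coefficient
  difference acting on e. Inverting with \<open>H\<close> gives E \<le> B (\<Delta> + \<eta> E) for
  the maximal norm E, and B \<eta> \<le> 1 / 2 absorbs the last term.\<close>

lemma ar_error_le:
  fixes e \<delta> :: "nat \<Rightarrow> 'w \<Rightarrow> real" and c f H :: "nat \<Rightarrow> nat \<Rightarrow> real"
  assumes M: "prob_space M"
    and H: "\<And>i. i \<in> {1..n} \<Longrightarrow> (\<Sum>k=1..n. \<bar>H i k\<bar>) \<le> B"
    and inv: "\<And>y i. i \<in> {1..n} \<Longrightarrow> y i = (\<Sum>k=1..n. H i k * (y k - (\<Sum>j=1..k - 1. f k j * y (k - j))))"
    and e0: "\<And>i \<omega>. i \<le> b \<Longrightarrow> e i \<omega> = 0"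
    and rec: "\<And>i \<omega>. i \<in> {b<..n} \<Longrightarrow> e i \<omega> = \<delta> i \<omega> + (\<Sum>j=1..b. c i j * e (i - j) \<omega>)"
    and \<delta>: "\<And>i. i \<in> {b<..n} \<Longrightarrow> square_integrable M (\<delta> i)" "\<And>i. i \<in> {b<..n} \<Longrightarrow> l2norm M (\<delta> i) \<le> \<Delta>"
    and v: "\<And>i. i \<in> {b<..n} \<Longrightarrow> (\<Sum>j=1..i - 1. \<bar>f i j - (if j \<le> b then c i j else 0)\<bar>) \<le> \<eta>"
    and pos: "0 \<le> B" "0 \<le> \<Delta>" "0 \<le> \<eta>" and small: "B * \<eta> \<le> 1 / 2" and i: "i \<in> {1..n}"
  shows "l2norm M (e i) \<le> 2 * B * \<Delta>"
proof -
  have e_sq: "i \<le> n \<longrightarrow> square_integrable M (e i)" for i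
  proof (induction i rule: less_induct)
    case (less i)
    show ?case
    proof
      assume "i \<le> n"
      show "square_integrable M (e i)"
      proof (cases "i \<le> b")
        case True
        then have "e i = (\<lambda>_. 0)" using e0 by blast
        then show ?thesis using square_integrable_const[OF M] by simp
      next
        case False
        then have "i \<in> {b<..n}" using \<open>i \<le> n\<close> by simp
        then have "e i = (\<lambda>\<omega>. \<delta> i \<omega> + (\<Sum>j=1..b. c i j * e (i - j) \<omega>))"
          using rec by blast
        moreover have "square_integrable M (\<lambda>\<omega>. \<delta> i \<omega> + (\<Sum>j=1..b. c i j * e (i - j) \<omega>))"
          using \<delta>(1)[OF \<open>i \<in> {b<..n}\<close>] less \<open>i \<le> n\<close> False
          by (intro square_integrable_add square_integrable_sum square_integrable_cmult M) auto
        ultimately show ?thesis by simp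
      qed
    qed
  qed
  define E where "E = Max ((\<lambda>i. l2norm M (e i)) ` {1..n})"
  have E: "l2norm M (e i) \<le> E" if "i \<in> {1..n}" for i
    unfolding E_def using that by (intro Max_ge) auto
  have E0: "0 \<le> E"
    using order_trans[OF l2norm_nonneg E[OF i]] .
  define g where "g = (\<lambda>k \<omega>. e k \<omega> - (\<Sum>j=1..k - 1. f k j * e (k - j) \<omega>))"
  have g: "square_integrable M (g k) \<and> l2norm M (g k) \<le> \<Delta> + \<eta> * E" if k: "k \<in> {1..n}" for k
  proof (cases "k \<le> b")
    \<comment> \<open>For k \<le> b the error and all its predecessors vanish, so nothing is assumed
      about the coefficients in these rows.\<close>
    case True
    then have "g k = (\<lambda>_. 0)"
      by (auto simp: g_def e0 intro!: sum.neutral)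
    then show ?thesis
      using square_integrable_const[OF M, of 0] pos E0 by (simp add: l2norm_def)
  next
    case False
    then have kb: "k \<in> {b<..n}" using k by simp
    define w where "w = (\<lambda>j. (if j \<le> b then c k j else 0) - f k j)"
    have "g k \<omega> = \<delta> k \<omega> + (\<Sum>j=1..k - 1. w j * e (k - j) \<omega>)" for \<omega>
    proof -
      have "(\<Sum>j=1..b. c k j * e (k - j) \<omega>) = (\<Sum>j=1..k - 1. (if j \<le> b then c k j else 0) * e (k - j) \<omega>)"
        using False by (intro sum.mono_neutral_cong_left) auto
      then show ?thesis
        unfolding g_def rec[OF kb] by (simp add: w_def left_diff_distrib sum_subtractf del: One_nat_def)
    qed
    then have gk: "g k = (\<lambda>\<omega>. \<delta> k \<omega> + (\<Sum>j=1..k - 1. w j * e (k - j) \<omega>))"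
      by blast
    have sq: "square_integrable M (e (k - j))" and le: "l2norm M (e (k - j)) \<le> E" if "j \<in> {1..k - 1}" for j
    proof -
      have "k - j \<in> {1..n}" using that k by auto
      with e_sq[of "k - j"] E[of "k - j"] show "square_integrable M (e (k - j))" "l2norm M (e (k - j)) \<le> E"
        by auto
    qed
    have sum_sq: "square_integrable M (\<lambda>\<omega>. \<Sum>j=1..k - 1. w j * e (k - j) \<omega>)"
      by (intro square_integrable_sum square_integrable_cmult sq M)
    have "l2norm M (g k) \<le> l2norm M (\<delta> k) + l2norm M (\<lambda>\<omega>. \<Sum>j=1..k - 1. w j * e (k - j) \<omega>)"
      unfolding gk by (rule l2norm_triangle[OF \<delta>(1)[OF kb] sum_sq])
    also have "\<dots> \<le> \<Delta> + (\<Sum>j=1..k - 1. \<bar>w j\<bar>) * E"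
      by (intro add_mono \<delta>(2)[OF kb] l2norm_sum_le_uniform[OF M sq le])
    also have "\<dots> \<le> \<Delta> + \<eta> * E"
      using v[OF kb] E0 by (intro add_left_mono mult_right_mono) (simp_all add: w_def abs_minus_commute)
    finally show ?thesis
      using square_integrable_add[OF \<delta>(1)[OF kb] sum_sq] unfolding gk by simp
  qed
  have bound: "l2norm M (e i) \<le> B * (\<Delta> + \<eta> * E)" if i: "i \<in> {1..n}" for i
  proof -
    \<comment> \<open>The deterministic inverse is applied separately at each sample point.\<close>
    have "e i = (\<lambda>\<omega>. \<Sum>k=1..n. H i k * g k \<omega>)"
      unfolding g_def using inv[OF i, of "\<lambda>i. e i _"] by blast
    then have "l2norm M (e i) \<le> (\<Sum>k=1..n. \<bar>H i k\<bar>) * (\<Delta> + \<eta> * E)"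
      using l2norm_sum_le_uniform[OF M, of "{1..n}" g "\<Delta> + \<eta> * E" "H i"] g by simp
    also have "\<dots> \<le> B * (\<Delta> + \<eta> * E)"
      using H[OF i] pos E0 by (intro mult_right_mono) auto
    finally show ?thesis .
  qed
  have "E \<le> B * (\<Delta> + \<eta> * E)"
    unfolding E_def using i bound[unfolded E_def] by (subst Max_le_iff) auto
  also have "\<dots> = B * \<Delta> + B * \<eta> * E"
    by (simp add: algebra_simps)
  also have "\<dots> \<le> B * \<Delta> + 1 / 2 * E"
    by (intro add_left_mono mult_right_mono small E0)
  finally have "E \<le> 2 * B * \<Delta>" by simp
  with E[OF i] show ?thesis by linarith
qed

section \<open>From coefficient differences to residuals and intercepts\<close>

lemma linear_prediction_difference:
  assumes "b < i"
  shows "X i \<omega> - (c 0 + (\<Sum>j=1..b. c j * X (i - j) \<omega>) + prediction_error X i f \<omega>)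
    = (f 0 - c 0) + (\<Sum>j=1..i - 1. (f j - (if j \<le> b then c j else 0)) * X (i - j) \<omega>)"
proof -
  have "(\<Sum>j=1..b. c j * X (i - j) \<omega>) = (\<Sum>j=1..i - 1. (if j \<le> b then c j else 0) * X (i - j) \<omega>)"
    using assms by (intro sum.mono_neutral_cong_left) auto
  then show ?thesis
    by (simp add: prediction_error_def linear_prediction_def left_diff_distrib sum_subtractf del: One_nat_def)
qed

text \<open>The exact intercept involves the means at the times i - j, the stationary one only the
  mean at i. The difference splits into the coefficient error against bounded means and the
  stationary coefficients against increments of the mean.\<close>

lemma intercept_difference_le:
  fixes m c f :: "nat \<Rightarrow> real"
  assumes "b < i" and f0: "m i = f 0 + (\<Sum>j=1..i - 1. f j * m (i - j))"
    and c0: "c 0 = m i - (\<Sum>j=1..b. c j * m i)"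
    and G: "\<And>j. j \<in> {1..i - 1} \<Longrightarrow> \<bar>m (i - j)\<bar> \<le> G" and D: "\<And>j. j \<in> {1..b} \<Longrightarrow> \<bar>m i - m (i - j)\<bar> \<le> D"
  shows "\<bar>f 0 - c 0\<bar> \<le> (\<Sum>j=1..i - 1. \<bar>f j - (if j \<le> b then c j else 0)\<bar>) * G + (\<Sum>j=1..b. \<bar>c j\<bar>) * D"
proof -
  have "(\<Sum>j=1..b. c j * m (i - j)) = (\<Sum>j=1..i - 1. (if j \<le> b then c j else 0) * m (i - j))"
    using assms(1) by (intro sum.mono_neutral_cong_left) auto
  then have eq: "f 0 - c 0 = (\<Sum>j=1..b. c j * (m i - m (i - j)))
      - (\<Sum>j=1..i - 1. (f j - (if j \<le> b then c j else 0)) * m (i - j))"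
    using f0 c0 by (simp add: left_diff_distrib right_diff_distrib sum_subtractf del: One_nat_def)
  have "\<bar>f 0 - c 0\<bar> \<le> \<bar>\<Sum>j=1..b. c j * (m i - m (i - j))\<bar>
      + \<bar>\<Sum>j=1..i - 1. (f j - (if j \<le> b then c j else 0)) * m (i - j)\<bar>"
    unfolding eq by (rule abs_triangle_ineq4)
  also have "\<bar>\<Sum>j=1..b. c j * (m i - m (i - j))\<bar> \<le> (\<Sum>j=1..b. \<bar>c j\<bar> * D)"
  proof (rule order_trans[OF sum_abs], rule sum_mono)
    fix j assume "j \<in> {1..b}"
    from mult_left_mono[OF D[OF this], of "\<bar>c j\<bar>"]
    show "\<bar>c j * (m i - m (i - j))\<bar> \<le> \<bar>c j\<bar> * D"
      by (simp add: abs_mult)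
  qed
  also have "\<bar>\<Sum>j=1..i - 1. (f j - (if j \<le> b then c j else 0)) * m (i - j)\<bar>
      \<le> (\<Sum>j=1..i - 1. \<bar>f j - (if j \<le> b then c j else 0)\<bar> * G)"
  proof (rule order_trans[OF sum_abs], rule sum_mono)
    fix j assume "j \<in> {1..i - 1}"
    from mult_left_mono[OF G[OF this], of "\<bar>f j - (if j \<le> b then c j else 0)\<bar>"]
    show "\<bar>(f j - (if j \<le> b then c j else 0)) * m (i - j)\<bar> \<le> \<bar>f j - (if j \<le> b then c j else 0)\<bar> * G"
      by (simp add: abs_mult)
  qed
  finally show ?thesis
    by (simp only: sum_distrib_right add.commute)
qed

section \<open>Rates\<close>

lemma continuously_differentiable_on_imp_continuous_on:
  "continuously_differentiable_on d S f \<Longrightarrow> continuous_on S f"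
proof (induction d)
  case (Suc d)
  from Suc.IH[OF continuously_differentiable_on_pred[OF Suc.prems]] show ?case .
qed (simp add: continuously_differentiable_on_0)

text \<open>One derivative suffices to make increments of the mean over j steps of order j /
  n.\<close>

lemma continuously_differentiable_on_bounded_lipschitz:
  fixes \<mu> :: "real \<Rightarrow> real"
  assumes "continuously_differentiable_on d {0..1} \<mu>" "0 < d"
  shows "\<exists>G\<ge>0. \<exists>L\<ge>0. (\<forall>t\<in>{0..1}. \<bar>\<mu> t\<bar> \<le> G) \<and> (\<forall>s\<in>{0..1}. \<forall>t\<in>{0..1}. \<bar>\<mu> s - \<mu> t\<bar> \<le> L * \<bar>s - t\<bar>)"
proof -
  have bdd: "\<exists>G\<ge>0. \<forall>t\<in>{0..1}. \<bar>f t\<bar> \<le> G" if "continuous_on {0..1} f" for f :: "real \<Rightarrow> real"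
  proof -
    have "bounded (f ` {0..1})"
      using compact_continuous_image[OF that] by (simp add: compact_imp_bounded)
    then obtain G where "\<forall>t\<in>{0..1}. norm (f t) \<le> G"
      unfolding bounded_iff by auto
    then have "\<forall>t\<in>{0..1}. \<bar>f t\<bar> \<le> \<bar>G\<bar>"
      by (auto intro: order_trans[OF _ abs_ge_self])
    then show ?thesis by (intro exI[of _ "\<bar>G\<bar>"]) auto
  qed
  obtain G where G: "0 \<le> G" "\<forall>t\<in>{0..1}. \<bar>\<mu> t\<bar> \<le> G"
    using bdd[OF continuously_differentiable_on_imp_continuous_on[OF assms(1)]] by blast
  obtain d' where "d = Suc d'"
    using assms(2) by (cases d) auto
  with assms(1) have "continuously_differentiable_on (Suc d') {0..1} \<mu>"
    by simp
  then obtain f' where f': "\<forall>t\<in>{0..1}. (\<mu> has_real_derivative f' t) (at t within {0..1})"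
    "continuously_differentiable_on d' {0..1} f'"
    unfolding continuously_differentiable_on_Suc by blast
  obtain L where L: "0 \<le> L" "\<forall>t\<in>{0..1}. \<bar>f' t\<bar> \<le> L"
    using bdd[OF continuously_differentiable_on_imp_continuous_on[OF f'(2)]] by blast
  have "\<bar>\<mu> s - \<mu> t\<bar> \<le> L * \<bar>s - t\<bar>" if "s \<in> {0..1}" "t \<in> {0..1}" for s t
    using field_differentiable_bound[of "{0..1}" \<mu> f' L s t] f'(1) L that by auto
  with G L show ?thesis by blast
qed

lemma finite_exceptions:
  fixes F :: "nat \<Rightarrow> 'i \<Rightarrow> real"
  assumes "\<And>n. finite (I n)" and le: "\<And>n i. n1 \<le> n \<Longrightarrow> i \<in> I n \<Longrightarrow> F n i \<le> C * r n"
    and pos: "\<And>n. 2 \<le> n \<Longrightarrow> 0 < r n"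
  shows "\<exists>C>0. \<forall>n\<ge>2. \<forall>i\<in>I n. F n i \<le> C * r n"
proof -
  \<comment> \<open>Sums of ratios instead of maxima: they dominate each ratio and need no separate
    treatment of empty index sets.\<close>
  define R where "R = (\<lambda>n. \<Sum>i\<in>I n. \<bar>F n i\<bar> / r n)"
  define C' where "C' = \<bar>C\<bar> + 1 + (\<Sum>n\<in>{2..<n1}. R n)"
  have R: "0 \<le> R n" if "2 \<le> n" for n
    unfolding R_def using pos[OF that] by (intro sum_nonneg) auto
  then have sumR: "0 \<le> (\<Sum>n\<in>{2..<n1}. R n)"
    by (intro sum_nonneg) auto
  have "F n i \<le> C' * r n" if n: "2 \<le> n" and i: "i \<in> I n" for n i
  proof (cases "n1 \<le> n")
    case True
    have "F n i \<le> C * r n" by (rule le[OF True i])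
    also have "\<dots> \<le> C' * r n"
      using pos[OF n] sumR by (intro mult_right_mono) (auto simp: C'_def)
    finally show ?thesis .
  next
    case False
    have "\<bar>F n i\<bar> / r n \<le> R n"
      unfolding R_def using assms(1) i pos[OF n] by (intro member_le_sum) auto
    also have "R n \<le> (\<Sum>n\<in>{2..<n1}. R n)"
      using False n R by (intro member_le_sum) auto
    also have "\<dots> \<le> C'"
      by (simp add: C'_def)
    finally have "\<bar>F n i\<bar> \<le> C' * r n"
      using pos[OF n] by (simp add: pos_divide_le_eq)
    then show ?thesis by linarith
  qed
  moreover have "0 < C'"
    using sumR by (simp add: C'_def)
  ultimately show ?thesis by blast
qed

text \<open>Since b \<ge> 3 > exp 1, the logarithm is at least 1 and its powers only enlarge the
  claimed rates; for the second rate the powers of b also increase.\<close>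

lemma rate_le:
  fixes \<tau> :: real and b n :: nat
  assumes "1 < \<tau>" "3 \<le> b" "0 < n"
  shows "(real b)\<^sup>2 / real n + real b powr (1 - \<tau>)
      \<le> ln (real b) powr (\<tau> - 1) * real b powr (- (\<tau> - 1)) + (real b)\<^sup>2 / real n"
    and "(real b)\<^sup>2 / real n + real b powr (1 - \<tau>)
      \<le> ln (real b) powr \<tau> * real b powr (- (\<tau> - 2)) + real b powr (5 / 2) / real n"
proof -
  have b: "3 \<le> real b" using assms(2) by simp
  have "exp 1 \<le> real b"
    using exp_le b by linarith
  then have ln: "1 \<le> ln (real b)"
    using b by (simp add: ln_ge_iff)
  have 1: "1 * real b powr (1 - \<tau>) \<le> ln (real b) powr (\<tau> - 1) * real b powr (- (\<tau> - 1))"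
    using ge_one_powr_ge_zero[OF ln, of "\<tau> - 1"] assms(1) by (intro mult_mono) auto
  then show "(real b)\<^sup>2 / real n + real b powr (1 - \<tau>)
      \<le> ln (real b) powr (\<tau> - 1) * real b powr (- (\<tau> - 1)) + (real b)\<^sup>2 / real n"
    by simp
  have "real b powr (1 - \<tau>) \<le> real b powr (- (\<tau> - 2))"
    using b by (intro powr_mono) auto
  then have 2: "1 * real b powr (1 - \<tau>) \<le> ln (real b) powr \<tau> * real b powr (- (\<tau> - 2))"
    using ge_one_powr_ge_zero[OF ln, of \<tau>] assms(1) by (intro mult_mono) auto
  have "(real b)\<^sup>2 = real b powr 2"
    using b by (simp add: powr_numeral)
  also have "\<dots> \<le> real b powr (5 / 2)"
    using b by (intro powr_mono) auto
  finally have "(real b)\<^sup>2 / real n \<le> real b powr (5 / 2) / real n"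
    by (rule divide_right_mono) simp
  with 2 show "(real b)\<^sup>2 / real n + real b powr (1 - \<tau>)
      \<le> ln (real b) powr \<tau> * real b powr (- (\<tau> - 2)) + real b powr (5 / 2) / real n"
    by simp
qed

lemma square_integrable_prediction_error:
  assumes M: "prob_space M" and X: "\<And>j. j \<in> {1..i} \<Longrightarrow> square_integrable M (X j)" and i: "1 \<le> i"
  shows "square_integrable M (prediction_error X i c)"
  unfolding prediction_error_def[abs_def] linear_prediction_def[abs_def]
  using i by (intro square_integrable_diff square_integrable_add square_integrable_const
      square_integrable_sum square_integrable_cmult X M) auto

lemma square_integrable_ar_process:
  assumes M: "prob_space M" and X: "\<And>j. j \<in> {1..n} \<Longrightarrow> square_integrable M (X j)"
    and \<epsilon>: "\<And>j. j \<in> {1..n} \<Longrightarrow> square_integrable M (\<epsilon> j)"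
  shows "i \<in> {1..n} \<Longrightarrow> square_integrable M (\<lambda>\<omega>. ar_process b c (\<lambda>i. \<epsilon> i \<omega>) (\<lambda>i. X i \<omega>) i)"
proof (induction i rule: less_induct)
  case (less i)
  show ?case
  proof (cases "i \<le> b")
    case True
    with X[OF less.prems] show ?thesis
      by (subst ar_process.simps) simp
  next
    case False
    then have "square_integrable M (\<lambda>\<omega>. c i 0 + (\<Sum>j=1..b. c i j * ar_process b c (\<lambda>i. \<epsilon> i \<omega>) (\<lambda>i. X i \<omega>) (i - j)) + \<epsilon> i \<omega>)"
      using less.prems by (intro square_integrable_add square_integrable_const square_integrable_sum
          square_integrable_cmult less.IH \<epsilon> M) auto
    with False show ?thesis
      by (subst ar_process.simps) simp
  qed
qed

text \<open>The order of choices matters: first N for the tail, then J depending on N, and then n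
  large for the term with 1 / n. The order \<open>b n\<close> enters only through
  \<open>N \<le> b n\<close>; if J exceeds it, the middle sum is empty.\<close>

lemma predictor_difference_eventually_le:
  fixes Q \<tau> \<eta> :: real and b :: "nat \<Rightarrow> nat"
  assumes \<tau>: "1 < \<tau>" and Q: "0 \<le> Q" and \<eta>: "0 < \<eta>" and b: "filterlim b at_top sequentially"
  shows "\<exists>N J. \<forall>\<^sub>F n in sequentially. N \<le> b n \<and>
    Q * (real N * ((real N + real J + 1) / real n + (\<Sum>j\<in>{J<..b n}. decay \<tau> j)) + suminf (decay_from \<tau> N)) \<le> \<eta>"
proof -
  define q where "q = Q + 1"
  have q: "0 < q" "Q \<le> q" using Q by (auto simp: q_def)
  obtain N where N: "suminf (decay_from \<tau> N) < \<eta> / (4 * q)"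
    using decay_from_eventually_small[OF \<tau>, of "\<eta> / (4 * q)"] \<eta> q by auto
  obtain J where J: "suminf (decay_from \<tau> J) < \<eta> / (4 * q * (real N + 1))"
    using decay_from_eventually_small[OF \<tau>, of "\<eta> / (4 * q * (real N + 1))"] \<eta> q
    by (auto simp: add_nonneg_pos)
  have "(\<lambda>n. real N * (real N + real J + 1) / real n) \<longlonglongrightarrow> 0"
    by (rule lim_const_over_n)
  then have ev: "\<forall>\<^sub>F n in sequentially. real N * (real N + real J + 1) / real n < \<eta> / (4 * q)"
    using \<eta> q by (intro order_tendstoD(2)) auto
  have bN: "\<forall>\<^sub>F n in sequentially. N \<le> b n"
    using b by (simp add: filterlim_at_top)
  show ?thesis
  proof (rule exI[of _ N], rule exI[of _ J])
    show "\<forall>\<^sub>F n in sequentially. N \<le> b n \<and>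
    Q * (real N * ((real N + real J + 1) / real n + (\<Sum>j\<in>{J<..b n}. decay \<tau> j)) + suminf (decay_from \<tau> N)) \<le> \<eta>"
      using ev bN
    proof eventually_elim
      case (elim n)
      have "(\<Sum>j\<in>{J<..b n}. decay \<tau> j) = (\<Sum>j\<in>{J<..b n}. decay_from \<tau> J j)"
        by (intro sum.cong) (auto simp: decay_from_def)
      also have "\<dots> \<le> suminf (decay_from \<tau> J)"
        by (rule sum_le_suminf[OF summable_decay_from[OF \<tau>]]) auto
      finally have s: "(\<Sum>j\<in>{J<..b n}. decay \<tau> j) \<le> \<eta> / (4 * q * (real N + 1))"
        using J by linarith
      have "real N * (\<Sum>j\<in>{J<..b n}. decay \<tau> j) \<le> (real N + 1) * (\<eta> / (4 * q * (real N + 1)))"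
        using s by (intro mult_mono) (auto intro: sum_nonneg)
      also have "\<dots> = \<eta> / (4 * q)"
      proof -
        have "a * (\<eta> / (4 * q * a)) = \<eta> / (4 * q)" if "a \<noteq> 0" for a
          using q that by (simp add: field_simps)
        then show ?thesis by (simp add: add_nonneg_eq_0_iff)
      qed
      finally have "real N * ((real N + real J + 1) / real n + (\<Sum>j\<in>{J<..b n}. decay \<tau> j)) + suminf (decay_from \<tau> N)
          \<le> \<eta> / (4 * q) + \<eta> / (4 * q) + \<eta> / (4 * q)"
        using elim(1) N by (simp add: distrib_left)
      then have "q * (real N * ((real N + real J + 1) / real n + (\<Sum>j\<in>{J<..b n}. decay \<tau> j)) + suminf (decay_from \<tau> N))
          \<le> q * (\<eta> / (4 * q) + \<eta> / (4 * q) + \<eta> / (4 * q))"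
        using q by (intro mult_left_mono) auto
      also have "\<dots> \<le> \<eta>"
        using q \<eta> by (simp add: field_simps)
      finally have "q * (real N * ((real N + real J + 1) / real n + (\<Sum>j\<in>{J<..b n}. decay \<tau> j)) + suminf (decay_from \<tau> N)) \<le> \<eta>" .
      moreover have "0 \<le> real N * ((real N + real J + 1) / real n + (\<Sum>j\<in>{J<..b n}. decay \<tau> j)) + suminf (decay_from \<tau> N)"
        by (intro add_nonneg_nonneg mult_nonneg_nonneg sum_nonneg suminf_decay_from_nonneg \<tau>) auto
      ultimately show ?case
        using elim(2) q(2) mult_right_mono[OF q(2)] by (meson order_trans)
    qed
  qed
qed

text \<open>The choice N = J = b: the middle sum is empty, 2 b + 1 \<le> 3 b gives the factor 3, and
  the tail contributes 1 / (\<tau> - 1).\<close>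

lemma predictor_difference_rate:
  fixes \<tau> :: real and b n :: nat
  assumes \<tau>: "1 < \<tau>" and b: "1 \<le> b" and n: "0 < n"
  shows "real b * ((real b + real b + 1) / real n + (\<Sum>j\<in>{b<..b}. decay \<tau> j)) + suminf (decay_from \<tau> b)
    \<le> (3 + 1 / (\<tau> - 1)) * ((real b)\<^sup>2 / real n + real b powr (1 - \<tau>))"
proof -
  have "real b * ((real b + real b + 1) / real n) \<le> real b * ((3 * real b) / real n)"
    using b by (intro mult_left_mono divide_right_mono) auto
  then have 1: "real b * ((real b + real b + 1) / real n) \<le> 3 * ((real b)\<^sup>2 / real n)"
    by (simp add: power2_eq_square)
  have "(1 + real b) powr (1 - \<tau>) \<le> real b powr (1 - \<tau>)"
    using b \<tau> by (intro powr_mono2') auto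
  then have "(1 + real b) powr (1 - \<tau>) / (\<tau> - 1) \<le> real b powr (1 - \<tau>) / (\<tau> - 1)"
    using \<tau> by (intro divide_right_mono) auto
  with suminf_decay_from_le[OF \<tau>, of b]
  have 2: "suminf (decay_from \<tau> b) \<le> 1 / (\<tau> - 1) * real b powr (1 - \<tau>)"
    by simp
  have "0 \<le> 1 / (\<tau> - 1) * ((real b)\<^sup>2 / real n)" "0 \<le> 3 * real b powr (1 - \<tau>)"
    using \<tau> by auto
  moreover have "real b * ((real b + real b + 1) / real n + (\<Sum>j\<in>{b<..b}. decay \<tau> j))
      = real b * ((real b + real b + 1) / real n)"
    by simp
  ultimately show ?thesis
    using 1 2 unfolding distrib_right[of 3] distrib_left[of 3] distrib_left[of "1 / (\<tau> - 1)"] by linarith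
qed

text \<open>The sum-norm difference \<open>V\<close> of the coefficients drives all four estimates.
  It gives the intercept error through bounded means, the one-step error through bounded second
  moments, and the error of the recursion through its stability.\<close>

lemma asymptotic_estimates:
  fixes b :: "nat \<Rightarrow> nat" and \<phi> :: "nat \<Rightarrow> nat \<Rightarrow> nat \<Rightarrow> real"
  assumes soa: "second_order_array M x"
    and ls: "locally_stationary M x \<gamma>" and updc: "UPDC M x"
    and \<tau>: "1 < \<tau>" and srd: "short_range_dependent M x \<tau>"
    and d: "0 < d" and smooth: "smooth_of_order d M x \<gamma> \<mu>"
    and b: "\<forall>n\<ge>2. 0 < b n \<and> b n < n" and b_lim: "filterlim b at_top sequentially"
    and best: "\<forall>n. \<forall>i\<in>{1..n}. best_linear_prediction (M n) (x n) i (\<phi> n i)"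
  defines "\<rho> \<equiv> \<lambda>n. (real (b n))\<^sup>2 / real n + real (b n) powr (1 - \<tau>)"
  shows "\<exists>C\<ge>0. \<exists>n1. \<forall>n\<ge>n1.
    (\<forall>i\<in>{b n<..n}. (\<Sum>j=1..i - 1. \<bar>\<phi> n i j - (if j \<le> b n then coef_fun \<gamma> \<mu> (b n) j (real i / real n) else 0)\<bar>) \<le> C * \<rho> n \<and>
      \<bar>\<phi> n i 0 - coef_fun \<gamma> \<mu> (b n) 0 (real i / real n)\<bar> \<le> C * \<rho> n \<and>
      l2norm (M n) (\<lambda>\<omega>. x n i \<omega> - (coef_fun \<gamma> \<mu> (b n) 0 (real i / real n)
        + (\<Sum>j=1..b n. coef_fun \<gamma> \<mu> (b n) j (real i / real n) * x n (i - j) \<omega>)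
        + prediction_error (x n) i (\<phi> n i) \<omega>)) \<le> C * \<rho> n) \<and>
    (\<forall>i\<in>{1..n}. l2norm (M n) (\<lambda>\<omega>. x n i \<omega> - ar_process (b n) (\<lambda>i j. coef_fun \<gamma> \<mu> (b n) j (real i / real n))
        (\<lambda>i. prediction_error (x n) i (\<phi> n i) \<omega>) (\<lambda>i. x n i \<omega>) i) \<le> C * \<rho> n)"
proof -
  obtain P Q B n0 where P: "0 \<le> P" and Q: "0 \<le> Q" and B: "0 \<le> B"
    and coef: "\<forall>t\<in>{0..1}. \<forall>b. \<forall>j\<in>{1..b}. \<bar>coef_fun \<gamma> \<mu> b j t\<bar> \<le> P * decay \<tau> j"
    and diff: "\<forall>n\<ge>n0. \<forall>i\<in>{1..n}. \<forall>f. best_linear_prediction (M n) (x n) i f \<longrightarrow> (\<forall>b<i. \<forall>N\<le>b. \<forall>J.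
       (\<Sum>j=1..i - 1. \<bar>f j - (if j \<le> b then coef_fun \<gamma> \<mu> b j (real i / real n) else 0)\<bar>)
       \<le> Q * (real N * ((real N + real J + 1) / real n + (\<Sum>j\<in>{J<..b}. decay \<tau> j)) + suminf (decay_from \<tau> N)))"
    and stable: "\<forall>n\<ge>n0. \<forall>f. (\<forall>i\<in>{1..n}. best_linear_prediction (M n) (x n) i (f i)) \<longrightarrow>
       (\<exists>H. (\<forall>i\<in>{1..n}. (\<Sum>k=1..n. \<bar>H i k\<bar>) \<le> B) \<and>
        (\<forall>e. \<forall>i\<in>{1..n}. e i = (\<Sum>k=1..n. H i k * (e k - (\<Sum>j=1..k - 1. f k j * e (k - j))))))"
    by (rule predictor_estimates[OF soa ls updc \<tau> srd, of \<mu>])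
  obtain K where K: "0 \<le> K" "\<forall>n. \<forall>i\<in>{1..n}. \<forall>j\<in>{1..n}. \<bar>covariance (M n) (x n i) (x n j)\<bar> \<le> K * decay \<tau> (lag i j)"
    using covariance_decay[OF ls srd \<tau>] by (elim exE conjE) (rule that)
  have \<mu>: "continuously_differentiable_on d {0..1} \<mu>"
    and mean: "\<And>n i. i \<in> {1..n} \<Longrightarrow> (LINT \<omega>|M n. x n i \<omega>) = \<mu> (real i / real n)"
    using smooth unfolding smooth_of_order_def by blast+
  obtain G L where G: "0 \<le> G" "\<forall>t\<in>{0..1}. \<bar>\<mu> t\<bar> \<le> G"
    and L: "0 \<le> L" "\<forall>s\<in>{0..1}. \<forall>t\<in>{0..1}. \<bar>\<mu> s - \<mu> t\<bar> \<le> L * \<bar>s - t\<bar>"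
    using continuously_differentiable_on_bounded_lipschitz[OF \<mu> d] by blast
  define Z where "Z = suminf (decay \<tau>)"
  have Z: "1 \<le> Z" using suminf_decay_ge_1[OF \<tau>] by (simp add: Z_def)
  \<comment> \<open>The coefficient perturbation that the recursion tolerates: B \<eta> \<le> 1 / 2,
    and B + 1 avoids division by 0.\<close>
  define \<eta> where "\<eta> = 1 / (2 * (B + 1))"
  have \<eta>: "0 < \<eta>" "B * \<eta> \<le> 1 / 2"
    using B by (auto simp: \<eta>_def field_simps)
  obtain N J where "\<forall>\<^sub>F n in sequentially. N \<le> b n \<and>
    Q * (real N * ((real N + real J + 1) / real n + (\<Sum>j\<in>{J<..b n}. decay \<tau> j)) + suminf (decay_from \<tau> N)) \<le> \<eta>"
    using predictor_difference_eventually_le[OF \<tau> Q \<eta>(1) b_lim] by blast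
  then obtain n2 where n2: "\<And>n. n2 \<le> n \<Longrightarrow> N \<le> b n \<and>
    Q * (real N * ((real N + real J + 1) / real n + (\<Sum>j\<in>{J<..b n}. decay \<tau> j)) + suminf (decay_from \<tau> N)) \<le> \<eta>"
    unfolding eventually_sequentially by blast
  \<comment> \<open>A uniform bound for the mean-square norm of the observations: variances are at
    most K and means at most G in absolute value.\<close>
  define W where "W = sqrt (K + G\<^sup>2)"
  define C1 where "C1 = Q * (3 + 1 / (\<tau> - 1))"
  define C2 where "C2 = C1 * G + P * Z * L"
  define C3 where "C3 = C2 + C1 * W"
  define C4 where "C4 = 2 * B * C3"
  define C where "C = C1 + C2 + C3 + C4"
  have W: "0 \<le> W" using K by (simp add: W_def)
  have C1: "0 \<le> C1" using Q \<tau> by (simp add: C1_def)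
  have C2: "0 \<le> C2" using C1 G P Z L by (simp add: C2_def)
  have C3: "0 \<le> C3" using C1 C2 W by (simp add: C3_def)
  have C4: "0 \<le> C4" using C3 B by (simp add: C4_def)
  have C: "0 \<le> C" "C1 \<le> C" "C2 \<le> C" "C3 \<le> C" "C4 \<le> C"
    using C1 C2 C3 C4 by (auto simp: C_def)
  show ?thesis
  proof (intro exI[of _ C] conjI C(1) exI[of _ "max 2 (max n0 n2)"] allI impI)
    fix n assume "max 2 (max n0 n2) \<le> n"
    then have n: "2 \<le> n" "n0 \<le> n" "n2 \<le> n" by auto
    have bn: "1 \<le> b n" "b n < n"
      using b n(1) by auto
    have M: "prob_space (M n)" and sq: "\<And>i. i \<in> {1..n} \<Longrightarrow> square_integrable (M n) (x n i)"
      using soa n(1) unfolding second_order_array_def by auto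
    have \<rho>: "0 \<le> \<rho> n" by (simp add: \<rho>_def)
    \<comment> \<open>Increments of the mean over at most b steps have order b / n, which is below
      b^2 / n because b \<ge> 1.\<close>
    have b\<rho>: "real (b n) / real n \<le> \<rho> n"
    proof -
      have "real (b n) * 1 \<le> real (b n) * real (b n)"
        using bn by (intro mult_left_mono) auto
      then have "real (b n) / real n \<le> (real (b n))\<^sup>2 / real n"
        by (intro divide_right_mono) (auto simp: power2_eq_square)
      then show ?thesis
        by (simp add: \<rho>_def add_increasing2)
    qed
    define c where "c = (\<lambda>i j. coef_fun \<gamma> \<mu> (b n) j (real i / real n))"
    define V where "V = (\<lambda>i. \<Sum>j=1..i - 1. \<bar>\<phi> n i j - (if j \<le> b n then c i j else 0)\<bar>)"
    define \<epsilon> where "\<epsilon> = (\<lambda>i. prediction_error (x n) i (\<phi> n i))"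
    define \<delta> where "\<delta> = (\<lambda>i \<omega>. x n i \<omega> - (c i 0 + (\<Sum>j=1..b n. c i j * x n (i - j) \<omega>) + \<epsilon> i \<omega>))"
    define y where "y = (\<lambda>i \<omega>. ar_process (b n) c (\<lambda>i. \<epsilon> i \<omega>) (\<lambda>i. x n i \<omega>) i)"
    have best_n: "best_linear_prediction (M n) (x n) i (\<phi> n i)" if "i \<in> {1..n}" for i
      using best that by blast
    have V0: "0 \<le> V i" for i
      by (simp add: V_def sum_nonneg)
    \<comment> \<open>The same estimate with two choices of cutoffs: both equal to
      \<open>b n\<close> for the rate, and the fixed N and J for the smallness threshold.\<close>
    have V\<rho>: "V i \<le> C1 * \<rho> n" and V\<eta>: "V i \<le> \<eta>" if i: "i \<in> {b n<..n}" for i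
    proof -
      have i': "i \<in> {1..n}" "b n < i" using i by auto
      have "V i \<le> Q * (real (b n) * ((real (b n) + real (b n) + 1) / real n + (\<Sum>j\<in>{b n<..b n}. decay \<tau> j))
          + suminf (decay_from \<tau> (b n)))"
        unfolding V_def c_def using diff n(2) i' best_n[OF i'(1)] by blast
      also have "\<dots> \<le> Q * ((3 + 1 / (\<tau> - 1)) * \<rho> n)"
        unfolding \<rho>_def using n bn Q by (intro mult_left_mono predictor_difference_rate \<tau>) auto
      finally show "V i \<le> C1 * \<rho> n"
        by (simp add: C1_def mult.assoc)
      have "V i \<le> Q * (real N * ((real N + real J + 1) / real n + (\<Sum>j\<in>{J<..b n}. decay \<tau> j))
          + suminf (decay_from \<tau> N))"
        unfolding V_def c_def using diff n(2) i' best_n[OF i'(1)] n2[OF n(3)] by blast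
      also have "\<dots> \<le> \<eta>"
        using n2[OF n(3)] by blast
      finally show "V i \<le> \<eta>" .
    qed
    have unit: "real i / real n \<in> {0..1}" if "i \<in> {1..n}" for i
      using that by (auto simp: divide_le_eq)
    have intercept: "\<bar>\<phi> n i 0 - c i 0\<bar> \<le> C2 * \<rho> n" if i: "i \<in> {b n<..n}" for i
    proof -
      have i': "i \<in> {1..n}" "b n < i" using i by auto
      define m where "m = (\<lambda>l. \<mu> (real l / real n))"
      have ij: "i - j \<in> {1..n}" if "j \<in> {1..i - 1}" for j
        using that i' by auto
      have "\<bar>\<phi> n i 0 - c i 0\<bar> \<le> V i * G + (\<Sum>j=1..b n. \<bar>c i j\<bar>) * (L * (real (b n) / real n))"
        unfolding V_def
      proof (rule intercept_difference_le[OF i'(2), where m = m])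
        have "(LINT \<omega>|M n. x n i \<omega>) = \<phi> n i 0 + (\<Sum>j=1..i - 1. \<phi> n i j * (LINT \<omega>|M n. x n (i - j) \<omega>))"
          using i' sq by (intro best_linear_prediction_normal_equations(1)[OF M _ best_n[OF i'(1)]]) auto
        also have "(\<Sum>j=1..i - 1. \<phi> n i j * (LINT \<omega>|M n. x n (i - j) \<omega>)) = (\<Sum>j=1..i - 1. \<phi> n i j * m (i - j))"
          by (intro sum.cong refl) (simp only: mean[OF ij] m_def)
        finally show "m i = \<phi> n i 0 + (\<Sum>j=1..i - 1. \<phi> n i j * m (i - j))"
          unfolding mean[OF i'(1)] m_def .
        show "c i 0 = m i - (\<Sum>j=1..b n. c i j * m i)"
          by (simp add: c_def m_def coef_fun_def)
        show "\<bar>m (i - j)\<bar> \<le> G" if "j \<in> {1..i - 1}" for j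
          unfolding m_def using G(2) unit[OF ij[OF that]] by blast
        fix j assume j: "j \<in> {1..b n}"
        have "\<bar>m i - m (i - j)\<bar> \<le> L * \<bar>real i / real n - real (i - j) / real n\<bar>"
          unfolding m_def using L(2) unit[OF i'(1)] unit[OF ij] i' j by auto
        also have "\<bar>real i / real n - real (i - j) / real n\<bar> = real j / real n"
          using j i' by (simp add: diff_divide_distrib[symmetric] of_nat_diff)
        also have "L * (real j / real n) \<le> L * (real (b n) / real n)"
          using j L(1) by (intro mult_left_mono divide_right_mono) auto
        finally show "\<bar>m i - m (i - j)\<bar> \<le> L * (real (b n) / real n)" .
      qed
      also have "\<dots> \<le> (C1 * \<rho> n) * G + (P * Z) * (L * \<rho> n)"
      proof (intro add_mono mult_mono V\<rho>[OF i] mult_left_mono b\<rho> L(1) G(1) order_refl)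
        have "(\<Sum>j=1..b n. \<bar>c i j\<bar>) \<le> (\<Sum>j=1..b n. P * decay \<tau> j)"
          unfolding c_def using coef unit[OF i'(1)] by (intro sum_mono) blast
        also have "\<dots> \<le> P * Z"
          unfolding sum_distrib_left[symmetric] Z_def using P by (intro mult_left_mono sum_decay_le \<tau>) auto
        finally show "(\<Sum>j=1..b n. \<bar>c i j\<bar>) \<le> P * Z" .
      qed (use C1 \<rho> P Z L in auto)
      also have "\<dots> = C2 * \<rho> n"
        by (simp add: C2_def algebra_simps)
      finally show ?thesis .
    qed
    have moment: "l2norm (M n) (x n l) \<le> W" if l: "l \<in> {1..n}" for l
    proof -
      have "(LINT \<omega>|M n. x n l \<omega> * x n l \<omega>) = covariance (M n) (x n l) (x n l) + (\<mu> (real l / real n))\<^sup>2"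
        using covariance_eq[OF M sq[OF l] sq[OF l]] mean[OF l] by (simp add: power2_eq_square)
      also have "covariance (M n) (x n l) (x n l) \<le> K"
        using K(2)[THEN spec, THEN bspec, OF l, THEN bspec, OF l] by simp
      also have "(\<mu> (real l / real n))\<^sup>2 \<le> G\<^sup>2"
        using G unit[OF l] by (intro abs_le_square_iff[THEN iffD1]) auto
      finally show ?thesis
        unfolding l2norm_def W_def by (intro real_sqrt_le_mono) (simp add: power2_eq_square)
    qed
    have \<delta>_eq: "\<delta> i = (\<lambda>\<omega>. (\<phi> n i 0 - c i 0)
        + (\<Sum>j=1..i - 1. (\<phi> n i j - (if j \<le> b n then c i j else 0)) * x n (i - j) \<omega>))"
      if "i \<in> {b n<..n}" for i
    proof
      fix \<omega>
      show "\<delta> i \<omega> = (\<phi> n i 0 - c i 0)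
        + (\<Sum>j=1..i - 1. (\<phi> n i j - (if j \<le> b n then c i j else 0)) * x n (i - j) \<omega>)"
        unfolding \<delta>_def \<epsilon>_def using that by (intro linear_prediction_difference) simp
    qed
    have \<delta>_sq: "square_integrable (M n) (\<delta> i)" and \<delta>: "l2norm (M n) (\<delta> i) \<le> C3 * \<rho> n"
      if i: "i \<in> {b n<..n}" for i
    proof -
      let ?S = "\<lambda>\<omega>. \<Sum>j=1..i - 1. (\<phi> n i j - (if j \<le> b n then c i j else 0)) * x n (i - j) \<omega>"
      have sq': "square_integrable (M n) (x n (i - j))" and mo: "l2norm (M n) (x n (i - j)) \<le> W"
        if "j \<in> {1..i - 1}" for j
      proof -
        have "i - j \<in> {1..n}" using that i by auto
        then show "square_integrable (M n) (x n (i - j))" "l2norm (M n) (x n (i - j)) \<le> W"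
          by (rule sq, rule moment)
      qed
      have S: "square_integrable (M n) ?S"
        by (intro square_integrable_sum square_integrable_cmult sq' M)
      show "square_integrable (M n) (\<delta> i)"
        unfolding \<delta>_eq[OF i] by (intro square_integrable_add square_integrable_const M S)
      have "l2norm (M n) (\<delta> i) \<le> l2norm (M n) (\<lambda>_. \<phi> n i 0 - c i 0) + l2norm (M n) ?S"
        unfolding \<delta>_eq[OF i] by (intro l2norm_triangle square_integrable_const M S)
      also have "l2norm (M n) (\<lambda>_. \<phi> n i 0 - c i 0) = \<bar>\<phi> n i 0 - c i 0\<bar>"
        by (simp add: l2norm_def prob_space.prob_space[OF M])
      also have "l2norm (M n) ?S \<le> V i * W"
        unfolding V_def by (rule l2norm_sum_le_uniform[OF M sq' mo])
      also have "\<bar>\<phi> n i 0 - c i 0\<bar> + V i * W \<le> C2 * \<rho> n + (C1 * \<rho> n) * W"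
        by (intro add_mono intercept[OF i] mult_right_mono V\<rho>[OF i] W)
      also have "\<dots> = C3 * \<rho> n"
        by (simp add: C3_def algebra_simps)
      finally show "l2norm (M n) (\<delta> i) \<le> C3 * \<rho> n" by simp
    qed
    obtain H where H: "\<forall>i\<in>{1..n}. (\<Sum>k=1..n. \<bar>H i k\<bar>) \<le> B"
      and inv: "\<forall>e. \<forall>i\<in>{1..n}. e i = (\<Sum>k=1..n. H i k * (e k - (\<Sum>j=1..k - 1. \<phi> n k j * e (k - j))))"
      using stable[THEN spec, THEN mp, OF n(2), THEN spec, of "\<phi> n"] best_n by blast
    have ar: "l2norm (M n) (\<lambda>\<omega>. x n i \<omega> - y i \<omega>) \<le> C4 * \<rho> n" if i: "i \<in> {1..n}" for i
    proof -
      have "l2norm (M n) (\<lambda>\<omega>. x n i \<omega> - y i \<omega>) \<le> 2 * B * (C3 * \<rho> n)"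
      proof (rule ar_error_le[where e = "\<lambda>i \<omega>. x n i \<omega> - y i \<omega>" and \<delta> = \<delta> and f = "\<phi> n" and c = c
            and H = H and b = "b n" and \<eta> = \<eta> and n = n, OF M])
        fix k assume "k \<in> {1..n}"
        with H show "(\<Sum>l=1..n. \<bar>H k l\<bar>) \<le> B" by blast
      next
        fix e :: "nat \<Rightarrow> real" and k assume "k \<in> {1..n}"
        with inv show "e k = (\<Sum>l=1..n. H k l * (e l - (\<Sum>j=1..l - 1. \<phi> n l j * e (l - j))))"
          by blast
      next
        fix k \<omega> assume "k \<le> b n"
        then show "x n k \<omega> - y k \<omega> = 0"
          by (simp add: y_def ar_process.simps)
      next
        fix k \<omega> assume k: "k \<in> {b n<..n}"
        then have "y k \<omega> = c k 0 + (\<Sum>j=1..b n. c k j * y (k - j) \<omega>) + \<epsilon> k \<omega>"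
          unfolding y_def by (subst ar_process.simps) simp
        then show "x n k \<omega> - y k \<omega> = \<delta> k \<omega> + (\<Sum>j=1..b n. c k j * (x n (k - j) \<omega> - y (k - j) \<omega>))"
          by (simp add: \<delta>_def right_diff_distrib sum_subtractf del: One_nat_def)
      qed (use \<delta>_sq \<delta> V\<eta> B C3 \<rho> \<eta> i in \<open>auto simp: V_def\<close>)
      then show ?thesis
        by (simp add: C4_def mult.assoc)
    qed
    have up: "C1 * \<rho> n \<le> C * \<rho> n" "C2 * \<rho> n \<le> C * \<rho> n" "C3 * \<rho> n \<le> C * \<rho> n" "C4 * \<rho> n \<le> C * \<rho> n"
      using C \<rho> by (auto intro: mult_right_mono)
    show "\<forall>i\<in>{b n<..n}. (\<Sum>j=1..i - 1. \<bar>\<phi> n i j - (if j \<le> b n then coef_fun \<gamma> \<mu> (b n) j (real i / real n) else 0)\<bar>) \<le> C * \<rho> n \<and>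
      \<bar>\<phi> n i 0 - coef_fun \<gamma> \<mu> (b n) 0 (real i / real n)\<bar> \<le> C * \<rho> n \<and>
      l2norm (M n) (\<lambda>\<omega>. x n i \<omega> - (coef_fun \<gamma> \<mu> (b n) 0 (real i / real n)
        + (\<Sum>j=1..b n. coef_fun \<gamma> \<mu> (b n) j (real i / real n) * x n (i - j) \<omega>)
        + prediction_error (x n) i (\<phi> n i) \<omega>)) \<le> C * \<rho> n"
      using order_trans[OF V\<rho> up(1)] order_trans[OF intercept up(2)] order_trans[OF \<delta> up(3)]
      unfolding V_def c_def \<delta>_def \<epsilon>_def by blast
    show "\<forall>i\<in>{1..n}. l2norm (M n) (\<lambda>\<omega>. x n i \<omega> - ar_process (b n) (\<lambda>i j. coef_fun \<gamma> \<mu> (b n) j (real i / real n))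
        (\<lambda>i. prediction_error (x n) i (\<phi> n i) \<omega>) (\<lambda>i. x n i \<omega>) i) \<le> C * \<rho> n"
      using order_trans[OF ar up(4)] unfolding y_def c_def \<epsilon>_def by blast
  qed
qed

theorem theorem2p11:
  fixes M :: "nat \<Rightarrow> 'w measure"
    and x :: "nat \<Rightarrow> nat \<Rightarrow> 'w \<Rightarrow> real"
    and \<gamma> :: "real \<Rightarrow> nat \<Rightarrow> real"
    and \<mu> :: "real \<Rightarrow> real"
    and \<tau> :: real
    and d :: nat
    and b :: "nat \<Rightarrow> nat"
    and \<phi> :: "nat \<Rightarrow> nat \<Rightarrow> nat \<Rightarrow> real"
    and \<phi>fun :: "nat \<Rightarrow> nat \<Rightarrow> real \<Rightarrow> real"
    and \<epsilon> xss :: "nat \<Rightarrow> nat \<Rightarrow> 'w \<Rightarrow> real"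
    and rate1 rate2 :: "nat \<Rightarrow> real"
  assumes "second_order_array M x"
    and "locally_stationary M x \<gamma>"
    and "UPDC M x"
    and "\<tau> > 1" and "short_range_dependent M x \<tau>"
    and "d > 0" and "smooth_of_order d M x \<gamma> \<mu>"
    and "\<And>n. n \<ge> 2 \<Longrightarrow> 0 < b n \<and> b n < n"
    and "filterlim b at_top sequentially"
    and "\<And>n i. 1 \<le> i \<Longrightarrow> i \<le> n \<Longrightarrow> best_linear_prediction (M n) (x n) i (\<phi> n i)"
  defines "\<phi>fun \<equiv> \<lambda>n. coef_fun \<gamma> \<mu> (b n)"
    and "\<epsilon> \<equiv> \<lambda>n i. prediction_error (x n) i (\<phi> n i)"
    and "xss \<equiv> \<lambda>n i \<omega>. ar_process (b n) (\<lambda>i j. \<phi>fun n j (real i / real n))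
                          (\<lambda>i. \<epsilon> n i \<omega>) (\<lambda>i. x n i \<omega>) i"
    and "rate1 \<equiv> \<lambda>n. ln (real (b n)) powr (\<tau> - 1) * real (b n) powr (- (\<tau> - 1))
                       + (real (b n))\<^sup>2 / real n"
    and "rate2 \<equiv> \<lambda>n. ln (real (b n)) powr \<tau> * real (b n) powr (- (\<tau> - 2))
                       + real (b n) powr (5 / 2) / real n"
  shows "(\<forall>n\<ge>2. \<forall>j\<le>b n. continuously_differentiable_on d {0..1} (\<phi>fun n j)) \<and>
    (\<exists>C>0. \<forall>n\<ge>2.
       (MAX i\<in>{b n<..n}.
          L2_set (\<lambda>j. \<phi> n i j - (if j \<le> b n then \<phi>fun n j (real i / real n) else 0)) {1..i - 1})
         \<le> C * rate1 n \<and>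
       (MAX i\<in>{b n<..n}. \<bar>\<phi> n i 0 - \<phi>fun n 0 (real i / real n)\<bar>) \<le> C * rate2 n) \<and>
    bigO_l2 M 2 (\<lambda>n. {b n<..n})
      (\<lambda>n i \<omega>. x n i \<omega> - (\<phi>fun n 0 (real i / real n)
          + (\<Sum>j=1..b n. \<phi>fun n j (real i / real n) * x n (i - j) \<omega>) + \<epsilon> n i \<omega>))
      rate2 \<and>
    bigO_l2 M 2 (\<lambda>n. {1..n}) (\<lambda>n i \<omega>. x n i \<omega> - xss n i \<omega>) rate2"
proof -
  note soa = assms(1) and ls = assms(2) and \<tau> = assms(4) and smooth = assms(7)
  have b: "1 \<le> b n" "b n < n" if "2 \<le> n" for n
    using assms(8)[OF that] by auto
  have M: "prob_space (M n)" and sq: "\<And>i. i \<in> {1..n} \<Longrightarrow> square_integrable (M n) (x n i)"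
    if "2 \<le> n" for n
    using soa that unfolding second_order_array_def by auto
  obtain \<kappa> where \<kappa>: "0 < \<kappa>"
    and ev: "\<forall>\<^sub>F n in sequentially. coercive \<kappa> {1..n} (\<lambda>i j. covariance (M n) (x n i) (x n j))"
    using UPDC_coercive[OF assms(3)] by blast
  have \<mu>: "continuously_differentiable_on d {0..1} \<mu>"
    and \<gamma>: "\<And>j. continuously_differentiable_on d {0..1} (\<lambda>t. \<gamma> t j)"
    using smooth unfolding smooth_of_order_def by blast+
  have regular: "\<forall>n\<ge>2. \<forall>j\<le>b n. continuously_differentiable_on d {0..1} (\<phi>fun n j)"
    unfolding \<phi>fun_def
    using continuously_differentiable_on_coef_fun[where \<kappa> = \<kappa>, OF autocovariance_coercive[OF ls _ ev] \<kappa> \<gamma> \<mu>]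
    by blast
  define \<rho> where "\<rho> = (\<lambda>n. (real (b n))\<^sup>2 / real n + real (b n) powr (1 - \<tau>))"
  define dev where "dev = (\<lambda>n i. L2_set (\<lambda>j. \<phi> n i j - (if j \<le> b n then \<phi>fun n j (real i / real n) else 0)) {1..i - 1})"
  define res where "res = (\<lambda>n i \<omega>. x n i \<omega> - (\<phi>fun n 0 (real i / real n)
          + (\<Sum>j=1..b n. \<phi>fun n j (real i / real n) * x n (i - j) \<omega>) + \<epsilon> n i \<omega>))"
  have b': "\<forall>n\<ge>2. 0 < b n \<and> b n < n"
    and best': "\<forall>n. \<forall>i\<in>{1..n}. best_linear_prediction (M n) (x n) i (\<phi> n i)"
    using assms(8,10) by auto
  have "\<exists>C\<ge>0. \<exists>n1. \<forall>n\<ge>n1.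
    (\<forall>i\<in>{b n<..n}. (\<Sum>j=1..i - 1. \<bar>\<phi> n i j - (if j \<le> b n then \<phi>fun n j (real i / real n) else 0)\<bar>) \<le> C * \<rho> n \<and>
      \<bar>\<phi> n i 0 - \<phi>fun n 0 (real i / real n)\<bar> \<le> C * \<rho> n \<and> l2norm (M n) (res n i) \<le> C * \<rho> n) \<and>
    (\<forall>i\<in>{1..n}. l2norm (M n) (\<lambda>\<omega>. x n i \<omega> - xss n i \<omega>) \<le> C * \<rho> n)"
    unfolding \<rho>_def res_def \<phi>fun_def \<epsilon>_def xss_def
    by (rule asymptotic_estimates[OF assms(1-7) b' assms(9) best'])
  then obtain C n1 where C: "0 \<le> C" and est: "\<forall>n\<ge>n1.
    (\<forall>i\<in>{b n<..n}. (\<Sum>j=1..i - 1. \<bar>\<phi> n i j - (if j \<le> b n then \<phi>fun n j (real i / real n) else 0)\<bar>) \<le> C * \<rho> n \<and>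
      \<bar>\<phi> n i 0 - \<phi>fun n 0 (real i / real n)\<bar> \<le> C * \<rho> n \<and> l2norm (M n) (res n i) \<le> C * \<rho> n) \<and>
    (\<forall>i\<in>{1..n}. l2norm (M n) (\<lambda>\<omega>. x n i \<omega> - xss n i \<omega>) \<le> C * \<rho> n)"
    by (elim exE conjE) (rule that)
  have "\<forall>\<^sub>F n in sequentially. 3 \<le> b n"
    using assms(9) by (simp add: filterlim_at_top)
  then obtain n2 where n2: "\<And>n. n2 \<le> n \<Longrightarrow> 3 \<le> b n"
    unfolding eventually_sequentially by blast
  define n0 where "n0 = max 2 (max n1 n2)"
  have \<rho>_le: "C * \<rho> n \<le> C * rate1 n" "C * \<rho> n \<le> C * rate2 n" if "n0 \<le> n" for n
    using rate_le[OF \<tau> n2, of n n] that C unfolding \<rho>_def rate1_def rate2_def n0_def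
    by (auto intro!: mult_left_mono)
  \<comment> \<open>For \<open>b n = 1\<close> the logarithmic term is 0, since
    \<open>0 powr _ = 0\<close>; positivity comes from the term with 1 / n.\<close>
  have pos: "0 < rate1 n" "0 < rate2 n" if "2 \<le> n" for n
    using b[OF that] that unfolding rate1_def rate2_def by (auto intro!: add_nonneg_pos)
  have dev: "dev n i \<le> C * rate1 n" and int: "\<bar>\<phi> n i 0 - \<phi>fun n 0 (real i / real n)\<bar> \<le> C * rate2 n"
    and res: "l2norm (M n) (res n i) \<le> C * rate2 n" if "n0 \<le> n" "i \<in> {b n<..n}" for n i
  proof -
    have "n1 \<le> n" using that by (simp add: n0_def)
    note e = est[THEN spec, THEN mp, OF this, THEN conjunct1, THEN bspec, OF that(2)]
    show "dev n i \<le> C * rate1 n"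
      unfolding dev_def
      \<comment> \<open>The Euclidean norm is at most the sum norm, in which the estimate was
        obtained.\<close>
      by (rule order_trans[OF L2_set_le_sum_abs order_trans[OF conjunct1[OF e] \<rho>_le(1)[OF that(1)]]])
    show "\<bar>\<phi> n i 0 - \<phi>fun n 0 (real i / real n)\<bar> \<le> C * rate2 n"
      by (rule order_trans[OF conjunct1[OF conjunct2[OF e]] \<rho>_le(2)[OF that(1)]])
    show "l2norm (M n) (res n i) \<le> C * rate2 n"
      by (rule order_trans[OF conjunct2[OF conjunct2[OF e]] \<rho>_le(2)[OF that(1)]])
  qed
  have ar: "l2norm (M n) (\<lambda>\<omega>. x n i \<omega> - xss n i \<omega>) \<le> C * rate2 n" if "n0 \<le> n" "i \<in> {1..n}" for n i
  proof -
    have "n1 \<le> n" using that by (simp add: n0_def)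
    from est[THEN spec, THEN mp, OF this, THEN conjunct2, THEN bspec, OF that(2)] \<rho>_le(2)[OF that(1)]
    show ?thesis by (rule order_trans)
  qed
  have "\<exists>C>0. \<forall>n\<ge>2. \<forall>i\<in>{b n<..n}. dev n i \<le> C * rate1 n"
    by (rule finite_exceptions[of "\<lambda>n. {b n<..n}" n0 "dev" C rate1], simp)
      (blast intro: dev pos(1))+
  then obtain C1 where C1: "0 < C1" "\<forall>n\<ge>2. \<forall>i\<in>{b n<..n}. dev n i \<le> C1 * rate1 n"
    by blast
  have "\<exists>C>0. \<forall>n\<ge>2. \<forall>i\<in>{b n<..n}. \<bar>\<phi> n i 0 - \<phi>fun n 0 (real i / real n)\<bar> \<le> C * rate2 n"
    by (rule finite_exceptions[of "\<lambda>n. {b n<..n}" n0 "\<lambda>n i. \<bar>\<phi> n i 0 - \<phi>fun n 0 (real i / real n)\<bar>" C rate2], simp)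
      (blast intro: int pos(2))+
  then obtain C2 where C2: "0 < C2" "\<forall>n\<ge>2. \<forall>i\<in>{b n<..n}. \<bar>\<phi> n i 0 - \<phi>fun n 0 (real i / real n)\<bar> \<le> C2 * rate2 n"
    by blast
  have "\<exists>C>0. \<forall>n\<ge>2. \<forall>i\<in>{b n<..n}. l2norm (M n) (res n i) \<le> C * rate2 n"
    by (rule finite_exceptions[of "\<lambda>n. {b n<..n}" n0 "\<lambda>n i. l2norm (M n) (res n i)" C rate2], simp)
      (blast intro: res pos(2))+
  then obtain C3 where C3: "\<forall>n\<ge>2. \<forall>i\<in>{b n<..n}. l2norm (M n) (res n i) \<le> C3 * rate2 n"
    by blast
  have "\<exists>C>0. \<forall>n\<ge>2. \<forall>i\<in>{1..n}. l2norm (M n) (\<lambda>\<omega>. x n i \<omega> - xss n i \<omega>) \<le> C * rate2 n"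
    by (rule finite_exceptions[of "\<lambda>n. {1..n}" n0 "\<lambda>n i. l2norm (M n) (\<lambda>\<omega>. x n i \<omega> - xss n i \<omega>)" C rate2], simp)
      (blast intro: ar pos(2))+
  then obtain C4 where C4: "\<forall>n\<ge>2. \<forall>i\<in>{1..n}. l2norm (M n) (\<lambda>\<omega>. x n i \<omega> - xss n i \<omega>) \<le> C4 * rate2 n"
    by blast
  have "\<exists>C>0. \<forall>n\<ge>2. (MAX i\<in>{b n<..n}. dev n i) \<le> C * rate1 n \<and>
       (MAX i\<in>{b n<..n}. \<bar>\<phi> n i 0 - \<phi>fun n 0 (real i / real n)\<bar>) \<le> C * rate2 n"
  proof (intro exI[of _ "C1 + C2"] conjI allI impI)
    fix n :: nat assume n: "2 \<le> n"
    \<comment> \<open>\<open>b n < n\<close> makes the range of i nonempty, so that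
      \<open>Max\<close> is governed by its members.\<close>
    have ne: "{b n<..n} \<noteq> {}" using b[OF n] by auto
    have "(MAX i\<in>{b n<..n}. dev n i) \<le> C1 * rate1 n"
      using C1(2) n ne by (subst Max_le_iff) auto
    also have "\<dots> \<le> (C1 + C2) * rate1 n"
      using C2(1) pos(1)[OF n] by (intro mult_right_mono) auto
    finally show "(MAX i\<in>{b n<..n}. dev n i) \<le> (C1 + C2) * rate1 n" .
    have "(MAX i\<in>{b n<..n}. \<bar>\<phi> n i 0 - \<phi>fun n 0 (real i / real n)\<bar>) \<le> C2 * rate2 n"
      using C2(2) n ne by (subst Max_le_iff) auto
    also have "\<dots> \<le> (C1 + C2) * rate2 n"
      using C1(1) pos(2)[OF n] by (intro mult_right_mono) auto
    finally show "(MAX i\<in>{b n<..n}. \<bar>\<phi> n i 0 - \<phi>fun n 0 (real i / real n)\<bar>) \<le> (C1 + C2) * rate2 n" .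
  qed (use C1 C2 in simp)
  moreover have \<epsilon>_sq: "square_integrable (M n) (\<epsilon> n i)" if "2 \<le> n" "i \<in> {1..n}" for n i
    unfolding \<epsilon>_def using that sq by (intro square_integrable_prediction_error M) auto
  have "bigO_l2 M 2 (\<lambda>n. {b n<..n}) res rate2"
    unfolding bigO_l2_def
  proof (intro exI[of _ C3] allI impI ballI conjI)
    fix n i :: nat assume n: "2 \<le> n" and i: "i \<in> {b n<..n}"
    show "square_integrable (M n) (res n i)"
      unfolding res_def using n i
      by (intro square_integrable_diff square_integrable_add square_integrable_const square_integrable_sum
          square_integrable_cmult \<epsilon>_sq sq M) auto
    show "sqrt (LINT \<omega>|M n. \<bar>res n i \<omega>\<bar>\<^sup>2) \<le> C3 * rate2 n"
      using C3 n i by (simp add: l2norm_def)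
  qed
  moreover have "bigO_l2 M 2 (\<lambda>n. {1..n}) (\<lambda>n i \<omega>. x n i \<omega> - xss n i \<omega>) rate2"
    unfolding bigO_l2_def
  proof (intro exI[of _ C4] allI impI ballI conjI)
    fix n i :: nat assume n: "2 \<le> n" and i: "i \<in> {1..n}"
    show "square_integrable (M n) (\<lambda>\<omega>. x n i \<omega> - xss n i \<omega>)"
      unfolding xss_def
      by (intro square_integrable_diff square_integrable_ar_process[OF M[OF n] sq[OF n] \<epsilon>_sq[OF n] i] sq[OF n i])
    show "sqrt (LINT \<omega>|M n. \<bar>x n i \<omega> - xss n i \<omega>\<bar>\<^sup>2) \<le> C4 * rate2 n"
      using C4 n i by (simp add: l2norm_def)
  qed
  ultimately show ?thesis
    using regular unfolding dev_def res_def by blast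
qed

end
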